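(* Let $d\ge 1$ and let $X=\{X_t\}_{t\ge 0}$ be a Lévy process on $\mathbf{R}^d$ with characteristic exponent $\Psi$ and $L^2$-generator $\mathscr{L}$. Let $\bar X_t:=X_t-X'_t$ be its symmetrization, where $X'$ is an independent copy of $X$. Then the stochastic heat equation $$\partial_t H(t,x)=(\mathscr{L}H)(t,x)+\dot w(t,x),\qquad H(0,x)=0,\qquad (t\ge 0,\ x\in\mathbf{R}^d),$$ has random-field solutions if and only if the symmetric Lévy process $\bar X$ has local times. Moreover, if $X$ is itself symmetric, then the stochastic wave equation $$\partial_{tt} W(t,x)=(\mathscr{L}W)(t,x)+\dot w(t,x),\qquad W(0,x)=\partial_t W(0,x)=0,$$ has random-field solutions if and only if $\bar X$ has local times.
   Context: Lévy process: $X_0=0$, $\mathrm{E}\,e^{i\xi\cdot X_t}=e^{-t\Psi(\xi)}$. Fourier transform: $\hat f(\xi)=\int_{\mathbf{R}^d}e^{i\xi\cdot x}f(x)\,dx$. $\mathscr{L}$ is the $L^2(\mathbf{R}^d)$-generator of $X$, i.e. the operator with Fourier multiplier $-\overline{\Psi(\xi)}$. $(P^*_tf)(x):=\mathrm{E} f(x-X_t)$. $\mathscr{S}(\mathbf{R}^d)$ is the space of rapidly decreasing test functions. $\dot w$ is space-time white noise on $\mathbf{R}_+\times\mathbf{R}^d$, and $w(h)=\int\!\!\int h\,dw$ is its Wiener integral for $h\in L^2(\mathbf{R}_+\times\mathbf{R}^d)$; $\hat w(h):=(2\pi)^{-d/2}w(\hat h)$, where $\hat h$ is the Fourier transform in the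 spatial variable. $X$ is symmetric if $X_t$ and $-X_t$ have the same law for all $t$, equivalently $\Psi$ is real and nonnegative. Weak solution of the heat equation: for $t\ge0$, $\phi\in\mathscr{S}(\mathbf{R}^d)$, $H(t,\phi):=\int_0^t\int_{\mathbf{R}^d}(P^*_{t-s}\phi)(y)\,w(dy\,ds)$. Weak solution of the wave equation (when $X$ is symmetric): $W(t,\phi):=(2\pi)^{-d/2}\int_{\mathbf{R}^d}\int_0^t\frac{\sin(\sqrt{\Psi(\xi)}\,(t-s))}{\sqrt{\Psi(\xi)}}\,\overline{\hat\phi(\xi)}\,\hat w(ds\,d\xi)$ (the quotient is read as $t-s$ where $\Psi(\xi)=0$). Random-field solutions: let $u$ be the weak solution ($H$ or $W$), $d_t(\phi):=\sqrt{\mathrm{E}(|u(t,\phi)|^2)}$ for $\phi\in\mathscr{S}(\mathbf{R}^d)$, and let $M_t$ be the completion of $\mathscr{S}(\mathbf{R}^d)$ inside the space of Schwartz distributions with respect to the metric $(\phi,\psi)\mapsto d_t(\phi-\psi)$ (i.e. distributions that are distributional limits of $d_t$-Cauchy sequences in $\mathscr{S}(\mathbf{R}^d)$; the condition is void at $t=0$). Put $M:=\bigcap_{t\ge0}M_t$. The equation has random-field solutions iff $\delta_x\in M$ for all $x\in\mathbf{R}^d$ ($\delta_x$ is the point mass at $x$). Local times: a process $Y$ on $\mathbf{R}^d$ has local times if, for all $t$, the occupation measure $Z(t,\phi):=\int_0^t\phi(Y_s)\,ds$ is absolutely continuous with respect to Lebesgue measure (almost surely); the local times are the densities $Z(t,x)=Z(t,dx)/dx$.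 *)

theory Defs
  imports "HOL-Probability.Probability"
begin

section \<open>Test functions and distributions\<close>

text \<open>The partial derivative along a list of directions; for lists over \<^const>\<open>Basis\<close> these
  are the iterated partial derivatives, each list standing for a multi-index.\<close>

primrec iter_deriv :: "'a::euclidean_space list \<Rightarrow> ('a \<Rightarrow> complex) \<Rightarrow> 'a \<Rightarrow> complex" where
  "iter_deriv [] f = f"
| "iter_deriv (b # bs) f = (\<lambda>x. frechet_derivative (iter_deriv bs f) (at x) b)"

definition schwartz :: "('a::euclidean_space \<Rightarrow> complex) set" where
  "schwartz = {f. \<forall>bs\<in>lists Basis. iter_deriv bs f differentiable_on UNIV \<and>
     (\<forall>k::nat. bounded (range (\<lambda>x. (1 + norm x) ^ k *\<^sub>R iter_deriv bs f x)))}"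

definition schwartz_seminorm :: "nat \<Rightarrow> 'a::euclidean_space list \<Rightarrow> ('a \<Rightarrow> complex) \<Rightarrow> real" where
  "schwartz_seminorm k bs f = (SUP x. (1 + norm x) ^ k * cmod (iter_deriv bs f x))"

text \<open>Schwartz (tempered) distributions: the linear functionals on \<^const>\<open>schwartz\<close> that are
  continuous, i.e. bounded by finitely many seminorms. A functional is a function on all
  of \<^typ>\<open>'a \<Rightarrow> complex\<close>, but only its values on \<^const>\<open>schwartz\<close> matter.\<close>

definition schwartz_distribution :: "(('a::euclidean_space \<Rightarrow> complex) \<Rightarrow> complex) \<Rightarrow> bool" where
  "schwartz_distribution T \<longleftrightarrow>
     (\<forall>f\<in>schwartz. \<forall>g\<in>schwartz. T (\<lambda>x. f x + g x) = T f + T g) \<and>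
     (\<forall>c. \<forall>f\<in>schwartz. T (\<lambda>x. c * f x) = c * T f) \<and>
     (\<exists>C k n. \<forall>f\<in>schwartz.
        cmod (T f) \<le> C * (\<Sum>bs | bs \<in> lists Basis \<and> length bs \<le> n. schwartz_seminorm k bs f))"

definition dirac :: "'a::euclidean_space \<Rightarrow> ('a \<Rightarrow> complex) \<Rightarrow> complex" where
  "dirac x = (\<lambda>f. f x)"

definition fourier :: "('a::euclidean_space \<Rightarrow> complex) \<Rightarrow> 'a \<Rightarrow> complex" where
  "fourier f \<xi> = (LINT x|lborel. iexp (\<xi> \<bullet> x) * f x)"


section \<open>Levy processes\<close>

locale levy_process = prob_space M for M :: "'w measure" +
  fixes X :: "real \<Rightarrow> 'w \<Rightarrow> 'a::euclidean_space"
  assumes rv: "\<And>t. 0 \<le> t \<Longrightarrow> X t \<in> borel_measurable M"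
    and start: "AE \<omega> in M. X 0 \<omega> = 0"
    and indep_increments: "\<And>(\<tau> :: nat \<Rightarrow> real) n. 0 \<le> \<tau> 0 \<Longrightarrow> mono \<tau> \<Longrightarrow>
      indep_vars (\<lambda>_. borel) (\<lambda>i \<omega>. X (\<tau> (Suc i)) \<omega> - X (\<tau> i) \<omega>) {..<n}"
    and stationary_increments: "\<And>s h. 0 \<le> s \<Longrightarrow> 0 \<le> h \<Longrightarrow>
      distr M borel (\<lambda>\<omega>. X (s + h) \<omega> - X s \<omega>) = distr M borel (X h)"
    and cadlag: "AE \<omega> in M. \<forall>t\<ge>0. ((\<lambda>s. X s \<omega>) \<longlongrightarrow> X t \<omega>) (at_right t) \<and>
      (0 < t \<longrightarrow> (\<exists>l. ((\<lambda>s. X s \<omega>) \<longlongrightarrow> l) (at_left t)))"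

text \<open>Since the identity is required for every \<open>t \<ge> 0\<close>, it determines \<open>\<Psi>\<close> uniquely.\<close>

definition characteristic_exponent ::
    "'w measure \<Rightarrow> (real \<Rightarrow> 'w \<Rightarrow> 'a::euclidean_space) \<Rightarrow> ('a \<Rightarrow> complex) \<Rightarrow> bool" where
  "characteristic_exponent M X \<Psi> \<longleftrightarrow>
     (\<forall>t\<ge>0. \<forall>\<xi>. (LINT \<omega>|M. iexp (\<xi> \<bullet> X t \<omega>)) = exp (- complex_of_real t * \<Psi> \<xi>))"

definition symmetric_process ::
    "'w measure \<Rightarrow> (real \<Rightarrow> 'w \<Rightarrow> 'a::euclidean_space) \<Rightarrow> bool" where
  "symmetric_process M X \<longleftrightarrow>
     (\<forall>t\<ge>0. distr M borel (X t) = distr M borel (\<lambda>\<omega>. - X t \<omega>))"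

definition trajectory :: "(real \<Rightarrow> 'w \<Rightarrow> 'a) \<Rightarrow> 'w \<Rightarrow> real \<Rightarrow> 'a" where
  "trajectory X \<omega> = (\<lambda>t\<in>{0..}. X t \<omega>)"

definition independent_copy ::
    "'w measure \<Rightarrow> (real \<Rightarrow> 'w \<Rightarrow> 'a::euclidean_space) \<Rightarrow> (real \<Rightarrow> 'w \<Rightarrow> 'a) \<Rightarrow> bool" where
  "independent_copy M X X' \<longleftrightarrow>
     prob_space.indep_var M (\<Pi>\<^sub>M t\<in>{0..}. borel) (trajectory X) (\<Pi>\<^sub>M t\<in>{0..}. borel) (trajectory X') \<and>
     distr M (\<Pi>\<^sub>M t\<in>{0..}. borel) (trajectory X') = distr M (\<Pi>\<^sub>M t\<in>{0..}. borel) (trajectory X)"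

text \<open>\<open>P\<^sup>*\<^sub>t f\<close>\<close>

definition dual_semigroup ::
    "'w measure \<Rightarrow> (real \<Rightarrow> 'w \<Rightarrow> 'a::euclidean_space) \<Rightarrow> real \<Rightarrow> ('a \<Rightarrow> complex) \<Rightarrow> 'a \<Rightarrow> complex" where
  "dual_semigroup M X t f x = (LINT \<omega>|M. f (x - X t \<omega>))"

text \<open>\<open>A \<mapsto> \<integral>\<^sub>0\<^sup>t 1\<^sub>A (Y\<^sub>s(\<omega>)) ds\<close>, the image of Lebesgue measure on \<open>[0, t]\<close> under the path.\<close>

definition occupation_measure ::
    "(real \<Rightarrow> 'w \<Rightarrow> 'a::euclidean_space) \<Rightarrow> real \<Rightarrow> 'w \<Rightarrow> 'a measure" where
  "occupation_measure Y t \<omega> = distr (restrict_space lborel {0..t}) borel (\<lambda>s. Y s \<omega>)"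

definition has_local_times :: "'w measure \<Rightarrow> (real \<Rightarrow> 'w \<Rightarrow> 'a::euclidean_space) \<Rightarrow> bool" where
  "has_local_times M Y \<longleftrightarrow>
     (\<forall>t\<ge>0. AE \<omega> in M. absolutely_continuous lborel (occupation_measure Y t \<omega>))"


section \<open>Space-time white noise\<close>

definition spacetime :: "(real \<times> 'a::euclidean_space) measure" where
  "spacetime = restrict_space lborel {0..} \<Otimes>\<^sub>M lborel"

definition square_integrable :: "'b measure \<Rightarrow> ('b \<Rightarrow> real) \<Rightarrow> bool" where
  "square_integrable \<mu> h \<longleftrightarrow> h \<in> borel_measurable \<mu> \<and> integrable \<mu> (\<lambda>z. (h z)\<^sup>2)"

text \<open>Centred Gaussian variables, including the degenerate one.\<close>

definition centred_gaussian :: "'p measure \<Rightarrow> ('p \<Rightarrow> real) \<Rightarrow> bool" where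
  "centred_gaussian P Z \<longleftrightarrow> Z \<in> borel_measurable P \<and>
     ((AE \<omega> in P. Z \<omega> = 0) \<or> (\<exists>\<sigma>>0. distributed P lborel Z (normal_density 0 \<sigma>)))"

text \<open>White noise is given by its Wiener integral \<open>h \<mapsto> w h\<close>, the isonormal Gaussian process
  over \<open>L\<^sup>2(\<real>\<^sub>+ \<times> \<real>\<^sup>d)\<close>; the noise of a Borel set \<open>A\<close> of finite measure is
  \<open>w (indicator A)\<close>. Linearity of \<open>w\<close> (almost surely) follows from the covariance. The
  values of \<open>w\<close> outside the square integrable functions are irrelevant.\<close>

locale white_noise = prob_space P for P :: "'p measure" +
  fixes w :: "(real \<times> 'a::euclidean_space \<Rightarrow> real) \<Rightarrow> 'p \<Rightarrow> real"
  assumes gaussian: "\<And>H c. finite H \<Longrightarrow> (\<And>h. h \<in> H \<Longrightarrow> square_integrable spacetime h) \<Longrightarrow>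
      centred_gaussian P (\<lambda>\<omega>. \<Sum>h\<in>H. c h * w h \<omega>)"
    and covariance: "\<And>g h. square_integrable spacetime g \<Longrightarrow> square_integrable spacetime h \<Longrightarrow>
      expectation (\<lambda>\<omega>. w g \<omega> * w h \<omega>) = (LINT z|spacetime. g z * h z)"

definition wiener_integral ::
    "((real \<times> 'a::euclidean_space \<Rightarrow> real) \<Rightarrow> 'p \<Rightarrow> real) \<Rightarrow>
      (real \<times> 'a \<Rightarrow> complex) \<Rightarrow> 'p \<Rightarrow> complex" where
  "wiener_integral w h \<omega> = Complex (w (\<lambda>z. Re (h z)) \<omega>) (w (\<lambda>z. Im (h z)) \<omega>)"

text \<open>The integral defining the spatial Fourier transform converges when the sections
  \<open>h (s, \<cdot>)\<close> are integrable, which holds for the integrand of the wave equation; no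
  extension to all of \<open>L\<^sup>2\<close> is needed.\<close>

definition wiener_integral_hat ::
    "((real \<times> 'a::euclidean_space \<Rightarrow> real) \<Rightarrow> 'p \<Rightarrow> real) \<Rightarrow>
      (real \<times> 'a \<Rightarrow> complex) \<Rightarrow> 'p \<Rightarrow> complex" where
  "wiener_integral_hat w h \<omega> =
     complex_of_real ((2 * pi) powr (- real DIM('a) / 2)) *
     wiener_integral w (\<lambda>(s, x). fourier (\<lambda>\<xi>. h (s, \<xi>)) x) \<omega>"


section \<open>Weak and random-field solutions\<close>

definition heat_solution ::
    "'w measure \<Rightarrow> (real \<Rightarrow> 'w \<Rightarrow> 'a::euclidean_space) \<Rightarrow>
      ((real \<times> 'a \<Rightarrow> real) \<Rightarrow> 'p \<Rightarrow> real) \<Rightarrow> real \<Rightarrow> ('a \<Rightarrow> complex) \<Rightarrow> 'p \<Rightarrow> complex" where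
  "heat_solution M X w t \<phi> =
     wiener_integral w (\<lambda>(s, y). indicator {0..t} s * dual_semigroup M X (t - s) \<phi> y)"

text \<open>\<open>sin (\<surd>v r) / \<surd>v\<close>, continued to \<open>v = 0\<close>\<close>

definition wave_kernel :: "real \<Rightarrow> real \<Rightarrow> real" where
  "wave_kernel v r = (if v = 0 then r else sin (sqrt v * r) / sqrt v)"

text \<open>Only used for symmetric processes, whose exponent is real and nonnegative; hence the
  real part.\<close>

definition wave_solution ::
    "('a::euclidean_space \<Rightarrow> complex) \<Rightarrow>
      ((real \<times> 'a \<Rightarrow> real) \<Rightarrow> 'p \<Rightarrow> real) \<Rightarrow> real \<Rightarrow> ('a \<Rightarrow> complex) \<Rightarrow> 'p \<Rightarrow> complex" where
  "wave_solution \<Psi> w t \<phi> \<omega> =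
     complex_of_real ((2 * pi) powr (- real DIM('a) / 2)) *
     wiener_integral_hat w (\<lambda>(s, \<xi>). indicator {0..t} s *
       complex_of_real (wave_kernel (Re (\<Psi> \<xi>)) (t - s)) * cnj (fourier \<phi> \<xi>)) \<omega>"

definition solution_dist ::
    "'p measure \<Rightarrow> (real \<Rightarrow> ('a::euclidean_space \<Rightarrow> complex) \<Rightarrow> 'p \<Rightarrow> complex) \<Rightarrow>
      real \<Rightarrow> ('a \<Rightarrow> complex) \<Rightarrow> real" where
  "solution_dist P u t \<phi> = sqrt (LINT \<omega>|P. (cmod (u t \<phi> \<omega>))\<^sup>2)"

definition solution_completion ::
    "'p measure \<Rightarrow> (real \<Rightarrow> ('a::euclidean_space \<Rightarrow> complex) \<Rightarrow> 'p \<Rightarrow> complex) \<Rightarrow>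
      real \<Rightarrow> (('a \<Rightarrow> complex) \<Rightarrow> complex) set" where
  "solution_completion P u t = {T. schwartz_distribution T \<and>
     (\<exists>\<phi> :: nat \<Rightarrow> 'a \<Rightarrow> complex.
        (\<forall>n. \<phi> n \<in> schwartz) \<and>
        (\<forall>e>0. \<exists>N. \<forall>m\<ge>N. \<forall>n\<ge>N. solution_dist P u t (\<lambda>x. \<phi> m x - \<phi> n x) < e) \<and>
        (\<forall>\<psi>\<in>schwartz. (\<lambda>n. LINT x|lborel. \<phi> n x * \<psi> x) \<longlonglongrightarrow> T \<psi>))}"

definition has_random_field_solutions ::
    "'p measure \<Rightarrow> (real \<Rightarrow> ('a::euclidean_space \<Rightarrow> complex) \<Rightarrow> 'p \<Rightarrow> complex) \<Rightarrow> bool" where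
  "has_random_field_solutions P u \<longleftrightarrow>
     (\<forall>x. dirac x \<in> (\<Inter>t\<in>{0..}. solution_completion P u t))"

end

theory Submission
  imports Defs
begin

text \<open>
  Write \<open>\<psi> = Re \<Psi>\<close>. Both sides of each equivalence are shown to be equivalent to Dalang's condition
  \<open>\<integral> 1 / (1 + \<psi>) < \<infinity>\<close>.

  By the Wiener isometry and Plancherel's identity, \<open>d\<^sub>t(\<phi>)\<^sup>2\<close> is comparable, for each \<open>t > 0\<close>, with the energy
  \<open>\<integral> \<bar>F \<phi>\<bar>\<^sup>2 / (1 + \<psi>)\<close>, where \<open>F\<close> is the Fourier transform, for the heat and for the wave equation alike. If Dalang's condition holds,
  Gaussian mollifiers are Cauchy in this energy and converge to a point mass. Conversely, if
  \<open>\<phi>\<^sub>n \<rightarrow> \<delta>\<^sub>0\<close> and the energies stay bounded, then the Gaussian averages of \<open>F \<phi>\<^sub>n\<close> converge pointwise to \<open>1\<close>.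
  Averaging increases the energy by at most a constant factor because
  \<open>\<psi>(\<xi> + \<eta>) \<le> 2 \<psi>(\<xi>) + 2 \<psi>(\<eta>)\<close>, and Fatou's lemma gives Dalang's condition.

  For the local times of the symmetrization \<open>Y\<close>, whose exponent is \<open>2 \<psi>\<close>: under Dalang's condition the Fourier
  transform of the occupation measure is almost surely square integrable. Conversely let \<open>k\<close> be a
  narrow Gaussian density and \<open>A = \<integral>\<^sub>0\<^sup>1 k(Y\<^bsub>s+a\<^esub> - Y\<^sub>s) da\<close>. Positivity of the Fourier transforms gives
  \<open>E A\<^sup>2 \<le> 2 (E A)\<^sup>2\<close>, so \<open>A\<close> exceeds half its mean with probability at least \<open>1/8\<close> (Paley and Zygmund), and
  the mean diverges when Dalang's condition fails. But if the occupation measure is absolutely continuous, then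
  Markov's inequality shows that \<open>A\<close> is unlikely to be large.
\<close>

section \<open>Gaussians and their Fourier transforms\<close>

text \<open>Membership in the completion gives convergence only after pairing with test functions,
  so the transforms of the approximating sequence need not converge at any point. Pairing with
  modulated Gaussians replaces them by Gaussian averages, and the weight survives because
  translation by \<open>\<eta>\<close> changes it by a factor of at most
  \<open>2 (1 + \<psi>(\<eta>))\<close>. The inequality behind this comes from
  \<open>1 - cos (a + b) \<le> 2 (1 - cos a) + 2 (1 - cos b)\<close>, integrated over two
  independent copies of \<open>X\<^sub>t\<close> and differentiated at \<open>t = 0\<close>. Energy
  and local times meet in one time integral: that of \<open>exp (- 2 a \<psi>)\<close> over
  \<open>0 \<le> a \<le> t\<close> is of the order of \<open>1 / (1 + \<psi>)\<close>. It is the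
  multiplier of the heat equation, it bounds the second moment of the transformed occupation
  measure, and up to a Gaussian factor its integral over all frequencies is the mean of
  \<open>A\<close>. For the contradiction the widths are chosen so that the mean of \<open>A\<close>
  is at least \<open>2 * 2 ^ n\<close>. Then \<open>A\<close> exceeds \<open>2 ^ n\<close> with
  probability at least \<open>1/8\<close> for every \<open>n\<close>, at every fixed time, whereas
  Borel-Cantelli lets this happen only finitely often at almost every time.\<close>

definition gauss_density :: "real \<Rightarrow> 'a::euclidean_space \<Rightarrow> real" where
  "gauss_density \<sigma> x = (\<Prod>b\<in>Basis. normal_density 0 \<sigma> (x \<bullet> b))"

lemma norm_sq_eq_sum: "(norm (x::'a::euclidean_space))\<^sup>2 = (\<Sum>b\<in>Basis. (x \<bullet> b)\<^sup>2)"
  by (subst power2_norm_eq_inner, subst euclidean_inner, simp add: power2_eq_square)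

lemma gauss_density_eq:
  assumes "0 < \<sigma>"
  shows "gauss_density \<sigma> (x::'a::euclidean_space) =
    exp (- (norm x)\<^sup>2 / (2 * \<sigma>\<^sup>2)) / (sqrt (2 * pi) * \<sigma>) ^ DIM('a)"
proof -
  have "sqrt (2 * pi * \<sigma>\<^sup>2) = sqrt (2*pi) * \<sigma>"
    using assms by (simp add: real_sqrt_mult)
  then show ?thesis
    unfolding gauss_density_def normal_density_def
    by (simp add: prod.distrib prod_dividef exp_sum[symmetric] sum_negf sum_divide_distrib
        norm_sq_eq_sum)
qed

lemma gauss_density_nonneg [simp]: "0 \<le> gauss_density \<sigma> x"
  by (simp add: gauss_density_def prod_nonneg)

lemma borel_measurable_gauss_density [measurable]: "gauss_density \<sigma> \<in> borel_measurable borel"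
  unfolding gauss_density_def by simp

text \<open>By \<open>lborel_eq\<close> Lebesgue measure is the image of the product measure over
  \<open>Basis\<close>, so a product of functions of single coordinates falls to Fubini on the
  product.\<close>

lemma
  fixes f :: "'a::euclidean_space \<Rightarrow> real \<Rightarrow> 'b::{real_normed_field,banach,second_countable_topology}"
  assumes f: "\<And>b. b \<in> Basis \<Longrightarrow> integrable lborel (f b)"
  shows integrable_lborel_prod: "integrable lborel (\<lambda>x::'a. \<Prod>b\<in>Basis. f b (x \<bullet> b))"
    and integral_lborel_prod: "(LINT x|lborel. (\<Prod>b\<in>Basis. f b (x \<bullet> b))) = (\<Prod>b\<in>Basis. LINT x|lborel. f b x)"
proof -
  interpret product_sigma_finite "\<lambda>_::'a. lborel :: real measure" by standard
  have [measurable]: "\<And>b. b \<in> Basis \<Longrightarrow> f b \<in> borel_measurable borel"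
    using f by (auto dest: borel_measurable_integrable)
  have *: "(\<Sum>c\<in>Basis. g c *\<^sub>R c) \<bullet> b = g b" if "b \<in> Basis" for g and b :: 'a
    using that by (simp add: inner_sum_left inner_Basis if_distrib sum.delta cong: if_cong)
  have eq: "(\<Prod>b\<in>Basis. f b ((\<Sum>c\<in>Basis. g c *\<^sub>R c) \<bullet> b)) = (\<Prod>b\<in>Basis. f b (g b))" for g
    by (intro prod.cong refl) (simp add: *)
  have [measurable]: "(\<lambda>x::'a. \<Prod>b\<in>Basis. f b (x \<bullet> b)) \<in> borel_measurable borel"
    by (intro borel_measurable_prod) measurable
  show "integrable lborel (\<lambda>x::'a. \<Prod>b\<in>Basis. f b (x \<bullet> b))"
    by (subst lborel_eq, subst integrable_distr_eq)
      (auto simp: eq intro!: product_integrable_prod f)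
  show "(LINT x|lborel. (\<Prod>b\<in>Basis. f b (x \<bullet> b))) = (\<Prod>b\<in>Basis. LINT x|lborel. f b x)"
    by (subst lborel_eq, subst integral_distr)
      (auto simp: eq intro!: product_integral_prod f)
qed

lemma normal_density_scale:
  assumes "0 < \<sigma>"
  shows "normal_density 0 \<sigma> (\<sigma> * x) = std_normal_density x / \<sigma>"
  using assms by (simp add: normal_density_def real_sqrt_mult power_mult_distrib)

lemma fourier_normal_density:
  assumes "0 < \<sigma>"
  shows "(LINT x|lborel. iexp (t * x) * complex_of_real (normal_density 0 \<sigma> x)) = exp (- (\<sigma> * t)\<^sup>2 / 2)"
proof -
  have "(LINT x|lborel. iexp (t * x) * complex_of_real (normal_density 0 \<sigma> x)) =
     \<bar>\<sigma>\<bar> *\<^sub>R (LINT x|lborel. iexp (t * (0 + \<sigma> * x)) * complex_of_real (normal_density 0 \<sigma> (0 + \<sigma> * x)))"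
    using assms by (intro lborel_integral_real_affine) auto
  also have "\<dots> = (LINT x|lborel. iexp ((\<sigma> * t) * x) * std_normal_density x)"
  proof -
    have "complex_of_real \<sigma> * (iexp (t * (0 + \<sigma> * x)) * complex_of_real (normal_density 0 \<sigma> (0 + \<sigma> * x)))
      = iexp ((\<sigma> * t) * x) * std_normal_density x" for x
      using assms normal_density_scale[OF assms, of x] by (simp add: mult_ac)
    then show ?thesis using assms
      by (simp add: scaleR_conv_of_real flip: integral_mult_right_zero)
  qed
  also have "\<dots> = char std_normal_distribution (\<sigma> * t)"
    unfolding char_def
    by (subst integral_density) (auto simp: scaleR_conv_of_real ac_simps)
  also have "\<dots> = exp (- (\<sigma> * t)\<^sup>2 / 2)"
    by (simp add: char_std_normal_distribution)
  finally show ?thesis .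
qed

lemma integrable_gauss_density:
  assumes "0 < \<sigma>" shows "integrable lborel (gauss_density \<sigma> :: 'a::euclidean_space \<Rightarrow> real)"
  unfolding gauss_density_def using assms by (intro integrable_lborel_prod) auto

lemma integral_gauss_density:
  assumes "0 < \<sigma>" shows "(LINT x|lborel. gauss_density \<sigma> (x::'a::euclidean_space)) = 1"
  unfolding gauss_density_def using assms by (subst integral_lborel_prod) auto

lemma nn_integral_gauss_density:
  assumes "0 < \<sigma>" shows "(\<integral>\<^sup>+ x. ennreal (gauss_density \<sigma> (x::'a::euclidean_space)) \<partial>lborel) = 1"
  using assms by (subst nn_integral_eq_integral) (auto simp: integrable_gauss_density integral_gauss_density)

lemma iexp_inner: "iexp (x \<bullet> y) = (\<Prod>b\<in>Basis. iexp ((x \<bullet> b) * (y \<bullet> b)))" for x y :: "'a::euclidean_space"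
  by (subst euclidean_inner) (simp add: exp_sum sum_distrib_left)

lemma fourier_gauss_density:
  assumes "0 < \<sigma>"
  shows "fourier (\<lambda>x. complex_of_real (gauss_density \<sigma> x)) \<xi> = exp (- (\<sigma> * norm \<xi>)\<^sup>2 / 2)"
proof -
  have int: "integrable lborel (\<lambda>x. iexp (t * x) * complex_of_real (normal_density 0 \<sigma> x))" for t
    using assms by (intro Bochner_Integration.integrable_bound[OF integrable_normal_density[of \<sigma> 0]]) (auto simp: norm_mult)
  have "fourier (\<lambda>x. complex_of_real (gauss_density \<sigma> x)) \<xi> =
      (LINT x|lborel. (\<Prod>b\<in>Basis. iexp ((\<xi> \<bullet> b) * (x \<bullet> b)) * complex_of_real (normal_density 0 \<sigma> (x \<bullet> b))))"
    unfolding fourier_def gauss_density_def iexp_inner by (simp add: prod.distrib)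
  also have "\<dots> = (\<Prod>b\<in>Basis. LINT x|lborel. iexp ((\<xi> \<bullet> b) * x) * complex_of_real (normal_density 0 \<sigma> x))"
    using int by (intro integral_lborel_prod) auto
  also have "\<dots> = (\<Prod>b\<in>Basis. complex_of_real (exp (- (\<sigma> * (\<xi> \<bullet> b))\<^sup>2 / 2)))"
    using fourier_normal_density[OF assms] by (intro prod.cong refl) simp
  also have "\<dots> = complex_of_real (exp (\<Sum>b\<in>Basis. - (\<sigma> * (\<xi> \<bullet> b))\<^sup>2 / 2))"
    by (simp only: exp_sum of_real_prod finite_Basis)
  also have "(\<Sum>b\<in>Basis. - (\<sigma> * (\<xi> \<bullet> b))\<^sup>2 / 2) = - (\<sigma> * norm \<xi>)\<^sup>2 / 2"
    by (simp add: power_mult_distrib norm_sq_eq_sum sum_distrib_left sum_negf sum_divide_distrib)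
  finally show ?thesis .
qed

text \<open>The characteristic function of \<open>gauss_density \<sigma>\<close>. Up to a constant
  it is again a Gaussian density, of width \<open>1 / \<sigma>\<close>, so transforms in both
  directions are explicit.\<close>

definition gauss_exp :: "real \<Rightarrow> 'a::euclidean_space \<Rightarrow> real" where
  "gauss_exp \<sigma> \<xi> = exp (- (\<sigma> * norm \<xi>)\<^sup>2 / 2)"

lemma borel_measurable_gauss_exp [measurable]: "gauss_exp \<sigma> \<in> borel_measurable borel"
  unfolding gauss_exp_def by simp

lemma gauss_exp_pos [simp]: "0 < gauss_exp \<sigma> x" and gauss_exp_le_1 [simp]: "gauss_exp \<sigma> x \<le> 1"
  and gauss_exp_nonneg [simp]: "0 \<le> gauss_exp \<sigma> x"
  by (simp_all add: gauss_exp_def)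

lemma gauss_exp_conv_density:
  assumes "0 < \<sigma>"
  shows "gauss_exp \<sigma> (x::'a::euclidean_space) = (sqrt (2 * pi) / \<sigma>) ^ DIM('a) * gauss_density (1 / \<sigma>) x"
proof -
  have "(sqrt (2 * pi) / \<sigma>) ^ DIM('a) \<noteq> 0"
    using assms by simp
  moreover have "(norm x)\<^sup>2 / (2 * (1 / \<sigma>)\<^sup>2) = (\<sigma> * norm x)\<^sup>2 / 2"
    by (simp add: power_divide power_mult_distrib)
  ultimately show ?thesis
    using assms by (simp add: gauss_density_eq gauss_exp_def)
qed

lemma integrable_gauss_exp:
  assumes "0 < \<sigma>" shows "integrable lborel (gauss_exp \<sigma> :: 'a::euclidean_space \<Rightarrow> real)"
  unfolding gauss_exp_conv_density[OF assms] using assms by (auto intro!: integrable_mult_right integrable_gauss_density)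

lemma fourier_gauss_exp:
  assumes "0 < \<sigma>"
  shows "fourier (\<lambda>x. complex_of_real (gauss_exp \<sigma> x)) (\<xi>::'a::euclidean_space) = (2 * pi) ^ DIM('a) * gauss_density \<sigma> \<xi>"
proof -
  have "fourier (\<lambda>x. complex_of_real (gauss_exp \<sigma> x)) \<xi> =
    (LINT x|lborel. complex_of_real ((sqrt (2 * pi) / \<sigma>) ^ DIM('a)) * (iexp (\<xi> \<bullet> x) * complex_of_real (gauss_density (1/\<sigma>) x)))"
    using assms unfolding fourier_def by (simp add: gauss_exp_conv_density ac_simps)
  also have "\<dots> = complex_of_real ((sqrt (2 * pi) / \<sigma>) ^ DIM('a)) * exp (- (1 / \<sigma> * norm \<xi>)\<^sup>2 / 2)"
    using fourier_gauss_density[of "1/\<sigma>" \<xi>] assms unfolding fourier_def by simp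
  also have "\<dots> = complex_of_real ((2 * pi) ^ DIM('a) * gauss_density \<sigma> \<xi>)"
  proof -
    define A where "A = sqrt (2 * pi) ^ DIM('a)"
    have 1: "(2 * pi) ^ DIM('a) = A * A"
      unfolding A_def power_mult_distrib[symmetric] by (simp only: real_sqrt_mult_self abs_of_pos) simp
    have 2: "(1 / \<sigma> * norm \<xi>)\<^sup>2 / 2 = (norm \<xi>)\<^sup>2 / (2 * \<sigma>\<^sup>2)"
      by (simp add: power_divide power_mult_distrib)
    have 3: "A \<noteq> 0" by (simp add: A_def)
    have 4: "gauss_density \<sigma> \<xi> = exp (- (1 / \<sigma> * norm \<xi>)\<^sup>2 / 2) / (A * \<sigma> ^ DIM('a))"
      using 2 by (simp only: gauss_density_eq[OF assms] minus_divide_left[symmetric] power_mult_distrib[of "sqrt (2 * pi)"] A_def)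
    have "(sqrt (2 * pi) / \<sigma>) ^ DIM('a) * exp (- (1 / \<sigma> * norm \<xi>)\<^sup>2 / 2) = (2 * pi) ^ DIM('a) * gauss_density \<sigma> \<xi>"
      unfolding 1 4 power_divide A_def[symmetric] using 3 by simp
    then show ?thesis
      unfolding of_real_mult[symmetric] by (simp only:)
  qed
  finally show ?thesis by simp
qed

section \<open>Plancherel's identity and convolution with finite measures\<close>

lemma borel_measurable_cnj [measurable]: "cnj \<in> borel_measurable borel"
  by (intro borel_measurable_continuous_onI continuous_intros)

lemma norm_integral_le:
  fixes f :: "_ \<Rightarrow> _::{banach,second_countable_topology}"
  assumes f: "f \<in> borel_measurable M" and g: "integrable M g" and le: "\<And>x. norm (f x) \<le> g x"
  shows "norm (integral\<^sup>L M f) \<le> integral\<^sup>L M g"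
proof -
  have g0: "0 \<le> g x" for x
    using order_trans[OF norm_ge_zero le] .
  have "integrable M f"
    using g f by (rule Bochner_Integration.integrable_bound) (use le g0 in auto)
  then show ?thesis
    using le g by (intro order_trans[OF integral_norm_bound integral_mono]) auto
qed


text \<open>Most later exchanges of complex integrals have an integrand dominated by a product of
  functions of one variable each; this form settles joint integrability once for them.\<close>

lemma (in pair_sigma_finite)
  fixes f :: "'a \<Rightarrow> 'b \<Rightarrow> 'c::{banach,second_countable_topology}"
  assumes f [measurable]: "case_prod f \<in> borel_measurable (M1 \<Otimes>\<^sub>M M2)"
    and a: "integrable M1 a" and b: "integrable M2 b"
    and le: "\<And>x y. norm (f x y) \<le> a x * (b y :: real)"
  shows integrable_product_bound: "integrable (M1 \<Otimes>\<^sub>M M2) (case_prod f)"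
    and Fubini_product_bound: "(\<integral>y. (\<integral>x. f x y \<partial>M1) \<partial>M2) = (\<integral>x. (\<integral>y. f x y \<partial>M2) \<partial>M1)"
proof -
  have [measurable]: "a \<in> borel_measurable M1" "b \<in> borel_measurable M2"
    using a b by (auto dest: borel_measurable_integrable)
  have "(\<integral>\<^sup>+z. ennreal (norm (case_prod f z)) \<partial>(M1 \<Otimes>\<^sub>M M2)) \<le>
      (\<integral>\<^sup>+z. ennreal \<bar>a (fst z)\<bar> * ennreal \<bar>b (snd z)\<bar> \<partial>(M1 \<Otimes>\<^sub>M M2))"
  proof (intro nn_integral_mono)
    fix z show "ennreal (norm (case_prod f z)) \<le> ennreal \<bar>a (fst z)\<bar> * ennreal \<bar>b (snd z)\<bar>"
      using le[of "fst z" "snd z"] abs_ge_self[of "a (fst z) * b (snd z)"]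
      by (auto simp: ennreal_mult[symmetric] abs_mult split: prod.split intro!: ennreal_leI)
  qed
  also have "\<dots> = (\<integral>\<^sup>+x. ennreal \<bar>a x\<bar> \<partial>M1) * (\<integral>\<^sup>+y. ennreal \<bar>b y\<bar> \<partial>M2)"
    by (subst M2.nn_integral_fst[symmetric]) (auto simp: nn_integral_cmult nn_integral_multc)
  also have "\<dots> < \<infinity>"
    using a b by (auto simp: integrable_iff_bounded ennreal_mult_less_top)
  finally show *: "integrable (M1 \<Otimes>\<^sub>M M2) (case_prod f)"
    by (intro integrableI_bounded) auto
  show "(\<integral>y. (\<integral>x. f x y \<partial>M1) \<partial>M2) = (\<integral>x. (\<integral>y. f x y \<partial>M2) \<partial>M1)"
    by (rule Fubini_integral[OF *])
qed

lemma iexp_add_inner: "iexp (\<xi> \<bullet> (y + x)) = iexp (\<xi> \<bullet> y) * iexp (\<xi> \<bullet> x)"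
  by (simp add: inner_add_right distrib_left exp_add)

lemma integral_lborel_shift:
  fixes f :: "'a::euclidean_space \<Rightarrow> 'b::{banach,second_countable_topology}"
  assumes [measurable]: "f \<in> borel_measurable borel"
  shows "(LINT x|lborel. f (c + x)) = (LINT x|lborel. f x)"
  by (subst lborel_distr_plus[of c, symmetric], subst integral_distr) auto

lemma integrable_lborel_shift:
  fixes f :: "'a::euclidean_space \<Rightarrow> 'b::{banach,second_countable_topology}"
  assumes "integrable lborel f"
  shows "integrable lborel (\<lambda>x. f (c + x))"
proof -
  have "integrable (distr lborel borel ((+) c)) f"
    using assms by (simp add: lborel_distr_plus)
  then show ?thesis by (subst (asm) integrable_distr_eq) (use assms in \<open>auto dest: borel_measurable_integrable\<close>)
qed

lemma nn_integral_lborel_shift: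
  fixes f :: "'a::euclidean_space \<Rightarrow> ennreal"
  assumes [measurable]: "f \<in> borel_measurable borel"
  shows "(\<integral>\<^sup>+ x. f (c + x) \<partial>lborel) = (\<integral>\<^sup>+ x. f x \<partial>lborel)"
  by (subst (2) lborel_distr_plus[of c, symmetric], subst nn_integral_distr) auto

lemma gauss_density_scale:
  fixes z :: "'a::euclidean_space"
  assumes "0 < \<sigma>"
  shows "gauss_density \<sigma> (\<sigma> *\<^sub>R z) = gauss_density 1 z / \<sigma> ^ DIM('a)"
  using assms unfolding gauss_density_def
  by (simp add: normal_density_scale prod_dividef)

text \<open>The substitution \<open>y = x + \<sigma> z\<close> moves the width from the kernel into
  the argument of \<open>f\<close>. With the kernel fixed, dominated convergence applies as the
  width tends to 0.\<close>

lemma integral_gauss_density_scale: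
  fixes f :: "'a::euclidean_space \<Rightarrow> 'b::{banach,second_countable_topology}"
  assumes [measurable]: "f \<in> borel_measurable borel" and \<sigma>: "0 < \<sigma>"
  shows "(LINT y|lborel. gauss_density \<sigma> (y - x) *\<^sub>R f y) = (LINT z|lborel. gauss_density 1 z *\<^sub>R f (x + \<sigma> *\<^sub>R z))"
proof -
  have "(LINT y|lborel. gauss_density \<sigma> (y - x) *\<^sub>R f y) =
    (LINT y|density (distr lborel borel (\<lambda>z. x + \<sigma> *\<^sub>R z)) (\<lambda>_. \<bar>\<sigma>\<bar> ^ DIM('a)). gauss_density \<sigma> (y - x) *\<^sub>R f y)"
    using \<sigma> by (subst lborel_affine[of \<sigma> x]) auto
  also have "\<dots> = (LINT z|lborel. gauss_density 1 z *\<^sub>R f (x + \<sigma> *\<^sub>R z))"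
    using \<sigma> by (subst integral_density) (auto simp: integral_distr gauss_density_scale)
  finally show ?thesis .
qed

lemma nn_integral_gauss_density_scale:
  fixes f :: "'a::euclidean_space \<Rightarrow> ennreal"
  assumes [measurable]: "f \<in> borel_measurable borel" and \<sigma>: "0 < \<sigma>"
  shows "(\<integral>\<^sup>+ y. gauss_density \<sigma> (y - x) * f y \<partial>lborel) = (\<integral>\<^sup>+ z. gauss_density 1 z * f (x + \<sigma> *\<^sub>R z) \<partial>lborel)"
proof -
  have "(\<integral>\<^sup>+ y. gauss_density \<sigma> (y - x) * f y \<partial>lborel) =
    (\<integral>\<^sup>+ y. gauss_density \<sigma> (y - x) * f y \<partial>density (distr lborel borel (\<lambda>z. x + \<sigma> *\<^sub>R z)) (\<lambda>_. \<bar>\<sigma>\<bar> ^ DIM('a)))"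
    using \<sigma> by (subst lborel_affine[of \<sigma> x]) auto
  also have "\<dots> = (\<integral>\<^sup>+ z. ennreal (\<bar>\<sigma>\<bar> ^ DIM('a)) * (gauss_density \<sigma> (\<sigma> *\<^sub>R z) * f (x + \<sigma> *\<^sub>R z)) \<partial>lborel)"
    using \<sigma> by (subst nn_integral_density) (auto simp: nn_integral_distr ennreal_power)
  also have "\<dots> = (\<integral>\<^sup>+ z. gauss_density 1 z * f (x + \<sigma> *\<^sub>R z) \<partial>lborel)"
    using \<sigma> by (intro nn_integral_cong) (auto simp: gauss_density_scale mult.assoc[symmetric] simp flip: ennreal_mult)
  finally show ?thesis .
qed

lemma gauss_approx_identity:
  fixes f :: "'a::euclidean_space \<Rightarrow> complex"
  assumes f: "continuous_on UNIV f" and B: "\<And>x. cmod (f x) \<le> B"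
    and \<sigma>: "\<And>n. 0 < \<sigma> n" "\<sigma> \<longlonglongrightarrow> 0"
  shows "(\<lambda>n. LINT y|lborel. gauss_density (\<sigma> n) (y - x) *\<^sub>R f y) \<longlonglongrightarrow> f x"
proof -
  have [measurable]: "f \<in> borel_measurable borel"
    using f by (rule borel_measurable_continuous_onI)
  have int: "integrable lborel (\<lambda>z. gauss_density 1 (z::'a))"
    by (rule integrable_gauss_density) simp
  have "(\<lambda>n. LINT z|lborel. gauss_density 1 z *\<^sub>R f (x + \<sigma> n *\<^sub>R z)) \<longlonglongrightarrow> (LINT z|lborel. gauss_density 1 (z::'a) *\<^sub>R f x)"
  proof (rule integral_dominated_convergence)
    show "integrable lborel (\<lambda>z::'a. gauss_density 1 z * B)"
      using int by simp
    show "AE z in lborel. (\<lambda>n. gauss_density 1 z *\<^sub>R f (x + \<sigma> n *\<^sub>R z)) \<longlonglongrightarrow> gauss_density 1 z *\<^sub>R f x"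
    proof (rule AE_I2, intro tendsto_scaleR tendsto_const)
      fix z :: 'a
      have "(\<lambda>n. x + \<sigma> n *\<^sub>R z) \<longlonglongrightarrow> x + 0 *\<^sub>R z"
        by (intro tendsto_intros \<sigma>)
      moreover have "isCont f x"
        using f by (simp add: continuous_on_eq_continuous_at)
      ultimately show "(\<lambda>n. f (x + \<sigma> n *\<^sub>R z)) \<longlonglongrightarrow> f x"
        using isCont_tendsto_compose by force
    qed
    show "AE z in lborel. norm (gauss_density 1 z *\<^sub>R f (x + \<sigma> n *\<^sub>R z)) \<le> gauss_density 1 z * B" for n
      using B by (auto intro!: mult_left_mono)
  qed auto
  moreover have "(LINT z|lborel. gauss_density 1 (z::'a) *\<^sub>R f x) = f x"
    using integral_scaleR_left[OF int, of "f x"] by (simp add: integral_gauss_density)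
  ultimately show ?thesis
    using integral_gauss_density_scale[OF _ \<sigma>(1), of f] by simp
qed

section \<open>The Fourier transform and Plancherel's identity\<close>

lemma
  fixes f :: "'a::euclidean_space \<Rightarrow> complex"
  assumes "integrable lborel f"
  shows borel_measurable_fourier: "fourier f \<in> borel_measurable borel"
    and norm_fourier_le: "cmod (fourier f \<xi>) \<le> (LINT x|lborel. cmod (f x))"
proof -
  have [measurable]: "f \<in> borel_measurable borel"
    using assms by (auto dest: borel_measurable_integrable)
  show "fourier f \<in> borel_measurable borel"
    unfolding fourier_def by measurable
  show "cmod (fourier f \<xi>) \<le> (LINT x|lborel. cmod (f x))"
    unfolding fourier_def by (rule order_trans[OF integral_norm_bound]) (simp add: norm_mult)
qed

lemma integrable_bounded_mult:
  fixes f g :: "'b \<Rightarrow> complex"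
  assumes "integrable M f" and [measurable]: "g \<in> borel_measurable M" and "\<And>x. cmod (g x) \<le> B"
  shows "integrable M (\<lambda>x. g x * f x)"
proof (rule Bochner_Integration.integrable_bound)
  show "integrable M (\<lambda>x. B * cmod (f x))" using assms(1) by simp
  show "(\<lambda>x. g x * f x) \<in> borel_measurable M" using assms(1) by measurable
  show "AE x in M. norm (g x * f x) \<le> norm (B * cmod (f x))"
    using order_trans[OF assms(3) abs_ge_self] by (auto simp: norm_mult abs_mult intro!: mult_right_mono)
qed

text \<open>The kernel \<open>iexp (\<xi> \<bullet> x)\<close> is symmetric in its two variables, so
  Fubini lets the transform change sides.\<close>

lemma fourier_mult:
  fixes f g :: "'a::euclidean_space \<Rightarrow> complex"
  assumes f: "integrable lborel f" and g: "integrable lborel g"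
  shows "(LINT \<xi>|lborel. fourier f \<xi> * g \<xi>) = (LINT x|lborel. f x * fourier g x)"
proof -
  have [measurable]: "f \<in> borel_measurable borel" "g \<in> borel_measurable borel"
    using f g by (auto dest: borel_measurable_integrable)
  have "(LINT \<xi>|lborel. fourier f \<xi> * g \<xi>) = (LINT \<xi>|lborel. (LINT x|lborel. iexp (\<xi> \<bullet> x) * f x * g \<xi>))"
    unfolding fourier_def by simp
  also have "\<dots> = (LINT x|lborel. (LINT \<xi>|lborel. iexp (\<xi> \<bullet> x) * f x * g \<xi>))"
    using f g by (intro lborel_pair.Fubini_product_bound[where a="\<lambda>x. cmod (f x)" and b="\<lambda>x. cmod (g x)"])
       (auto simp: norm_mult)
  also have "\<dots> = (LINT x|lborel. f x * fourier g x)"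
    unfolding fourier_def by (simp add: inner_commute mult_ac flip: integral_mult_right_zero)
  finally show ?thesis .
qed

lemma fourier_modulate: "fourier (\<lambda>\<xi>. iexp (- (x \<bullet> \<xi>)) * g \<xi>) y = fourier g (y - x)"
  unfolding fourier_def
  by (simp add: inner_diff_left of_real_diff algebra_simps exp_add[symmetric] mult.assoc[symmetric])

text \<open>The Gaussian factor makes all the integrals absolutely convergent; it is removed by monotone
  convergence on the Fourier side and by the approximate identity on the space side.\<close>

lemma
  fixes f :: "'a::euclidean_space \<Rightarrow> complex"
  assumes f: "continuous_on UNIV f" and B: "\<And>x. cmod (f x) \<le> B" and int: "integrable lborel f"
  shows integrable_plancherel: "integrable lborel (\<lambda>\<xi>. (cmod (fourier f \<xi>))\<^sup>2)"
    and integral_plancherel: "(LINT \<xi>|lborel. (cmod (fourier f \<xi>))\<^sup>2) = (2 * pi) ^ DIM('a) * (LINT x|lborel. (cmod (f x))\<^sup>2)"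
proof -
  note [measurable] = borel_measurable_fourier[OF int]
  have [measurable]: "f \<in> borel_measurable borel"
    using int by (auto dest: borel_measurable_integrable)
  define L where "L = (LINT x|lborel. cmod (f x))"
  have F: "cmod (fourier f \<xi>) \<le> L" for \<xi>
    unfolding L_def by (rule norm_fourier_le[OF int])
  define \<sigma> where "\<sigma> n = 1 / real (Suc n)" for n
  have \<sigma>: "0 < \<sigma> n" for n by (simp add: \<sigma>_def)
  have \<sigma>0: "\<sigma> \<longlonglongrightarrow> 0" unfolding \<sigma>_def by (rule LIMSEQ_Suc[OF lim_1_over_n])
  have ge: "integrable lborel (\<lambda>\<xi>::'a. complex_of_real (gauss_exp (\<sigma> n) \<xi>))" for n
    using integrable_gauss_exp[OF \<sigma>] by (intro integrable_of_real)
  define I where "I n x = (LINT y|lborel. gauss_density (\<sigma> n) (y - x) *\<^sub>R f y)" for n x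
  have I_lim: "(\<lambda>n. I n x) \<longlonglongrightarrow> f x" for x
    unfolding I_def using f B \<sigma> \<sigma>0 by (rule gauss_approx_identity)
  have [measurable]: "I n \<in> borel_measurable borel" for n
    unfolding I_def by measurable
  have I_le: "cmod (I n x) \<le> B" for n x
  proof -
    have "cmod (I n x) = cmod (LINT z|lborel. gauss_density 1 z *\<^sub>R f (x + \<sigma> n *\<^sub>R z))"
      unfolding I_def by (subst integral_gauss_density_scale[OF _ \<sigma>]) auto
    also have "\<dots> \<le> (LINT z|lborel. gauss_density 1 (z::'a) * B)"
      by (rule norm_integral_le) (use B integrable_gauss_density[of 1] in \<open>auto intro!: mult_left_mono\<close>)
    finally show ?thesis by (simp add: integral_gauss_density)
  qed
  have gF: "integrable lborel (\<lambda>\<xi>. cnj (fourier f \<xi>) * complex_of_real (gauss_exp (\<sigma> n) \<xi>))" for n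
    by (rule integrable_bounded_mult[OF ge, of _ L]) (use F in auto)
  \<comment> \<open>Conjugation reverses the frequency, so the multiplication formula meets a
    modulated Gaussian, whose transform is a Gaussian density centred at \<open>x\<close>. The
    result is a multiple of the mollification of \<open>f\<close>.\<close>
  have fh: "fourier (\<lambda>\<xi>. cnj (fourier f \<xi>) * complex_of_real (gauss_exp (\<sigma> n) \<xi>)) x = (2 * pi) ^ DIM('a) * cnj (I n x)" for n x
  proof -
    have "fourier (\<lambda>\<xi>. cnj (fourier f \<xi>) * complex_of_real (gauss_exp (\<sigma> n) \<xi>)) x =
       cnj (LINT \<xi>|lborel. fourier f \<xi> * (iexp (- (x \<bullet> \<xi>)) * complex_of_real (gauss_exp (\<sigma> n) \<xi>)))"
    proof -
      have "iexp (x \<bullet> \<xi>) * (cnj (fourier f \<xi>) * complex_of_real (gauss_exp (\<sigma> n) \<xi>)) =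
        cnj (fourier f \<xi> * (iexp (- (x \<bullet> \<xi>)) * complex_of_real (gauss_exp (\<sigma> n) \<xi>)))" for \<xi>
        by (simp add: exp_cnj)
      then show ?thesis
        unfolding fourier_def[of _ x] by (simp only: Bochner_Integration.integral_cnj)
    qed
    also have "(LINT \<xi>|lborel. fourier f \<xi> * (iexp (- (x \<bullet> \<xi>)) * complex_of_real (gauss_exp (\<sigma> n) \<xi>))) =
       (LINT y|lborel. f y * fourier (\<lambda>\<xi>. iexp (- (x \<bullet> \<xi>)) * complex_of_real (gauss_exp (\<sigma> n) \<xi>)) y)"
      by (rule fourier_mult[OF int integrable_bounded_mult[OF ge, of _ 1]]) auto
    also have "\<dots> = (LINT y|lborel. complex_of_real ((2 * pi) ^ DIM('a)) * (gauss_density (\<sigma> n) (y - x) *\<^sub>R f y))"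
      unfolding fourier_modulate fourier_gauss_exp[OF \<sigma>] by (simp add: scaleR_conv_of_real mult_ac)
    also have "\<dots> = (2 * pi) ^ DIM('a) * I n x"
      unfolding I_def integral_mult_right_zero ..
    finally show ?thesis by simp
  qed
  define S where "S n = (LINT \<xi>|lborel. (cmod (fourier f \<xi>))\<^sup>2 * gauss_exp (\<sigma> n) \<xi>)" for n
  have S: "complex_of_real (S n) = (LINT x|lborel. (2 * pi) ^ DIM('a) * (f x * cnj (I n x)))" for n
  proof -
    have "complex_of_real (S n) = (LINT \<xi>|lborel. fourier f \<xi> * (cnj (fourier f \<xi>) * complex_of_real (gauss_exp (\<sigma> n) \<xi>)))"
      unfolding S_def integral_complex_of_real[symmetric] of_real_mult complex_norm_square mult.assoc ..
    also have "\<dots> = (LINT x|lborel. f x * ((2 * pi) ^ DIM('a) * cnj (I n x)))"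
      unfolding fourier_mult[OF int gF] fh ..
    finally show ?thesis by (simp add: mult_ac)
  qed
  have "(\<lambda>n. LINT x|lborel. (2 * pi) ^ DIM('a) * (f x * cnj (I n x))) \<longlonglongrightarrow> (LINT x|lborel. (2 * pi) ^ DIM('a) * (f x * cnj (f x)))"
  proof (rule integral_dominated_convergence)
    show "integrable lborel (\<lambda>x. (2 * pi) ^ DIM('a) * (cmod (f x) * B))"
      using int by simp
    show "AE x in lborel. (\<lambda>n. (2 * pi) ^ DIM('a) * (f x * cnj (I n x))) \<longlonglongrightarrow> (2 * pi) ^ DIM('a) * (f x * cnj (f x))"
      using I_lim by (intro AE_I2 tendsto_intros) auto
    show "AE x in lborel. norm ((2 * pi) ^ DIM('a) * (f x * cnj (I n x))) \<le> (2 * pi) ^ DIM('a) * (cmod (f x) * B)" for n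
      using I_le by (auto simp: norm_mult norm_power intro!: mult_left_mono)
  qed auto
  also have "(LINT x|lborel. (2 * pi) ^ DIM('a) * (f x * cnj (f x))) = complex_of_real ((2 * pi) ^ DIM('a) * (LINT x|lborel. (cmod (f x))\<^sup>2))"
    unfolding complex_norm_square[symmetric] integral_mult_right_zero integral_complex_of_real
    by (simp add: of_real_power)
  finally have S_lim: "S \<longlonglongrightarrow> (2 * pi) ^ DIM('a) * (LINT x|lborel. (cmod (f x))\<^sup>2)"
    unfolding S[symmetric] tendsto_of_real_iff .
  have 1: "integrable lborel (\<lambda>\<xi>. (cmod (fourier f \<xi>))\<^sup>2 * gauss_exp (\<sigma> n) \<xi>)" for n
  proof (rule Bochner_Integration.integrable_bound)
    show "integrable lborel (\<lambda>\<xi>::'a. L\<^sup>2 * gauss_exp (\<sigma> n) \<xi>)"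
      by (intro integrable_mult_right integrable_gauss_exp \<sigma>)
  qed (use F in \<open>auto simp: abs_mult intro!: mult_right_mono power_mono\<close>)
  have 2: "AE \<xi> in lborel. mono (\<lambda>n. (cmod (fourier f \<xi>))\<^sup>2 * gauss_exp (\<sigma> n) \<xi>)"
  proof (intro AE_I2 monoI mult_left_mono)
    fix \<xi> :: 'a and m n :: nat assume "m \<le> n"
    then have "\<sigma> n \<le> \<sigma> m" by (simp add: \<sigma>_def frac_le)
    then have "(\<sigma> n * norm \<xi>)\<^sup>2 \<le> (\<sigma> m * norm \<xi>)\<^sup>2"
      using \<sigma>[of n] by (intro power_mono mult_right_mono) auto
    then show "gauss_exp (\<sigma> m) \<xi> \<le> gauss_exp (\<sigma> n) \<xi>"
      by (simp add: gauss_exp_def)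
  qed auto
  have 3: "AE \<xi> in lborel. (\<lambda>n. (cmod (fourier f \<xi>))\<^sup>2 * gauss_exp (\<sigma> n) \<xi>) \<longlonglongrightarrow> (cmod (fourier f \<xi>))\<^sup>2"
  proof (intro AE_I2)
    fix \<xi> :: 'a
    have "(\<lambda>n. (cmod (fourier f \<xi>))\<^sup>2 * exp (- (\<sigma> n * norm \<xi>)\<^sup>2 / 2)) \<longlonglongrightarrow> (cmod (fourier f \<xi>))\<^sup>2 * exp (- (0 * norm \<xi>)\<^sup>2 / 2)"
      by (intro tendsto_intros \<sigma>0) auto
    then show "(\<lambda>n. (cmod (fourier f \<xi>))\<^sup>2 * gauss_exp (\<sigma> n) \<xi>) \<longlonglongrightarrow> (cmod (fourier f \<xi>))\<^sup>2"
      by (simp add: gauss_exp_def)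
  qed
  have 4: "(\<lambda>\<xi>. (cmod (fourier f \<xi>))\<^sup>2) \<in> borel_measurable lborel" by simp
  show "integrable lborel (\<lambda>\<xi>. (cmod (fourier f \<xi>))\<^sup>2)"
    and "(LINT \<xi>|lborel. (cmod (fourier f \<xi>))\<^sup>2) = (2 * pi) ^ DIM('a) * (LINT x|lborel. (cmod (f x))\<^sup>2)"
    using integral_monotone_convergence_nonneg[OF 1 2 _ 3 S_lim[unfolded S_def] 4] by auto
qed

section \<open>Convolution with a finite Borel measure\<close>

locale finite_borel_measure = finite_measure \<mu> for \<mu> :: "'a::euclidean_space measure" +
  assumes sets_eq [measurable_cong, simp]: "sets \<mu> = sets borel"
begin

lemma space_eq [simp]: "space \<mu> = UNIV"
  using sets_eq_imp_space_eq[OF sets_eq] by simp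

definition ft :: "'a \<Rightarrow> complex" where
  "ft \<xi> = (LINT y|\<mu>. iexp (\<xi> \<bullet> y))"

text \<open>For the law of \<open>X\<^sub>t\<close> this is \<open>dual_semigroup\<close> at time
  \<open>t\<close>, and \<open>ft\<close> is the characteristic function.\<close>

definition conv :: "('a \<Rightarrow> complex) \<Rightarrow> 'a \<Rightarrow> complex" where
  "conv \<phi> x = (LINT y|\<mu>. \<phi> (x - y))"

context
  fixes \<phi> :: "'a \<Rightarrow> complex" and B
  assumes \<phi>: "continuous_on UNIV \<phi>" "\<And>x. cmod (\<phi> x) \<le> B" "integrable lborel \<phi>"
begin

lemma measurable_phi [measurable]: "\<phi> \<in> borel_measurable borel"
  using \<phi>(1) by (rule borel_measurable_continuous_onI)

lemma continuous_conv: "continuous_on UNIV (conv \<phi>)"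
  unfolding continuous_on_eq_continuous_at[OF open_UNIV]
proof safe
  fix x :: 'a
  show "isCont (conv \<phi>) x"
    unfolding conv_def continuous_at_sequentially comp_def
  proof safe
    fix u assume u: "u \<longlonglongrightarrow> x"
    show "(\<lambda>n. LINT y|\<mu>. \<phi> (u n - y)) \<longlonglongrightarrow> (LINT y|\<mu>. \<phi> (x - y))"
    proof (rule integral_dominated_convergence[where w="\<lambda>_. B"])
      show "AE y in \<mu>. (\<lambda>n. \<phi> (u n - y)) \<longlonglongrightarrow> \<phi> (x - y)"
      proof (intro AE_I2)
        fix y
        have "isCont \<phi> (x - y)" using \<phi>(1) by (simp add: continuous_on_eq_continuous_at)
        then show "(\<lambda>n. \<phi> (u n - y)) \<longlonglongrightarrow> \<phi> (x - y)"
          using u by (intro isCont_tendsto_compose[of _ \<phi>] tendsto_intros)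
      qed
    qed (use \<phi>(2) in auto)
  qed
qed

lemma norm_conv_le: "cmod (conv \<phi> x) \<le> B * measure \<mu> UNIV"
proof -
  have "cmod (conv \<phi> x) \<le> (LINT y|\<mu>. B)"
    unfolding conv_def by (rule norm_integral_le) (use \<phi>(2) in auto)
  then show ?thesis by (simp add: mult.commute)
qed

lemma sigma_finite_pair: "pair_sigma_finite lborel \<mu>"
  by (intro pair_sigma_finite.intro sigma_finite_lborel sigma_finite_measure)

lemma nn_integral_norm_conv_pair:
  "(\<integral>\<^sup>+ z. norm (case z of (x, y) \<Rightarrow> \<phi> (x - y)) \<partial>(lborel \<Otimes>\<^sub>M \<mu>)) < \<infinity>"
proof -
  interpret pair_sigma_finite lborel \<mu> by (rule sigma_finite_pair)
  have "(\<integral>\<^sup>+ z. norm (case z of (x, y) \<Rightarrow> \<phi> (x - y)) \<partial>(lborel \<Otimes>\<^sub>M \<mu>)) =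
     (\<integral>\<^sup>+ y. (\<integral>\<^sup>+ x. norm (\<phi> (x - y)) \<partial>lborel) \<partial>\<mu>)"
    by (subst nn_integral_snd[symmetric]) auto
  also have "\<dots> = (\<integral>\<^sup>+ y. (\<integral>\<^sup>+ x. norm (\<phi> x) \<partial>lborel) \<partial>\<mu>)"
    using nn_integral_lborel_shift[of "\<lambda>x. ennreal (norm (\<phi> x))" "- _"]
    by simp
  also have "\<dots> < \<infinity>"
    using \<phi>(3) by (simp add: integrable_iff_bounded ennreal_mult_less_top emeasure_eq_measure)
  finally show ?thesis .
qed

lemma integrable_conv_pair: "integrable (lborel \<Otimes>\<^sub>M \<mu>) (\<lambda>(x, y). \<phi> (x - y))"
  using nn_integral_norm_conv_pair by (intro integrableI_bounded) auto

lemma integrable_conv: "integrable lborel (conv \<phi>)"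
proof -
  interpret pair_sigma_finite lborel \<mu> by (rule sigma_finite_pair)
  show ?thesis unfolding conv_def
    using integrable_fst'[OF integrable_conv_pair] by simp
qed

lemma fourier_conv: "fourier (conv \<phi>) \<xi> = fourier \<phi> \<xi> * ft \<xi>"
proof -
  interpret pair_sigma_finite lborel \<mu> by (rule sigma_finite_pair)
  have "integrable (lborel \<Otimes>\<^sub>M \<mu>) (\<lambda>z. iexp (\<xi> \<bullet> fst z) * (case z of (x, y) \<Rightarrow> \<phi> (x - y)))"
    by (rule integrable_bounded_mult[OF integrable_conv_pair, where B=1]) auto
  then have int: "integrable (lborel \<Otimes>\<^sub>M \<mu>) (\<lambda>(x, y). iexp (\<xi> \<bullet> x) * \<phi> (x - y))"
    by (simp add: case_prod_beta')
  have "fourier (conv \<phi>) \<xi> = (LINT x|lborel. (LINT y|\<mu>. iexp (\<xi> \<bullet> x) * \<phi> (x - y)))"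
    unfolding fourier_def conv_def by simp
  also have "\<dots> = (LINT y|\<mu>. (LINT x|lborel. iexp (\<xi> \<bullet> x) * \<phi> (x - y)))"
    by (rule Fubini_integral[OF int, symmetric])
  also have "\<dots> = (LINT y|\<mu>. iexp (\<xi> \<bullet> y) * fourier \<phi> \<xi>)"
  proof (intro Bochner_Integration.integral_cong refl)
    fix y
    have "(LINT x|lborel. iexp (\<xi> \<bullet> x) * \<phi> (x - y)) = (LINT x|lborel. iexp (\<xi> \<bullet> (y + x)) * \<phi> ((y + x) - y))"
      by (rule integral_lborel_shift[symmetric]) simp
    also have "\<dots> = (LINT x|lborel. iexp (\<xi> \<bullet> y) * (iexp (\<xi> \<bullet> x) * \<phi> x))"
      using iexp_add_inner[of \<xi> y] by (simp add: mult.assoc)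
    finally show "(LINT x|lborel. iexp (\<xi> \<bullet> x) * \<phi> (x - y)) = iexp (\<xi> \<bullet> y) * fourier \<phi> \<xi>"
      unfolding fourier_def by simp
  qed
  finally show ?thesis
    unfolding ft_def by simp
qed

text \<open>Continuity, boundedness and integrability pass from \<open>\<phi>\<close> to its
  convolution, so Plancherel's identity applies to the convolution itself, and there the transform
  factorizes.\<close>

lemma
  shows integrable_conv_sq: "integrable lborel (\<lambda>x. (cmod (conv \<phi> x))\<^sup>2)"
    and integral_conv_sq: "(2 * pi) ^ DIM('a) * (LINT x|lborel. (cmod (conv \<phi> x))\<^sup>2) =
       (LINT \<xi>|lborel. (cmod (fourier \<phi> \<xi>))\<^sup>2 * (cmod (ft \<xi>))\<^sup>2)"
    and integrable_fourier_conv_sq: "integrable lborel (\<lambda>\<xi>. (cmod (fourier \<phi> \<xi>))\<^sup>2 * (cmod (ft \<xi>))\<^sup>2)"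
proof -
  note * = continuous_conv norm_conv_le integrable_conv
  have [measurable]: "conv \<phi> \<in> borel_measurable borel"
    using continuous_conv by (rule borel_measurable_continuous_onI)
  have eq: "(cmod (fourier (conv \<phi>) \<xi>))\<^sup>2 = (cmod (fourier \<phi> \<xi>))\<^sup>2 * (cmod (ft \<xi>))\<^sup>2" for \<xi>
    by (simp add: fourier_conv norm_mult power_mult_distrib)
  show "integrable lborel (\<lambda>x. (cmod (conv \<phi> x))\<^sup>2)"
  proof (rule Bochner_Integration.integrable_bound)
    show "integrable lborel (\<lambda>x. (B * measure \<mu> UNIV) * cmod (conv \<phi> x))"
      using integrable_conv by simp
    show "AE x in lborel. norm ((cmod (conv \<phi> x))\<^sup>2) \<le> norm ((B * measure \<mu> UNIV) * cmod (conv \<phi> x))"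
      using norm_conv_le by (auto simp: power2_eq_square abs_mult intro!: mult_right_mono order_trans[OF norm_conv_le])
  qed simp
  show "integrable lborel (\<lambda>\<xi>. (cmod (fourier \<phi> \<xi>))\<^sup>2 * (cmod (ft \<xi>))\<^sup>2)"
    using integrable_plancherel[OF *] unfolding eq .
  show "(2 * pi) ^ DIM('a) * (LINT x|lborel. (cmod (conv \<phi> x))\<^sup>2) =
       (LINT \<xi>|lborel. (cmod (fourier \<phi> \<xi>))\<^sup>2 * (cmod (ft \<xi>))\<^sup>2)"
    using integral_plancherel[OF *] unfolding eq by simp
qed

end

end

section \<open>Schwartz functions\<close>

lemma integrable_inverse_1_plus_sq: "integrable lborel (\<lambda>x::real. 1 / (1 + x\<^sup>2))"
  using integrable_inverse_1_plus_square by (simp add: set_integrable_def divide_inverse)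

text \<open>Coordinatewise decay gives an integrable majorant of product form, built from the
  integrable function \<open>1 / (1 + x\<^sup>2)\<close> on the line.\<close>

lemma integrable_prod_decay:
  fixes f :: "'a::euclidean_space \<Rightarrow> complex"
  assumes f: "f \<in> borel_measurable borel"
    and C: "\<And>x. cmod (f x) * (\<Prod>b\<in>Basis. 1 + (x \<bullet> b)\<^sup>2) \<le> C"
  shows "integrable lborel f"
proof (rule Bochner_Integration.integrable_bound)
  show "integrable lborel (\<lambda>x::'a. C * (\<Prod>b\<in>Basis. 1 / (1 + (x \<bullet> b)\<^sup>2)))"
    by (intro integrable_mult_right integrable_lborel_prod integrable_inverse_1_plus_sq)
  show "f \<in> borel_measurable lborel" using f by simp
  have pos: "0 < (\<Prod>b\<in>Basis. 1 + (x \<bullet> b)\<^sup>2)" for x :: 'a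
    by (intro prod_pos) (auto intro: add_pos_nonneg)
  have "cmod (f x) \<le> C * (\<Prod>b\<in>Basis. 1 / (1 + (x \<bullet> b)\<^sup>2))" for x
    using C[of x] pos[of x] by (simp add: prod_dividef field_simps)
  then show "AE x in lborel. norm (f x) \<le> norm (C * (\<Prod>b\<in>Basis. 1 / (1 + (x \<bullet> b)\<^sup>2)))"
    by (intro AE_I2) (smt (verit) real_norm_def)
qed

text \<open>Each factor \<open>1 + (x \<bullet> b)\<^sup>2\<close> of the product majorant is at
  most \<open>(1 + norm x)\<^sup>2\<close>, whence the exponent \<open>2 * DIM('a)\<close>.\<close>

lemma integrable_decay:
  fixes f :: "'a::euclidean_space \<Rightarrow> complex"
  assumes f: "f \<in> borel_measurable borel"
    and C: "\<And>x. (1 + norm x) ^ (2 * DIM('a)) * cmod (f x) \<le> C"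
  shows "integrable lborel f"
proof (rule integrable_prod_decay[OF f])
  fix x :: 'a
  have "(\<Prod>b\<in>Basis. 1 + (x \<bullet> b)\<^sup>2) \<le> (\<Prod>b\<in>(Basis::'a set). (1 + norm x)\<^sup>2)"
  proof (rule prod_mono)
    fix b :: 'a assume b: "b \<in> Basis"
    have "(x \<bullet> b)\<^sup>2 \<le> (norm x)\<^sup>2"
      using Basis_le_norm[OF b, of x] by (subst abs_le_square_iff[symmetric]) simp
    then show "0 \<le> 1 + (x \<bullet> b)\<^sup>2 \<and> 1 + (x \<bullet> b)\<^sup>2 \<le> (1 + norm x)\<^sup>2"
      using norm_ge_zero[of x] by (simp add: power2_sum add_increasing2 add_nonneg_nonneg del: norm_ge_zero)
  qed
  also have "\<dots> = (1 + norm x) ^ (2 * DIM('a))"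
    by (simp add: power_mult)
  finally have "cmod (f x) * (\<Prod>b\<in>Basis. 1 + (x \<bullet> b)\<^sup>2) \<le> cmod (f x) * (1 + norm x) ^ (2 * DIM('a))"
    by (rule mult_left_mono) simp
  then show "cmod (f x) * (\<Prod>b\<in>Basis. 1 + (x \<bullet> b)\<^sup>2) \<le> C"
    using C[of x] by (simp add: mult.commute)
qed

lemma schwartz_iter_differentiable:
  assumes "f \<in> schwartz" "bs \<in> lists Basis"
  shows "iter_deriv bs f differentiable at x"
  using assms unfolding schwartz_def by (auto simp: differentiable_on_eq_differentiable_at)

lemma schwartz_iter_has_derivative:
  assumes "f \<in> schwartz" "bs \<in> lists Basis"
  shows "(iter_deriv bs f has_derivative frechet_derivative (iter_deriv bs f) (at x)) (at x)"
  using schwartz_iter_differentiable[OF assms] by (simp add: frechet_derivative_works)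

lemma schwartz_iter_continuous:
  assumes "f \<in> schwartz" "bs \<in> lists Basis"
  shows "continuous_on UNIV (iter_deriv bs f)"
  using assms unfolding schwartz_def by (auto intro: differentiable_imp_continuous_on)

lemma schwartz_iter_decay:
  assumes "f \<in> schwartz" "bs \<in> lists Basis"
  obtains C where "\<And>x. (1 + norm x) ^ k * cmod (iter_deriv bs f x) \<le> C"
proof -
  have "bounded (range (\<lambda>x. (1 + norm x) ^ k *\<^sub>R iter_deriv bs f x))"
    using assms unfolding schwartz_def by auto
  then obtain C where "\<And>x. norm ((1 + norm x) ^ k *\<^sub>R iter_deriv bs f x) \<le> C"
    unfolding bounded_iff by auto
  then show ?thesis by (intro that[of C]) simp
qed

lemma schwartz_iter_integrable:
  fixes f :: "'a::euclidean_space \<Rightarrow> complex"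
  assumes "f \<in> schwartz" "bs \<in> lists Basis"
  shows "integrable lborel (iter_deriv bs f)"
proof -
  obtain C where "\<And>x. (1 + norm x) ^ (2 * DIM('a)) * cmod (iter_deriv bs f x) \<le> C"
    using schwartz_iter_decay[OF assms] by blast
  then show ?thesis
    using schwartz_iter_continuous[OF assms] by (intro integrable_decay) (auto intro: borel_measurable_continuous_onI)
qed

lemma schwartz_continuous: "f \<in> schwartz \<Longrightarrow> continuous_on UNIV f"
  using schwartz_iter_continuous[of f "[]"] by simp

lemma schwartzI:
  assumes "\<And>bs x. bs \<in> lists Basis \<Longrightarrow> iter_deriv bs f differentiable at x"
    and "\<And>bs k. bs \<in> lists Basis \<Longrightarrow> \<exists>C. \<forall>x. (1 + norm x) ^ k * cmod (iter_deriv bs f x) \<le> C"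
  shows "f \<in> schwartz"
  unfolding schwartz_def mem_Collect_eq
proof (intro ballI conjI allI)
  fix bs :: "'a list" and k :: nat assume bs: "bs \<in> lists Basis"
  show "iter_deriv bs f differentiable_on UNIV"
    using assms(1)[OF bs] by (simp add: differentiable_on_eq_differentiable_at)
  show "bounded (range (\<lambda>x. (1 + norm x) ^ k *\<^sub>R iter_deriv bs f x))"
    using assms(2)[OF bs, of k] by (auto simp: bounded_iff)
qed

lemma schwartz_integrable: "f \<in> schwartz \<Longrightarrow> integrable lborel f"
  using schwartz_iter_integrable[of f "[]"] by simp

lemma schwartz_bounded:
  assumes "f \<in> schwartz" obtains B where "\<And>x. cmod (f x) \<le> B"
  using schwartz_iter_decay[OF assms, of "[]" 0] by auto

section \<open>Derivatives and decay of the Fourier transform\<close>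

lemma has_vector_derivative_quotient:
  assumes "(f has_vector_derivative v) (at (0::real))" and h: "filterlim h (at 0) F"
  shows "((\<lambda>n. (f (h n) - f 0) /\<^sub>R h n) \<longlongrightarrow> v) F"
proof -
  have "((\<lambda>s. norm (f (0 + s) - f 0 - s *\<^sub>R v) / norm s) \<longlongrightarrow> 0) (at 0)"
    using assms(1) unfolding has_vector_derivative_def has_derivative_at by simp
  from filterlim_compose[OF this h]
  have "((\<lambda>n. norm (f (h n) - f 0 - h n *\<^sub>R v) / norm (h n)) \<longlongrightarrow> 0) F"
    by simp
  moreover have "eventually (\<lambda>n. norm (f (h n) - f 0 - h n *\<^sub>R v) / norm (h n) = norm ((f (h n) - f 0) /\<^sub>R h n - v)) F"
    using filterlim_at[THEN iffD1, OF h, THEN conjunct1]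
  proof eventually_elim
    case (elim n)
    then have "(f (h n) - f 0) /\<^sub>R h n - v = (f (h n) - f 0 - h n *\<^sub>R v) /\<^sub>R h n"
      by (simp add: scaleR_diff_right)
    then show ?case by (simp add: divide_inverse mult.commute)
  qed
  ultimately have "((\<lambda>n. norm ((f (h n) - f 0) /\<^sub>R h n - v)) \<longlongrightarrow> 0) F"
    by (rule Lim_transform_eventually)
  then show ?thesis
    by (simp add: tendsto_norm_zero_iff LIM_zero_iff)
qed

text \<open>This is integration by parts, done with difference quotients: translation invariance
  turns the transform of a quotient into that of \<open>g\<close> times the quotient of an
  exponential, and both sides pass to the limit. The sign is minus because the transform uses
  \<open>exp (\<i> \<xi> \<bullet> x)\<close>.\<close>

lemma fourier_iter_deriv_Cons:
  fixes f :: "'a::euclidean_space \<Rightarrow> complex"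
  assumes f: "f \<in> schwartz" and bs: "b \<in> Basis" "bs \<in> lists Basis"
  shows "fourier (iter_deriv (b # bs) f) \<xi> = - \<i> * (\<xi> \<bullet> b) * fourier (iter_deriv bs f) \<xi>"
proof -
  define g where "g = iter_deriv bs f"
  define g' where "g' = iter_deriv (b # bs) f"
  have bbs: "b # bs \<in> lists Basis" using bs by simp
  have g': "((\<lambda>s. g (x + s *\<^sub>R b)) has_vector_derivative g' (x + s *\<^sub>R b)) (at s within A)" for x s A
  proof -
    have "(g has_derivative frechet_derivative g (at (x + s *\<^sub>R b))) (at (x + s *\<^sub>R b))"
      unfolding g_def by (rule schwartz_iter_has_derivative[OF f bs(2)])
    moreover have "((\<lambda>s. x + s *\<^sub>R b) has_vector_derivative b) (at s within A)"
      by (auto intro!: derivative_eq_intros)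
    ultimately have "((g \<circ> (\<lambda>s. x + s *\<^sub>R b)) has_vector_derivative frechet_derivative g (at (x + s *\<^sub>R b)) b) (at s within A)"
      by (intro vector_derivative_diff_chain_within) (auto intro: has_derivative_at_withinI)
    then show ?thesis
      by (simp add: g'_def g_def comp_def)
  qed
  have g_int: "integrable lborel g" and g'_int: "integrable lborel g'"
    unfolding g_def g'_def by (rule schwartz_iter_integrable[OF f] bs bbs)+
  have [measurable]: "g \<in> borel_measurable borel" "g' \<in> borel_measurable borel"
    using g_int g'_int by (auto dest: borel_measurable_integrable)
  define N where "N = 2 * DIM('a)"
  obtain C where C: "\<And>x. (1 + norm x) ^ N * cmod (g' x) \<le> C"
    using schwartz_iter_decay[OF f bbs] unfolding g'_def by blast
  \<comment> \<open>Dominated convergence runs along sequences, so the derivative is approached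
    along steps tending to 0. Steps of size at most 1 keep the shifted points comparable with
    \<open>x\<close>.\<close>
  define h where "h n = 1 / real (Suc n)" for n
  have h: "0 < h n" "h n \<le> 1" for n by (auto simp: h_def)
  have h0: "h \<longlonglongrightarrow> 0" unfolding h_def by (rule LIMSEQ_Suc[OF lim_1_over_n])
  then have h_at: "filterlim h (at 0) sequentially"
    using h(1) by (auto simp: filterlim_at less_imp_neq[symmetric] intro: always_eventually)
  define D where "D n x = (g (x + h n *\<^sub>R b) - g x) /\<^sub>R h n" for n x
  have le_aux: "1 + a \<le> 2 * (1 + A)" if "a \<le> A + B" "B \<le> 1" "0 \<le> A" for a A B :: real
    using that by simp
  \<comment> \<open>A shift of length at most 1 changes \<open>1 + norm x\<close> by a factor of at
    most 2, which costs \<open>2 ^ N\<close> in the decay.\<close>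
  have g'_bound: "cmod (g' (x + s *\<^sub>R b)) \<le> C * 2 ^ N / (1 + norm x) ^ N" if "0 \<le> s" "s \<le> 1" for x s
  proof -
    have "norm x \<le> norm (x + s *\<^sub>R b) + norm (s *\<^sub>R b)"
      by (metis add_diff_cancel_right' norm_triangle_ineq4)
    moreover have "norm (s *\<^sub>R b) \<le> 1"
      using that bs by simp
    ultimately have "1 + norm x \<le> 2 * (1 + norm (x + s *\<^sub>R b))"
      using le_aux[OF _ _ norm_ge_zero] by blast
    then have "(1 + norm x) ^ N \<le> (2 * (1 + norm (x + s *\<^sub>R b))) ^ N"
      by (intro power_mono) auto
    then have "(1 + norm x) ^ N * cmod (g' (x + s *\<^sub>R b)) \<le> (2 * (1 + norm (x + s *\<^sub>R b))) ^ N * cmod (g' (x + s *\<^sub>R b))"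
      by (rule mult_right_mono) simp
    also have "\<dots> \<le> 2 ^ N * C"
      unfolding power_mult_distrib mult.assoc using C[of "x + s *\<^sub>R b"] by (intro mult_left_mono) auto
    finally show ?thesis
      by (subst pos_le_divide_eq) (auto simp: mult_ac intro!: zero_less_power add_pos_nonneg)
  qed
  \<comment> \<open>By the mean value inequality the decay of the derivative bounds all the
    difference quotients at once, with an integrable majorant.\<close>
  have D_bound: "cmod (D n x) \<le> C * 2 ^ N / (1 + norm x) ^ N" for n x
  proof -
    have "norm (g (x + h n *\<^sub>R b) - g (x + 0 *\<^sub>R b)) \<le> C * 2 ^ N / (1 + norm x) ^ N * norm (h n - 0)"
    proof (rule differentiable_bound[where S="{0..h n}" and f'="\<lambda>s t. t *\<^sub>R g' (x + s *\<^sub>R b)"])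
      fix s assume s: "s \<in> {0..h n}"
      show "((\<lambda>s. g (x + s *\<^sub>R b)) has_derivative (\<lambda>t. t *\<^sub>R g' (x + s *\<^sub>R b))) (at s within {0..h n})"
        using g'[of x s] unfolding has_vector_derivative_def .
      show "onorm (\<lambda>t. t *\<^sub>R g' (x + s *\<^sub>R b)) \<le> C * 2 ^ N / (1 + norm x) ^ N"
        using g'_bound[of s x] s h(2)[of n] by (subst onorm_scaleR_left) (auto simp: onorm_id)
    qed (use h(1)[of n] in auto)
    moreover have "cmod (D n x) = cmod (g (x + h n *\<^sub>R b) - g x) / h n"
      unfolding D_def norm_scaleR using h(1)[of n] by (simp add: divide_inverse mult.commute)
    ultimately show ?thesis
      using h(1)[of n] by (simp add: pos_divide_le_eq)
  qed
  have D_lim: "(\<lambda>n. D n x) \<longlonglongrightarrow> g' x" for x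
  proof -
    show ?thesis
      using has_vector_derivative_quotient[OF g'[of x 0 UNIV] h_at] unfolding D_def by simp
  qed
  have D_int: "fourier (D n) \<xi> = ((iexp (- (h n * (\<xi> \<bullet> b))) - 1) / h n) * fourier g \<xi>" for n
  proof -
    have g_sh: "integrable lborel (\<lambda>x. g (h n *\<^sub>R b + x))"
      by (rule integrable_lborel_shift[OF g_int])
    have i1: "integrable lborel (\<lambda>x. iexp (\<xi> \<bullet> x) * g (h n *\<^sub>R b + x))" "integrable lborel (\<lambda>x. iexp (\<xi> \<bullet> x) * g x)"
      by (rule integrable_bounded_mult[OF g_sh, where B=1] integrable_bounded_mult[OF g_int, where B=1]; simp)+
    have e: "iexp (- (h n * (\<xi> \<bullet> b))) * iexp (\<xi> \<bullet> (h n *\<^sub>R b + x)) = iexp (\<xi> \<bullet> x)" for x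
      by (simp add: inner_add_right exp_add[symmetric] algebra_simps)
    have "(LINT x|lborel. iexp (\<xi> \<bullet> x) * g (h n *\<^sub>R b + x)) =
        (LINT x|lborel. iexp (- (h n * (\<xi> \<bullet> b))) * (iexp (\<xi> \<bullet> (h n *\<^sub>R b + x)) * g (h n *\<^sub>R b + x)))"
      unfolding mult.assoc[symmetric] e ..
    also have "\<dots> = iexp (- (h n * (\<xi> \<bullet> b))) * (LINT x|lborel. (iexp (\<xi> \<bullet> (h n *\<^sub>R b + x)) * g (h n *\<^sub>R b + x)))"
      by (rule integral_mult_right_zero)
    also have "(LINT x|lborel. (iexp (\<xi> \<bullet> (h n *\<^sub>R b + x)) * g (h n *\<^sub>R b + x))) = fourier g \<xi>"
      unfolding fourier_def by (rule integral_lborel_shift) simp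
    finally have sh: "(LINT x|lborel. iexp (\<xi> \<bullet> x) * g (h n *\<^sub>R b + x)) = iexp (- (h n * (\<xi> \<bullet> b))) * fourier g \<xi>" .
    have "fourier (D n) \<xi> = (LINT x|lborel. (iexp (\<xi> \<bullet> x) * g (h n *\<^sub>R b + x) - iexp (\<xi> \<bullet> x) * g x) / h n)"
      unfolding fourier_def D_def
      by (intro Bochner_Integration.integral_cong refl) (simp add: scaleR_conv_of_real add.commute field_simps)
    also have "\<dots> = (iexp (- (h n * (\<xi> \<bullet> b))) * fourier g \<xi> - fourier g \<xi>) / h n"
      using i1 by (simp add: sh fourier_def[symmetric] Bochner_Integration.integral_diff)
    finally show ?thesis by (simp add: field_simps)
  qed
  have "(\<lambda>n. fourier (D n) \<xi>) \<longlonglongrightarrow> fourier g' \<xi>"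
    unfolding fourier_def
  proof (rule integral_dominated_convergence)
    show "(\<lambda>x. iexp (\<xi> \<bullet> x) * g' x) \<in> borel_measurable lborel" by simp
    show "(\<lambda>x. iexp (\<xi> \<bullet> x) * D n x) \<in> borel_measurable lborel" for n
      unfolding D_def by simp
    have "integrable lborel (\<lambda>x::'a. complex_of_real (C * 2 ^ N / (1 + norm x) ^ N))"
    proof (rule integrable_decay)
      have "0 \<le> C" using C[of 0] by (auto intro: order_trans[rotated])
      then show "(1 + norm x) ^ (2 * DIM('a)) * cmod (complex_of_real (C * 2 ^ N / (1 + norm x) ^ N)) \<le> C * 2 ^ N" for x :: 'a
      proof -
        have nz: "(1 + norm x) ^ N \<noteq> 0" and nn: "0 \<le> C * 2 ^ N / (1 + norm x) ^ N"
          using \<open>0 \<le> C\<close> norm_ge_zero[of x] by (auto simp: add_nonneg_eq_0_iff)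
        show ?thesis
          unfolding N_def[symmetric] norm_of_real abs_of_nonneg[OF nn]
          using nz by (simp add: divide_self)
      qed
    qed simp
    then show "integrable lborel (\<lambda>x::'a. C * 2 ^ N / (1 + norm x) ^ N)"
      using integrable_Re by fastforce
    show "AE x in lborel. (\<lambda>n. iexp (\<xi> \<bullet> x) * D n x) \<longlonglongrightarrow> iexp (\<xi> \<bullet> x) * g' x"
      using D_lim by (intro AE_I2 tendsto_intros)
    show "AE x in lborel. norm (iexp (\<xi> \<bullet> x) * D n x) \<le> C * 2 ^ N / (1 + norm x) ^ N" for n
      using D_bound by (simp add: norm_mult)
  qed
  moreover have "(\<lambda>n. fourier (D n) \<xi>) \<longlonglongrightarrow> (- \<i> * (\<xi> \<bullet> b)) * fourier g \<xi>"
  proof -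
    have "((\<lambda>s. iexp (- (s * (\<xi> \<bullet> b)))) has_vector_derivative (- \<i> * (\<xi> \<bullet> b))) (at 0)"
      using exp_scaleR_has_vector_derivative_right[of "- \<i> * (\<xi> \<bullet> b)" 0 UNIV]
      by (simp add: scaleR_conv_of_real mult_ac)
    from has_vector_derivative_quotient[OF this h_at]
    have "(\<lambda>n. (iexp (- (h n * (\<xi> \<bullet> b))) - 1) / h n) \<longlonglongrightarrow> (- \<i> * (\<xi> \<bullet> b))"
      by (simp add: scaleR_conv_of_real divide_inverse mult.commute)
    then show ?thesis
      unfolding D_int by (intro tendsto_mult tendsto_const)
  qed
  ultimately show ?thesis
    unfolding g_def[symmetric] g'_def[symmetric] by (rule LIMSEQ_unique)
qed

text \<open>The list \<open>bs\<close> is carried for the induction: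
  \<open>1 + (\<xi> \<bullet> c)\<^sup>2\<close> splits into the constant 1 and two copies of
  \<open>\<bar>\<xi> \<bullet> c\<bar>\<close>, which join \<open>bs\<close>. Once \<open>cs\<close>
  is empty, the coordinate factors are absorbed into the transform of an iterated derivative, which
  is bounded.\<close>

lemma fourier_schwartz_decay:
  fixes f :: "'a::euclidean_space \<Rightarrow> complex"
  assumes f: "f \<in> schwartz" and "cs \<in> lists Basis" "bs \<in> lists Basis"
  shows "\<exists>C. \<forall>\<xi>. cmod (fourier f \<xi>) * (\<Prod>c\<leftarrow>cs. 1 + (\<xi> \<bullet> c)\<^sup>2) * (\<Prod>b\<leftarrow>bs. \<bar>\<xi> \<bullet> b\<bar>) \<le> C"
  using assms(2,3)
proof (induction cs arbitrary: bs)
  case Nil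
  have bs: "bs \<in> lists Basis" using Nil by auto
  have "cmod (fourier f \<xi>) * (\<Prod>b\<leftarrow>bs. \<bar>\<xi> \<bullet> b\<bar>) = cmod (fourier (iter_deriv bs f) \<xi>)" for \<xi>
    using bs
  proof (induction bs)
    case (Cons b bs)
    then show ?case
      by (subst fourier_iter_deriv_Cons[OF f]) (auto simp: norm_mult mult_ac)
  qed simp
  then show ?case
    using norm_fourier_le[OF schwartz_iter_integrable[OF f bs]] by auto
next
  case (Cons c cs)
  from Cons.IH[of bs] Cons.prems obtain C1 where
    1: "\<And>\<xi>. cmod (fourier f \<xi>) * (\<Prod>c\<leftarrow>cs. 1 + (\<xi> \<bullet> c)\<^sup>2) * (\<Prod>b\<leftarrow>bs. \<bar>\<xi> \<bullet> b\<bar>) \<le> C1" by auto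
  have "\<exists>C. \<forall>\<xi>. cmod (fourier f \<xi>) * (\<Prod>c\<leftarrow>cs. 1 + (\<xi> \<bullet> c)\<^sup>2) * (\<Prod>b\<leftarrow>c # c # bs. \<bar>\<xi> \<bullet> b\<bar>) \<le> C"
    by (rule Cons.IH) (use Cons.hyps Cons.prems in auto)
  then obtain C2 where
    2: "\<And>\<xi>. cmod (fourier f \<xi>) * (\<Prod>c\<leftarrow>cs. 1 + (\<xi> \<bullet> c)\<^sup>2) * (\<Prod>b\<leftarrow>c # c # bs. \<bar>\<xi> \<bullet> b\<bar>) \<le> C2" by blast
  have "cmod (fourier f \<xi>) * (\<Prod>c\<leftarrow>c # cs. 1 + (\<xi> \<bullet> c)\<^sup>2) * (\<Prod>b\<leftarrow>bs. \<bar>\<xi> \<bullet> b\<bar>) \<le> C1 + C2" for \<xi>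
  proof -
    have "cmod (fourier f \<xi>) * (\<Prod>c\<leftarrow>c # cs. 1 + (\<xi> \<bullet> c)\<^sup>2) * (\<Prod>b\<leftarrow>bs. \<bar>\<xi> \<bullet> b\<bar>) =
      cmod (fourier f \<xi>) * (\<Prod>c\<leftarrow>cs. 1 + (\<xi> \<bullet> c)\<^sup>2) * (\<Prod>b\<leftarrow>bs. \<bar>\<xi> \<bullet> b\<bar>) +
      cmod (fourier f \<xi>) * (\<Prod>c\<leftarrow>cs. 1 + (\<xi> \<bullet> c)\<^sup>2) * (\<bar>\<xi> \<bullet> c\<bar> * \<bar>\<xi> \<bullet> c\<bar> * (\<Prod>b\<leftarrow>bs. \<bar>\<xi> \<bullet> b\<bar>))"
      unfolding abs_mult_self_eq by (simp add: power2_eq_square algebra_simps)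
    then show ?thesis
      using 1[of \<xi>] 2[of \<xi>] by (simp add: mult.assoc)
  qed
  then show ?case by blast
qed

text \<open>Needed for the wave equation, where the transform of a test function is multiplied by a
  kernel and transformed once more.\<close>

lemma fourier_schwartz_integrable:
  fixes f :: "'a::euclidean_space \<Rightarrow> complex"
  assumes f: "f \<in> schwartz"
  shows "integrable lborel (fourier f)"
proof -
  obtain cs :: "'a list" where cs: "set cs = Basis" "distinct cs"
    using finite_distinct_list[OF finite_Basis] by auto
  obtain C where "\<And>\<xi>. cmod (fourier f \<xi>) * (\<Prod>c\<leftarrow>cs. 1 + (\<xi> \<bullet> c)\<^sup>2) * (\<Prod>b\<leftarrow>[]. \<bar>\<xi> \<bullet> b\<bar>) \<le> C"
    using fourier_schwartz_decay[OF f, of cs "[]"] cs by auto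
  then have "cmod (fourier f \<xi>) * (\<Prod>b\<in>Basis. 1 + (\<xi> \<bullet> b)\<^sup>2) \<le> C" for \<xi>
    using cs by (simp add: prod.distinct_set_conv_list[symmetric])
  then show ?thesis
    by (intro integrable_prod_decay borel_measurable_fourier schwartz_integrable f)
qed

lemma continuous_fourier:
  fixes f :: "'a::euclidean_space \<Rightarrow> complex"
  assumes f: "integrable lborel f"
  shows "continuous_on UNIV (fourier f)"
  unfolding continuous_on_eq_continuous_at[OF open_UNIV]
proof safe
  fix x :: 'a
  have [measurable]: "f \<in> borel_measurable borel" using f by (auto dest: borel_measurable_integrable)
  show "isCont (fourier f) x"
    unfolding fourier_def continuous_at_sequentially comp_def
  proof safe
    fix u assume u: "u \<longlonglongrightarrow> x"
    show "(\<lambda>n. LINT y|lborel. iexp (u n \<bullet> y) * f y) \<longlonglongrightarrow> (LINT y|lborel. iexp (x \<bullet> y) * f y)"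
    proof (rule integral_dominated_convergence[where w="\<lambda>y. cmod (f y)"])
      show "AE y in lborel. (\<lambda>n. iexp (u n \<bullet> y) * f y) \<longlonglongrightarrow> iexp (x \<bullet> y) * f y"
        using u by (intro AE_I2 tendsto_intros)
    qed (use f in \<open>auto simp: norm_mult\<close>)
  qed
qed

lemma iter_deriv_diff:
  fixes f g :: "'a::euclidean_space \<Rightarrow> complex"
  assumes f: "f \<in> schwartz" and g: "g \<in> schwartz" and bs: "bs \<in> lists Basis"
  shows "iter_deriv bs (\<lambda>x. f x - g x) = (\<lambda>x. iter_deriv bs f x - iter_deriv bs g x)"
  using bs
proof (induction bs)
  case (Cons b bs)
  then have IH: "iter_deriv bs (\<lambda>x. f x - g x) = (\<lambda>x. iter_deriv bs f x - iter_deriv bs g x)" and bs: "bs \<in> lists Basis"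
    by auto
  show ?case
  proof
    fix x
    have "((\<lambda>x. iter_deriv bs f x - iter_deriv bs g x) has_derivative
      (\<lambda>v. frechet_derivative (iter_deriv bs f) (at x) v - frechet_derivative (iter_deriv bs g) (at x) v)) (at x)"
      by (intro has_derivative_diff schwartz_iter_has_derivative f g bs)
    from frechet_derivative_at[OF this] show "iter_deriv (b # bs) (\<lambda>x. f x - g x) x = iter_deriv (b # bs) f x - iter_deriv (b # bs) g x"
      by (simp add: IH fun_eq_iff)
  qed
qed simp

lemma schwartz_diff:
  fixes f g :: "'a::euclidean_space \<Rightarrow> complex"
  assumes f: "f \<in> schwartz" and g: "g \<in> schwartz"
  shows "(\<lambda>x. f x - g x) \<in> schwartz"
proof (rule schwartzI)
  fix bs :: "'a list" and k :: nat assume bs: "bs \<in> lists Basis"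
  show "iter_deriv bs (\<lambda>x. f x - g x) differentiable at x" for x
    unfolding iter_deriv_diff[OF f g bs] using f g bs
    by (intro differentiable_diff schwartz_iter_differentiable)
  obtain C1 C2 where C: "\<And>x. (1 + norm x) ^ k * cmod (iter_deriv bs f x) \<le> C1"
    "\<And>x. (1 + norm x) ^ k * cmod (iter_deriv bs g x) \<le> C2"
    using schwartz_iter_decay[OF f bs] schwartz_iter_decay[OF g bs] by metis
  have "(1 + norm x) ^ k * cmod (iter_deriv bs f x - iter_deriv bs g x) \<le> C1 + C2" for x
  proof -
    have "(1 + norm x) ^ k * cmod (iter_deriv bs f x - iter_deriv bs g x) \<le>
       (1 + norm x) ^ k * (cmod (iter_deriv bs f x) + cmod (iter_deriv bs g x))"
      by (simp add: mult_left_mono norm_triangle_ineq4)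
    then show ?thesis using C[of x] by (simp add: distrib_left)
  qed
  then show "\<exists>C. \<forall>x. (1 + norm x) ^ k * cmod (iter_deriv bs (\<lambda>x. f x - g x) x) \<le> C"
    unfolding iter_deriv_diff[OF f g bs] by blast
qed

section \<open>Polynomials times Gaussians as test functions\<close>

inductive polynomial_fun :: "('a::euclidean_space \<Rightarrow> complex) \<Rightarrow> bool" where
  const: "polynomial_fun (\<lambda>x. c)"
| inner: "polynomial_fun (\<lambda>x. complex_of_real (x \<bullet> b))"
| add: "polynomial_fun p \<Longrightarrow> polynomial_fun q \<Longrightarrow> polynomial_fun (\<lambda>x. p x + q x)"
| mult: "polynomial_fun p \<Longrightarrow> polynomial_fun q \<Longrightarrow> polynomial_fun (\<lambda>x. p x * q x)"

lemma polynomial_fun_derivative: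
  assumes "polynomial_fun p"
  shows "\<exists>D. (\<forall>x. (p has_derivative D x) (at x)) \<and> (\<forall>v. polynomial_fun (\<lambda>x. D x v))"
  using assms
proof induction
  case (const c)
  then show ?case by (intro exI[of _ "\<lambda>x v. 0"]) (auto intro: polynomial_fun.const)
next
  case (inner b)
  have "((\<lambda>x. complex_of_real (x \<bullet> b)) has_derivative (\<lambda>v. complex_of_real (v \<bullet> b))) (at x)" for x
    by (intro derivative_intros has_derivative_inner_left has_derivative_ident)
  then show ?case by (intro exI[of _ "\<lambda>x v. complex_of_real (v \<bullet> b)"]) (auto intro: polynomial_fun.const)
next
  case (add p q)
  then obtain D1 D2 where D: "\<forall>x. (p has_derivative D1 x) (at x)" "\<forall>v. polynomial_fun (\<lambda>x. D1 x v)"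
    "\<forall>x. (q has_derivative D2 x) (at x)" "\<forall>v. polynomial_fun (\<lambda>x. D2 x v)" by blast
  then show ?case
    by (intro exI[of _ "\<lambda>x v. D1 x v + D2 x v"]) (auto intro!: polynomial_fun.add has_derivative_add)
next
  case (mult p q)
  then obtain D1 D2 where D: "\<forall>x. (p has_derivative D1 x) (at x)" "\<forall>v. polynomial_fun (\<lambda>x. D1 x v)"
    "\<forall>x. (q has_derivative D2 x) (at x)" "\<forall>v. polynomial_fun (\<lambda>x. D2 x v)" by blast
  then show ?case using mult.hyps
    by (intro exI[of _ "\<lambda>x v. p x * D2 x v + D1 x v * q x"])
       (auto intro!: polynomial_fun.add polynomial_fun.mult has_derivative_mult)
qed

lemma polynomial_fun_growth:
  assumes "polynomial_fun p"
  shows "\<exists>C N. 0 \<le> C \<and> (\<forall>x. cmod (p x) \<le> C * (1 + norm x) ^ N)"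
  using assms
proof induction
  case (const c)
  then show ?case by (intro exI[of _ "cmod c"] exI[of _ 0]) auto
next
  case (inner b)
  have "\<bar>x \<bullet> b\<bar> \<le> norm b * (1 + norm x) ^ 1" for x
    using Cauchy_Schwarz_ineq2[of x b] by (simp add: algebra_simps add_increasing)
  then show ?case by (intro exI[of _ "norm b"] exI[of _ 1]) auto
next
  case (add p q)
  then obtain C1 C2 N1 N2 where C: "0 \<le> C1" "0 \<le> C2" "\<And>x. cmod (p x) \<le> C1 * (1 + norm x) ^ N1" "\<And>x. cmod (q x) \<le> C2 * (1 + norm x) ^ N2"
    by blast
  have "cmod (p x + q x) \<le> (C1 + C2) * (1 + norm x) ^ (N1 + N2)" for x
  proof -
    have "C1 * (1 + norm x) ^ N1 \<le> C1 * (1 + norm x) ^ (N1 + N2)" "C2 * (1 + norm x) ^ N2 \<le> C2 * (1 + norm x) ^ (N1 + N2)"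
      using C by (auto intro!: mult_left_mono power_increasing)
    then show ?thesis
      using C(3,4)[of x] norm_triangle_ineq[of "p x" "q x"] by (simp add: distrib_right)
  qed
  then show ?case using C by (intro exI[of _ "C1 + C2"] exI[of _ "N1 + N2"]) auto
next
  case (mult p q)
  then obtain C1 C2 N1 N2 where C: "0 \<le> C1" "0 \<le> C2" "\<And>x. cmod (p x) \<le> C1 * (1 + norm x) ^ N1" "\<And>x. cmod (q x) \<le> C2 * (1 + norm x) ^ N2"
    by blast
  have "cmod (p x * q x) \<le> (C1 * C2) * (1 + norm x) ^ (N1 + N2)" for x
    using mult_mono[OF C(3,4)[of x]] C by (simp add: norm_mult power_add mult_ac)
  then show ?case using C by (intro exI[of _ "C1 * C2"] exI[of _ "N1 + N2"]) auto
qed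

text \<open>One form for two families of test functions: with \<open>y = 0\<close> it is a
  translated Gaussian density up to a constant, with \<open>x0 = 0\<close> and
  \<open>a = 1 / 2\<close> it is the modulated Gaussian against which distributions are
  tested.\<close>

definition modulated_gauss :: "real \<Rightarrow> 'a \<Rightarrow> 'a \<Rightarrow> 'a::euclidean_space \<Rightarrow> complex" where
  "modulated_gauss a x0 y x = exp (complex_of_real (- a * ((x - x0) \<bullet> (x - x0))) + \<i> * complex_of_real (y \<bullet> x))"

lemma modulated_gauss_derivative:
  "(modulated_gauss a x0 y has_derivative
     (\<lambda>v. (complex_of_real (- 2 * a * ((x - x0) \<bullet> v)) + \<i> * complex_of_real (y \<bullet> v)) * modulated_gauss a x0 y x)) (at x)"
proof -
  have "((\<lambda>x. complex_of_real (- a * ((x - x0) \<bullet> (x - x0))) + \<i> * complex_of_real (y \<bullet> x)) has_derivative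
    (\<lambda>v. complex_of_real (- a * ((x - x0) \<bullet> v + v \<bullet> (x - x0))) + \<i> * complex_of_real (y \<bullet> v))) (at x)"
    by (auto intro!: derivative_eq_intros simp: )
  then have "((\<lambda>x. complex_of_real (- a * ((x - x0) \<bullet> (x - x0))) + \<i> * complex_of_real (y \<bullet> x)) has_derivative
    (\<lambda>v. complex_of_real (- 2 * a * ((x - x0) \<bullet> v)) + \<i> * complex_of_real (y \<bullet> v))) (at x)"
    by (rule has_derivative_eq_rhs) (auto simp: fun_eq_iff inner_commute algebra_simps)
  from has_derivative_compose[OF this DERIV_exp[unfolded has_field_derivative_def]]
  show ?thesis
    unfolding modulated_gauss_def by (rule has_derivative_eq_rhs) (auto simp: fun_eq_iff mult_ac)
qed

text \<open>The logarithmic derivative of the Gaussian wave is affine in \<open>x\<close>, so each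
  differentiation only replaces the polynomial factor by another one.\<close>

lemma iter_deriv_poly_gauss:
  fixes p :: "'a::euclidean_space \<Rightarrow> complex"
  assumes "polynomial_fun p"
  shows "\<exists>q. polynomial_fun q \<and> iter_deriv bs (\<lambda>x. p x * modulated_gauss a x0 y x) = (\<lambda>x. q x * modulated_gauss a x0 y x)"
proof (induction bs)
  case Nil
  then show ?case using assms by auto
next
  case (Cons b bs)
  then obtain q where q: "polynomial_fun q" "iter_deriv bs (\<lambda>x. p x * modulated_gauss a x0 y x) = (\<lambda>x. q x * modulated_gauss a x0 y x)"
    by blast
  obtain D where D: "\<And>x. (q has_derivative D x) (at x)" "\<And>v. polynomial_fun (\<lambda>x. D x v)"
    using polynomial_fun_derivative[OF q(1)] by blast
  define r where "r x = complex_of_real (- 2 * a) * (complex_of_real (x \<bullet> b) + complex_of_real (- (x0 \<bullet> b))) + \<i> * complex_of_real (y \<bullet> b)" for x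
  have r: "polynomial_fun r"
    unfolding r_def by (intro polynomial_fun.intros)
  have "frechet_derivative (\<lambda>x. q x * modulated_gauss a x0 y x) (at x) b = (q x * r x + D x b) * modulated_gauss a x0 y x" for x
  proof -
    have "((\<lambda>x. q x * modulated_gauss a x0 y x) has_derivative
      (\<lambda>v. q x * ((complex_of_real (- 2 * a * ((x - x0) \<bullet> v)) + \<i> * complex_of_real (y \<bullet> v)) * modulated_gauss a x0 y x)
         + D x v * modulated_gauss a x0 y x)) (at x)"
      by (rule has_derivative_mult[OF D(1) modulated_gauss_derivative])
    from frechet_derivative_at[OF this, THEN fun_cong, of b, symmetric]
    show ?thesis by (simp add: r_def algebra_simps inner_diff_left)
  qed
  then show ?case
    using q r D(2) by (intro exI[of _ "\<lambda>x. q x * r x + D x b"]) (auto intro!: polynomial_fun.add polynomial_fun.mult simp: q(2))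
qed

lemma poly_gauss_schwartz:
  fixes p :: "'a::euclidean_space \<Rightarrow> complex"
  assumes a: "0 < a" and p: "polynomial_fun p"
  shows "(\<lambda>x. p x * modulated_gauss a x0 y x) \<in> schwartz"
proof (rule schwartzI)
  fix bs :: "'a list" and k :: nat
  obtain q where q: "polynomial_fun q" and eq: "iter_deriv bs (\<lambda>x. p x * modulated_gauss a x0 y x) = (\<lambda>x. q x * modulated_gauss a x0 y x)"
    using iter_deriv_poly_gauss[OF p] by blast
  obtain D where D: "\<And>x. (q has_derivative D x) (at x)"
    using polynomial_fun_derivative[OF q] by blast
  show "iter_deriv bs (\<lambda>x. p x * modulated_gauss a x0 y x) differentiable at x" for x
    unfolding eq using D modulated_gauss_derivative[of a x0 y x]
    by (intro differentiable_mult) (unfold differentiable_def, blast+)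
  obtain C N where C: "0 \<le> C" "\<And>x. cmod (q x) \<le> C * (1 + norm x) ^ N"
    using polynomial_fun_growth[OF q] by blast
  define m where "m = k + N"
  \<comment> \<open>Recentring at \<open>x0\<close> costs \<open>(1 + norm x0) ^ m\<close>. With
    \<open>u\<close> the distance from \<open>x0\<close>, the power \<open>(1 + u) ^ m\<close> is at
    most \<open>exp (m u)\<close>, and completing the square shows that
    \<open>m u - a u\<^sup>2\<close> never exceeds \<open>m\<^sup>2 / (4 a)\<close>.\<close>
  have "(1 + norm x) ^ k * cmod (q x * modulated_gauss a x0 y x) \<le> C * (1 + norm x0) ^ m * exp ((real m)\<^sup>2 / (4 * a))" for x
  proof -
    define u where "u = norm (x - x0)"
    have u: "0 \<le> u" by (simp add: u_def)
    have "1 + norm x \<le> (1 + norm x0) * (1 + u)"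
    proof -
      have "norm x \<le> u + norm x0" unfolding u_def by (metis diff_add_cancel norm_triangle_ineq)
      moreover have "0 \<le> norm x0 * u" using u by simp
      ultimately show ?thesis by (simp add: algebra_simps)
    qed
    then have *: "(1 + norm x) ^ m \<le> (1 + norm x0) ^ m * (1 + u) ^ m"
      by (subst power_mult_distrib[symmetric]) (auto intro!: power_mono)
    have "(1 + u) ^ m \<le> exp u ^ m"
      using u exp_ge_add_one_self[of u] by (intro power_mono) auto
    then have "(1 + u) ^ m * exp (- a * u\<^sup>2) \<le> exp (real m * u) * exp (- a * u\<^sup>2)"
      by (intro mult_right_mono) (auto simp: exp_of_nat_mult)
    also have "\<dots> = exp (real m * u - a * u\<^sup>2)" by (simp add: exp_add[symmetric])
    also have "\<dots> \<le> exp ((real m)\<^sup>2 / (4 * a))"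
    proof -
      have "0 \<le> (2 * a * u - real m)\<^sup>2" by simp
      then have "4 * a * (real m * u - a * u\<^sup>2) \<le> (real m)\<^sup>2"
        by (simp add: power2_eq_square algebra_simps)
      then show ?thesis using a by (simp add: field_simps)
    qed
    finally have **: "(1 + u) ^ m * exp (- a * u\<^sup>2) \<le> exp ((real m)\<^sup>2 / (4 * a))" .
    have "cmod (modulated_gauss a x0 y x) = exp (- a * u\<^sup>2)"
      unfolding modulated_gauss_def norm_exp_eq_Re u_def by (simp add: power2_norm_eq_inner)
    then have "(1 + norm x) ^ k * cmod (q x * modulated_gauss a x0 y x) = (1 + norm x) ^ k * cmod (q x) * exp (- a * u\<^sup>2)"
      by (simp add: norm_mult)
    also have "\<dots> \<le> (1 + norm x) ^ k * (C * (1 + norm x) ^ N) * exp (- a * u\<^sup>2)"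
      by (intro mult_right_mono mult_left_mono C) auto
    also have "\<dots> = C * ((1 + norm x) ^ m * exp (- a * u\<^sup>2))" by (simp add: m_def power_add)
    also have "\<dots> \<le> C * ((1 + norm x0) ^ m * (1 + u) ^ m * exp (- a * u\<^sup>2))"
      by (intro mult_left_mono mult_right_mono * C) auto
    also have "\<dots> = C * (1 + norm x0) ^ m * ((1 + u) ^ m * exp (- a * u\<^sup>2))" by simp
    also have "\<dots> \<le> C * (1 + norm x0) ^ m * exp ((real m)\<^sup>2 / (4 * a))"
      by (intro mult_left_mono ** mult_nonneg_nonneg C) auto
    finally show ?thesis .
  qed
  then show "\<exists>C. \<forall>x. (1 + norm x) ^ k * cmod (iter_deriv bs (\<lambda>x. p x * modulated_gauss a x0 y x) x) \<le> C"
    unfolding eq by blast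
qed

lemma gauss_density_schwartz:
  fixes x0 :: "'a::euclidean_space"
  assumes "0 < \<sigma>" shows "(\<lambda>x. complex_of_real (gauss_density \<sigma> (x - x0))) \<in> schwartz"
proof -
  have "(\<lambda>x. complex_of_real (1 / (sqrt (2 * pi) * \<sigma>) ^ DIM('a)) * modulated_gauss (1 / (2 * \<sigma>\<^sup>2)) x0 0 x) \<in> schwartz"
    using assms by (intro poly_gauss_schwartz polynomial_fun.const) auto
  also have "(\<lambda>x. complex_of_real (1 / (sqrt (2 * pi) * \<sigma>) ^ DIM('a)) * modulated_gauss (1 / (2 * \<sigma>\<^sup>2)) x0 0 x) =
      (\<lambda>x. complex_of_real (gauss_density \<sigma> (x - x0)))"
  proof
    fix x
    have "modulated_gauss (1 / (2 * \<sigma>\<^sup>2)) x0 0 x = complex_of_real (exp (- (norm (x - x0))\<^sup>2 / (2 * \<sigma>\<^sup>2)))"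
      by (simp add: modulated_gauss_def power2_norm_eq_inner flip: exp_of_real)
    then show "complex_of_real (1 / (sqrt (2 * pi) * \<sigma>) ^ DIM('a)) * modulated_gauss (1 / (2 * \<sigma>\<^sup>2)) x0 0 x =
      complex_of_real (gauss_density \<sigma> (x - x0))"
      unfolding gauss_density_eq[OF assms] by simp
  qed
  finally show ?thesis .
qed

text \<open>Pairing \<open>\<phi>\<close> with this function averages the transform of
  \<open>\<phi>\<close> over a Gaussian around \<open>\<xi>\<close>. Its value at the origin is 1,
  which is therefore the limit of the averages when \<open>\<phi>\<close> approaches the point mass
  at 0.\<close>

lemma iexp_gauss_exp_schwartz:
  "(\<lambda>x. iexp (\<xi> \<bullet> x) * complex_of_real (gauss_exp 1 x)) \<in> schwartz"
proof -
  have "(\<lambda>x. 1 * modulated_gauss (1 / 2) 0 \<xi> x) \<in> schwartz"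
    by (intro poly_gauss_schwartz polynomial_fun.const) auto
  also have "(\<lambda>x. 1 * modulated_gauss (1 / 2) 0 \<xi> x) = (\<lambda>x. iexp (\<xi> \<bullet> x) * complex_of_real (gauss_exp 1 x))"
    unfolding modulated_gauss_def exp_add exp_of_real gauss_exp_def
    by (simp add: power2_norm_eq_inner mult.commute)
  finally show ?thesis .
qed

lemma schwartz_distribution_dirac: "schwartz_distribution (dirac x)"
  unfolding schwartz_distribution_def dirac_def
proof (intro conjI ballI allI exI)
  fix f :: "'a \<Rightarrow> complex" assume f: "f \<in> schwartz"
  obtain B where B: "\<And>x. cmod (f x) \<le> B" using schwartz_bounded[OF f] by blast
  have *: "{bs :: 'a list. bs \<in> lists Basis \<and> length bs \<le> 0} = {[]}" by auto
  have "cmod (f x) \<le> (SUP x. (1 + norm x) ^ 0 * cmod (iter_deriv [] f x))"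
    using B by (intro cSUP_upper2[of _ _ x]) (auto intro!: bdd_aboveI2[where M=B] B)
  then show "cmod (f x) \<le> 1 * (\<Sum>bs | bs \<in> lists Basis \<and> length bs \<le> 0. schwartz_seminorm 0 bs f)"
    unfolding * schwartz_seminorm_def by simp
qed auto

section \<open>Characteristic exponents\<close>

text \<open>Half angles turn \<open>1 - cos x\<close> into \<open>2 (sin (x / 2))\<^sup>2\<close>.
  Since the absolute value of the sine is subadditive, the claim becomes
  \<open>(p + q)\<^sup>2 \<le> 2 p\<^sup>2 + 2 q\<^sup>2\<close>.\<close>

lemma one_minus_cos_add_le: "1 - cos (a + b) \<le> 2 * (1 - cos a) + 2 * (1 - cos b :: real)"
proof -
  have *: "1 - cos x = 2 * (sin (x / 2))\<^sup>2" for x :: real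
    using cos_double_sin[of "x / 2"] by simp
  have "\<bar>sin (a / 2 + b / 2)\<bar> \<le> \<bar>sin (a / 2)\<bar> * \<bar>cos (b / 2)\<bar> + \<bar>cos (a / 2)\<bar> * \<bar>sin (b / 2)\<bar>"
    unfolding sin_add abs_mult[symmetric] by (rule abs_triangle_ineq)
  also have "\<dots> \<le> \<bar>sin (a / 2)\<bar> * 1 + 1 * \<bar>sin (b / 2)\<bar>"
    by (intro add_mono mult_left_mono mult_right_mono) auto
  finally have "(sin ((a + b) / 2))\<^sup>2 \<le> (\<bar>sin (a / 2)\<bar> + \<bar>sin (b / 2)\<bar>)\<^sup>2"
    by (intro power2_le_iff_abs_le[THEN iffD2]) (auto simp: add_divide_distrib)
  also have "\<dots> \<le> 2 * (sin (a / 2))\<^sup>2 + 2 * (sin (b / 2))\<^sup>2"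
    using sum_squares_bound[of "\<bar>sin (a / 2)\<bar>" "\<bar>sin (b / 2)\<bar>"] by (simp add: power2_sum)
  finally show ?thesis
    unfolding * by simp
qed

text \<open>Multiplying the integral by its conjugate yields the transform of a difference of two
  copies; being real, it equals its cosine part. The lemma serves twice, for the law of
  \<open>X\<^sub>t\<close> and for Lebesgue measure on a time interval along a path.\<close>

lemma (in finite_measure) norm_integral_iexp_sq:
  fixes f :: "'a \<Rightarrow> 'b::euclidean_space"
  assumes [measurable]: "f \<in> borel_measurable M"
  shows "(cmod (LINT x|M. iexp (\<xi> \<bullet> f x)))\<^sup>2 = (LINT z|(M \<Otimes>\<^sub>M M). cos (\<xi> \<bullet> (f (fst z) - f (snd z))))"
proof -
  interpret pair_sigma_finite M M ..
  interpret MM: finite_measure "M \<Otimes>\<^sub>M M"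
    by (rule finite_measure_pair_measure) unfold_locales
  have int: "integrable (M \<Otimes>\<^sub>M M) (\<lambda>z. iexp (\<xi> \<bullet> (f (fst z) - f (snd z))))"
    by (rule MM.integrable_const_bound[of _ 1]) auto
  have e: "iexp (\<xi> \<bullet> (x - y)) = iexp (\<xi> \<bullet> x) * cnj (iexp (\<xi> \<bullet> y))" for x y
  proof -
    have "iexp (\<xi> \<bullet> (x - y)) = iexp (\<xi> \<bullet> x) * iexp (- (\<xi> \<bullet> y))"
      by (simp add: exp_add[symmetric] inner_diff_right algebra_simps)
    also have "iexp (- (\<xi> \<bullet> y)) = cnj (iexp (\<xi> \<bullet> y))"
      by (simp add: exp_cnj)
    finally show ?thesis .
  qed
  have "complex_of_real ((cmod (LINT x|M. iexp (\<xi> \<bullet> f x)))\<^sup>2) = (LINT x|M. iexp (\<xi> \<bullet> f x)) * cnj (LINT x|M. iexp (\<xi> \<bullet> f x))"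
    by (rule complex_norm_square)
  also have "\<dots> = (LINT x|M. (LINT y|M. iexp (\<xi> \<bullet> f x) * cnj (iexp (\<xi> \<bullet> f y))))"
    unfolding Bochner_Integration.integral_cnj integral_mult_right_zero integral_mult_left_zero ..
  also have "\<dots> = (LINT z|(M \<Otimes>\<^sub>M M). iexp (\<xi> \<bullet> (f (fst z) - f (snd z))))"
    using integral_fst'[OF int] by (simp only: e fst_conv snd_conv)
  finally have "(cmod (LINT x|M. iexp (\<xi> \<bullet> f x)))\<^sup>2 = Re (LINT z|(M \<Otimes>\<^sub>M M). iexp (\<xi> \<bullet> (f (fst z) - f (snd z))))"
    by (metis Re_complex_of_real)
  also have "\<dots> = (LINT z|(M \<Otimes>\<^sub>M M). Re (iexp (\<xi> \<bullet> (f (fst z) - f (snd z)))))"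
    by (rule integral_Re[symmetric, OF int])
  finally show ?thesis by (simp add: Re_exp)
qed

context finite_borel_measure
begin

lemma continuous_ft: "continuous_on UNIV ft"
  unfolding continuous_on_eq_continuous_at[OF open_UNIV]
proof safe
  fix x :: 'a
  show "isCont ft x"
    unfolding ft_def continuous_at_sequentially comp_def
  proof safe
    fix u assume u: "u \<longlonglongrightarrow> x"
    show "(\<lambda>n. LINT y|\<mu>. iexp (u n \<bullet> y)) \<longlonglongrightarrow> (LINT y|\<mu>. iexp (x \<bullet> y))"
    proof (rule integral_dominated_convergence[where w="\<lambda>y. 1"])
      show "AE y in \<mu>. (\<lambda>n. iexp (u n \<bullet> y)) \<longlonglongrightarrow> iexp (x \<bullet> y)"
        using u by (intro AE_I2 tendsto_intros)
    qed auto
  qed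
qed

lemma norm_ft_le: "cmod (ft \<xi>) \<le> measure \<mu> UNIV"
proof -
  have "cmod (ft \<xi>) \<le> (LINT y|\<mu>. 1)"
    unfolding ft_def by (rule norm_integral_le) auto
  then show ?thesis by simp
qed

lemma norm_ft_sq: "(cmod (ft \<xi>))\<^sup>2 = (LINT z|(\<mu> \<Otimes>\<^sub>M \<mu>). cos (\<xi> \<bullet> (fst z - snd z)))"
  unfolding ft_def by (rule norm_integral_iexp_sq) simp

text \<open>The cosine inequality is integrated against
  \<open>\<mu> \<Otimes>\<^sub>M \<mu>\<close>; total mass 1 turns the constant into 1.\<close>

lemma one_minus_norm_ft_sq_add_le:
  assumes "measure \<mu> UNIV = 1"
  shows "1 - (cmod (ft (\<xi> + \<eta>)))\<^sup>2 \<le> 2 * (1 - (cmod (ft \<xi>))\<^sup>2) + 2 * (1 - (cmod (ft \<eta>))\<^sup>2)"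
proof -
  interpret pair_sigma_finite \<mu> \<mu> ..
  interpret prob_space \<mu> by standard (simp add: emeasure_eq_measure assms)
  interpret pair_prob_space \<mu> \<mu> ..
  have int: "integrable (\<mu> \<Otimes>\<^sub>M \<mu>) (\<lambda>z. cos (\<xi> \<bullet> (fst z - snd z)))" for \<xi>
    by (rule P.integrable_const_bound[of _ 1]) auto
  have *: "1 - (cmod (ft \<xi>))\<^sup>2 = (LINT z|(\<mu> \<Otimes>\<^sub>M \<mu>). 1 - cos (\<xi> \<bullet> (fst z - snd z)))" for \<xi>
    unfolding norm_ft_sq using int by (simp add: P.prob_space)
  have "(LINT z|(\<mu> \<Otimes>\<^sub>M \<mu>). 1 - cos ((\<xi> + \<eta>) \<bullet> (fst z - snd z))) \<le>
    (LINT z|(\<mu> \<Otimes>\<^sub>M \<mu>). 2 * (1 - cos (\<xi> \<bullet> (fst z - snd z))) + 2 * (1 - cos (\<eta> \<bullet> (fst z - snd z))))"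
  proof (rule integral_mono)
    show "1 - cos ((\<xi> + \<eta>) \<bullet> (fst z - snd z)) \<le> 2 * (1 - cos (\<xi> \<bullet> (fst z - snd z))) + 2 * (1 - cos (\<eta> \<bullet> (fst z - snd z)))" for z
      unfolding inner_add_left by (rule one_minus_cos_add_le)
  qed (intro Bochner_Integration.integrable_diff Bochner_Integration.integrable_add integrable_mult_right int P.integrable_const)+
  also have "\<dots> = 2 * (LINT z|(\<mu> \<Otimes>\<^sub>M \<mu>). 1 - cos (\<xi> \<bullet> (fst z - snd z))) + 2 * (LINT z|(\<mu> \<Otimes>\<^sub>M \<mu>). 1 - cos (\<eta> \<bullet> (fst z - snd z)))"
    using int by (subst Bochner_Integration.integral_add) auto
  finally show ?thesis unfolding * .
qed

end

lemma finite_borel_measure_distr: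
  assumes "prob_space M" "X \<in> borel_measurable M"
  shows "finite_borel_measure (distr M borel X)"
proof -
  interpret prob_space M by fact
  interpret D: prob_space "distr M borel X" by (rule prob_space_distr) fact
  show ?thesis by standard simp
qed

lemma ft_distr:
  assumes "prob_space M" and [measurable]: "X \<in> borel_measurable M"
  shows "finite_borel_measure.ft (distr M borel X) \<xi> = (LINT \<omega>|M. iexp (\<xi> \<bullet> X \<omega>))"
  unfolding finite_borel_measure.ft_def[OF finite_borel_measure_distr[OF assms]]
  by (subst integral_distr) auto

text \<open>These properties of the real part of the exponent carry the whole analysis.
  \<open>add_le\<close> does double duty: it makes the weight \<open>1 / (1 + \<psi>)\<close> stable
  under translation and forces at most quadratic growth.\<close>

locale subquadratic_exponent =
  fixes \<psi> :: "'a::euclidean_space \<Rightarrow> real"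
  assumes continuous: "continuous_on UNIV \<psi>"
    and nonneg [simp]: "0 \<le> \<psi> \<xi>"
    and add_le: "\<psi> (\<xi> + \<eta>) \<le> 2 * \<psi> \<xi> + 2 * \<psi> \<eta>"

lemma levy_exponent_cmod:
  assumes "characteristic_exponent M X \<Psi>" "0 \<le> t"
  shows "cmod (LINT \<omega>|M. iexp (\<xi> \<bullet> X t \<omega>)) = exp (- t * Re (\<Psi> \<xi>))"
  using assms unfolding characteristic_exponent_def by (simp add: norm_exp_eq_Re)

text \<open>The squared modulus of the characteristic function at time \<open>t\<close> is
  \<open>exp (- 2 t \<psi>)\<close>. Dividing its distance from 1 by \<open>t\<close> and letting
  \<open>t\<close> tend to 0 recovers \<open>2 \<psi>\<close>, and the inequality for characteristic
  functions passes to the limit.\<close>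

lemma subquadratic_exponent_levy:
  fixes X :: "real \<Rightarrow> 'w \<Rightarrow> 'a::euclidean_space"
  assumes "levy_process M X" and \<Psi>: "characteristic_exponent M X \<Psi>"
  shows "subquadratic_exponent (\<lambda>\<xi>. Re (\<Psi> \<xi>))"
proof -
  interpret levy_process M X by fact
  have fb: "finite_borel_measure (distr M borel (X t))" if "0 \<le> t" for t
    using rv[OF that] by (intro finite_borel_measure_distr prob_space_axioms)
  have ft: "cmod (finite_borel_measure.ft (distr M borel (X t)) \<xi>) = exp (- t * Re (\<Psi> \<xi>))" if "0 \<le> t" for t \<xi>
    using levy_exponent_cmod[OF \<Psi> that] ft_distr[OF prob_space_axioms rv[OF that]] by simp
  have m1: "measure (distr M borel (X t)) UNIV = 1" if "0 \<le> t" for t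
    using prob_space.prob_space[OF prob_space_distr[OF rv[OF that]]] by simp
  show ?thesis
  proof
    fix \<xi> \<eta> :: 'a
    have "exp (- Re (\<Psi> \<xi>)) \<le> 1"
      using finite_borel_measure.norm_ft_le[OF fb[of 1], of \<xi>] m1[of 1] by (simp add: ft)
    then show "0 \<le> Re (\<Psi> \<xi>)" by simp
    have lim: "(\<lambda>n. (1 - exp (- (2 * Re (\<Psi> \<xi>)) * (1 / real (Suc n)))) /\<^sub>R (1 / real (Suc n))) \<longlonglongrightarrow> 2 * Re (\<Psi> \<xi>)" for \<xi>
    proof -
      have "((\<lambda>s. - exp (- (2 * Re (\<Psi> \<xi>)) * s)) has_vector_derivative 2 * Re (\<Psi> \<xi>)) (at 0)"
        unfolding has_real_derivative_iff_has_vector_derivative[symmetric]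
        by (auto intro!: derivative_eq_intros)
      moreover have "filterlim (\<lambda>n. 1 / real (Suc n)) (at 0) sequentially"
        unfolding filterlim_at using LIMSEQ_Suc[OF lim_1_over_n] by (auto intro!: always_eventually simp del: of_nat_Suc)
      ultimately show ?thesis
        by (auto dest: has_vector_derivative_quotient)
    qed
    have "2 * Re (\<Psi> (\<xi> + \<eta>)) \<le> 2 * (2 * Re (\<Psi> \<xi>)) + 2 * (2 * Re (\<Psi> \<eta>))"
    proof (rule LIMSEQ_le[OF lim tendsto_add[OF tendsto_mult[OF tendsto_const lim] tendsto_mult[OF tendsto_const lim]]], intro exI[of _ 0] allI impI)
      fix n
      define t where "t = 1 / real (Suc n)"
      have t: "0 < t" by (simp add: t_def)
      have sq: "(cmod (finite_borel_measure.ft (distr M borel (X t)) \<xi>))\<^sup>2 = exp (- (2 * Re (\<Psi> \<xi>)) * t)" for \<xi>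
        using t by (subst ft) (auto simp: power2_eq_square exp_add[symmetric] algebra_simps)
      have "1 - exp (- (2 * Re (\<Psi> (\<xi> + \<eta>))) * t) \<le> 2 * (1 - exp (- (2 * Re (\<Psi> \<xi>)) * t)) + 2 * (1 - exp (- (2 * Re (\<Psi> \<eta>)) * t))"
        using finite_borel_measure.one_minus_norm_ft_sq_add_le[OF fb m1, of t \<xi> \<eta>] t unfolding sq by simp
      from mult_left_mono[OF this, of "inverse t", OF less_imp_le[OF positive_imp_inverse_positive[OF t]]]
      show "(1 - exp (- (2 * Re (\<Psi> (\<xi> + \<eta>))) * (1 / real (Suc n)))) /\<^sub>R (1 / real (Suc n)) \<le>
        2 * ((1 - exp (- (2 * Re (\<Psi> \<xi>)) * (1 / real (Suc n)))) /\<^sub>R (1 / real (Suc n))) +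
        2 * ((1 - exp (- (2 * Re (\<Psi> \<eta>)) * (1 / real (Suc n)))) /\<^sub>R (1 / real (Suc n)))"
        unfolding t_def[symmetric] real_scaleR_def by (simp only: distrib_left mult.left_commute)
    qed
    then show "Re (\<Psi> (\<xi> + \<eta>)) \<le> 2 * Re (\<Psi> \<xi>) + 2 * Re (\<Psi> \<eta>)" by simp
  next
    \<comment> \<open>Continuity is read off at time 1, where the exponent is minus the logarithm of
      a continuous modulus without zeros.\<close>
    have eq: "Re (\<Psi> \<xi>) = - ln (cmod (finite_borel_measure.ft (distr M borel (X 1)) \<xi>))" for \<xi>
      by (simp add: ft)
    have nz: "finite_borel_measure.ft (distr M borel (X 1)) \<xi> \<noteq> 0" for \<xi>
      using ft[of 1 \<xi>] exp_not_eq_zero by force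
    show "continuous_on UNIV (\<lambda>\<xi>. Re (\<Psi> \<xi>))"
      unfolding eq by (intro continuous_intros finite_borel_measure.continuous_ft fb) (simp_all add: nz)
  qed
qed

section \<open>The weight and the growth of the exponent\<close>

context subquadratic_exponent
begin

definition J :: "'a \<Rightarrow> real" where "J \<xi> = 1 / (1 + \<psi> \<xi>)"

lemma borel_measurable_exponent [measurable]: "\<psi> \<in> borel_measurable borel"
  using continuous by (rule borel_measurable_continuous_onI)

lemma borel_measurable_J [measurable]: "J \<in> borel_measurable borel"
  unfolding J_def by measurable

lemma J_pos [simp]: "0 < J \<xi>"
  unfolding J_def using nonneg[of \<xi>] by (auto intro: add_pos_nonneg)

lemma J_nonneg [simp]: "0 \<le> J \<xi>"
  using J_pos[of \<xi>] by linarith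

lemma J_le_1 [simp]: "J \<xi> \<le> 1"
  unfolding J_def using nonneg[of \<xi>] by (auto simp: divide_le_eq add_pos_nonneg)

text \<open>An inequality of Peetre type: the cost of moving the weight from \<open>\<xi>\<close> to
  \<open>\<eta>\<close> depends on the difference alone.\<close>

lemma J_shift_le: "J \<xi> \<le> 2 * J \<eta> * (1 + \<psi> (\<eta> - \<xi>))"
proof -
  have "1 + \<psi> \<eta> \<le> 1 + 2 * \<psi> \<xi> + 2 * \<psi> (\<eta> - \<xi>)"
    using add_le[of \<xi> "\<eta> - \<xi>"] by simp
  also have "\<dots> \<le> 2 * (1 + \<psi> (\<eta> - \<xi>)) * (1 + \<psi> \<xi>)"
    by (simp add: algebra_simps)
  finally have "1 + \<psi> \<eta> \<le> 2 * (1 + \<psi> (\<eta> - \<xi>)) * (1 + \<psi> \<xi>)" .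
  then show ?thesis
    unfolding J_def using nonneg[of \<xi>] nonneg[of \<eta>] by (simp add: field_simps add_pos_nonneg)
qed

lemma quadratic_growth: obtains C where "\<And>\<xi>. \<psi> \<xi> \<le> C * (1 + (norm \<xi>)\<^sup>2)"
proof -
  have "compact (cball (0::'a) 1)" by simp
  then have "compact (\<psi> ` cball 0 1)"
    using continuous by (intro compact_continuous_image) (auto intro: continuous_on_subset)
  then obtain B where B: "\<And>\<xi>. norm \<xi> \<le> 1 \<Longrightarrow> \<psi> \<xi> \<le> B"
    by (force dest!: compact_imp_bounded simp: bounded_iff)
  have B0: "0 \<le> B" using B[of 0] nonneg[of 0] by (simp del: nonneg)
  have double: "\<psi> \<xi> \<le> 4 * \<psi> ((1/2) *\<^sub>R \<xi>)" for \<xi>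
    using add_le[of "(1/2) *\<^sub>R \<xi>" "(1/2) *\<^sub>R \<xi>"] by (simp add: scaleR_add_left[symmetric])
  \<comment> \<open>The induction counts halvings. Each one divides both
    \<open>(norm \<xi>)\<^sup>2\<close> and the bound from \<open>double\<close> by 4, until the
    point lies in the unit ball.\<close>
  have P: "\<psi> \<xi> \<le> 4 * B * (norm \<xi>)\<^sup>2" if "1 < norm \<xi>" "norm \<xi> \<le> 2 ^ k" for k \<xi>
    using that
  proof (induction k arbitrary: \<xi>)
    case (Suc k)
    show ?case
    proof (cases "norm \<xi> \<le> 2")
      case True
      then have "\<psi> \<xi> \<le> 4 * B" using double[of \<xi>] B[of "(1/2) *\<^sub>R \<xi>"] by simp
      also have "\<dots> \<le> 4 * B * (norm \<xi>)\<^sup>2"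
        using mult_left_mono[of 1 "(norm \<xi>)\<^sup>2" "4 * B"] one_le_power[of "norm \<xi>" 2] Suc.prems B0 by simp
      finally show ?thesis .
    next
      case False
      then have "\<psi> ((1/2) *\<^sub>R \<xi>) \<le> 4 * B * (norm ((1/2) *\<^sub>R \<xi>))\<^sup>2"
        using Suc.prems by (intro Suc.IH) auto
      then show ?thesis using double[of \<xi>] by (simp add: power_mult_distrib power_divide)
    qed
  qed simp
  have "\<psi> \<xi> \<le> 4 * B * (1 + (norm \<xi>)\<^sup>2)" for \<xi>
  proof (cases "norm \<xi> \<le> 1")
    case True
    then show ?thesis using B[of \<xi>] B0 by (simp add: distrib_left add_increasing2)
  next
    case False
    obtain k where "norm \<xi> \<le> 2 ^ k"
      using real_arch_pow[of 2 "norm \<xi>"] by (auto intro: less_imp_le)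
    then show ?thesis using P[of \<xi> k] False B0 by (simp add: distrib_left)
  qed
  then show ?thesis by (rule that)
qed

text \<open>Twice this integral is the factor lost when transforms are averaged over a Gaussian, see
  \<open>energy_smoothed_le\<close>.\<close>

lemma nn_integral_gauss_exponent_finite:
  "(\<integral>\<^sup>+ \<xi>. ennreal ((1 + \<psi> \<xi>) * gauss_density 1 \<xi>) \<partial>lborel) < \<infinity>"
proof -
  obtain C where C: "\<And>\<xi>. \<psi> \<xi> \<le> C * (1 + (norm \<xi>)\<^sup>2)" using quadratic_growth by blast
  have C0: "0 \<le> C" using C[of 0] nonneg[of 0] by (simp del: nonneg)
  define N where "N = 2 * DIM('a)"
  obtain B where "\<And>x::'a. (1 + norm x) ^ (N + 2) * cmod (iter_deriv [] (\<lambda>x. complex_of_real (gauss_density 1 (x - 0))) x) \<le> B"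
    using schwartz_iter_decay[OF gauss_density_schwartz[of 1 0] lists.Nil, of "N + 2"] zero_less_one by blast
  then have B: "\<And>x::'a. (1 + norm x) ^ (N + 2) * gauss_density 1 x \<le> B" by simp
  have "integrable lborel (\<lambda>\<xi>. complex_of_real ((1 + \<psi> \<xi>) * gauss_density 1 \<xi>))"
  proof (rule integrable_decay)
    fix x :: 'a
    have "1 + \<psi> x \<le> (1 + C) * (1 + norm x)\<^sup>2"
    proof -
      have "1 + \<psi> x \<le> (1 + C) * (1 + (norm x)\<^sup>2)"
        using add_mono[OF C[of x] add_increasing2[OF zero_le_power2[of "norm x"] order_refl[of "1::real"]]]
        by (simp add: distrib_right)
      also have "\<dots> \<le> (1 + C) * (1 + norm x)\<^sup>2"
        using C0 by (intro mult_left_mono) (auto simp: power2_sum)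
      finally show ?thesis .
    qed
    then have "(1 + norm x) ^ N * ((1 + \<psi> x) * gauss_density 1 x) \<le> (1 + norm x) ^ N * ((1 + C) * (1 + norm x)\<^sup>2 * gauss_density 1 x)"
      by (intro mult_left_mono mult_right_mono) auto
    also have "\<dots> = (1 + C) * ((1 + norm x) ^ (N + 2) * gauss_density 1 x)"
      by (simp add: power_add power2_eq_square)
    also have "\<dots> \<le> (1 + C) * B"
      using B[of x] C0 by (intro mult_left_mono) auto
    finally show "(1 + norm x) ^ (2 * DIM('a)) * cmod (complex_of_real ((1 + \<psi> x) * gauss_density 1 x)) \<le> (1 + C) * B"
      unfolding norm_of_real N_def[symmetric] by (simp add: abs_mult)
  qed simp
  then show ?thesis
    by (auto simp: integrable_iff_bounded norm_mult simp del: of_real_mult of_real_add)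
qed

end

section \<open>Point masses in the completion\<close>

lemma nn_integral_lborel_reflect:
  fixes f :: "'a::euclidean_space \<Rightarrow> ennreal"
  assumes [measurable]: "f \<in> borel_measurable borel"
  shows "(\<integral>\<^sup>+ x. f (c - x) \<partial>lborel) = (\<integral>\<^sup>+ x. f x \<partial>lborel)"
proof -
  have "lborel = distr lborel borel (\<lambda>x. c - x)"
    using lborel_affine[of "-1" c] by (simp add: density_1)
  then have "(\<integral>\<^sup>+ x. f x \<partial>lborel) = (\<integral>\<^sup>+ x. f x \<partial>distr lborel borel (\<lambda>x. c - x))"
    by simp
  also have "\<dots> = (\<integral>\<^sup>+ x. f (c - x) \<partial>lborel)"
    by (subst nn_integral_distr) auto
  finally show ?thesis ..
qed

lemma fourier_diff:
  assumes "integrable lborel f" "integrable lborel g"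
  shows "fourier (\<lambda>x. f x - g x) \<xi> = fourier f \<xi> - fourier g \<xi>"
proof -
  have "integrable lborel (\<lambda>x. iexp (\<xi> \<bullet> x) * f x)" "integrable lborel (\<lambda>x. iexp (\<xi> \<bullet> x) * g x)"
    by (rule integrable_bounded_mult[OF assms(1), where B=1] integrable_bounded_mult[OF assms(2), where B=1]; simp)+
  then show ?thesis
    unfolding fourier_def right_diff_distrib by (rule Bochner_Integration.integral_diff)
qed

lemma fourier_gauss_density_shift:
  assumes "0 < \<sigma>"
  shows "fourier (\<lambda>x. complex_of_real (gauss_density \<sigma> (x - x0))) \<xi> = iexp (\<xi> \<bullet> x0) * complex_of_real (gauss_exp \<sigma> \<xi>)"
proof -
  have "fourier (\<lambda>x. complex_of_real (gauss_density \<sigma> (x - x0))) \<xi> =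
    (LINT x|lborel. iexp (\<xi> \<bullet> (x0 + x)) * complex_of_real (gauss_density \<sigma> ((x0 + x) - x0)))"
    unfolding fourier_def by (rule integral_lborel_shift[symmetric]) simp
  also have "\<dots> = (LINT x|lborel. iexp (\<xi> \<bullet> x0) * (iexp (\<xi> \<bullet> x) * complex_of_real (gauss_density \<sigma> x)))"
    by (simp only: iexp_add_inner mult.assoc add_diff_cancel_left')
  also have "\<dots> = iexp (\<xi> \<bullet> x0) * fourier (\<lambda>x. complex_of_real (gauss_density \<sigma> x)) \<xi>"
    unfolding fourier_def by (rule integral_mult_right_zero)
  finally show ?thesis
    using fourier_gauss_density[OF assms, of \<xi>] by (simp add: gauss_exp_def)
qed

context subquadratic_exponent
begin

text \<open>A squared Sobolev norm of negative order adapted to \<open>\<psi>\<close>; for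
  \<open>\<psi> \<xi> = (norm \<xi>)\<^sup>2\<close> it is that of order -1 up to a
  constant.\<close>

definition energy :: "('a \<Rightarrow> complex) \<Rightarrow> real" where
  "energy \<phi> = (LINT \<xi>|lborel. (cmod (fourier \<phi> \<xi>))\<^sup>2 * J \<xi>)"

lemma integrable_energy:
  assumes \<phi>: "\<phi> \<in> schwartz"
  shows "integrable lborel (\<lambda>\<xi>. (cmod (fourier \<phi> \<xi>))\<^sup>2 * J \<xi>)"
proof -
  obtain B where B: "\<And>x. cmod (\<phi> x) \<le> B" using schwartz_bounded[OF \<phi>] by blast
  note [measurable] = borel_measurable_fourier[OF schwartz_integrable[OF \<phi>]]
  show ?thesis
    by (rule Bochner_Integration.integrable_bound[OF integrable_plancherel[OF schwartz_continuous[OF \<phi>] B schwartz_integrable[OF \<phi>]]])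
      (auto simp: abs_mult intro!: mult_left_le)
qed

lemma nn_integral_energy:
  assumes \<phi>: "\<phi> \<in> schwartz"
  shows "(\<integral>\<^sup>+ \<xi>. ennreal ((cmod (fourier \<phi> \<xi>))\<^sup>2 * J \<xi>) \<partial>lborel) = ennreal (energy \<phi>)"
  unfolding energy_def using integrable_energy[OF \<phi>] by (intro nn_integral_eq_integral) auto

lemma energy_nonneg: "0 \<le> energy \<phi>"
  unfolding energy_def by (intro Bochner_Integration.integral_nonneg) auto

text \<open>This turns the Cauchy property of a sequence into a bound for its energies.\<close>

lemma energy_le_diff:
  assumes f: "f \<in> schwartz" and g: "g \<in> schwartz"
  shows "energy f \<le> 2 * energy (\<lambda>x. f x - g x) + 2 * energy g"
proof -
  have "energy f \<le> (LINT \<xi>|lborel. 2 * ((cmod (fourier (\<lambda>x. f x - g x) \<xi>))\<^sup>2 * J \<xi>) + 2 * ((cmod (fourier g \<xi>))\<^sup>2 * J \<xi>))"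
    unfolding energy_def
  proof (rule integral_mono)
    fix \<xi>
    have "fourier f \<xi> = fourier (\<lambda>x. f x - g x) \<xi> + fourier g \<xi>"
      by (simp add: fourier_diff schwartz_integrable f g)
    then have "(cmod (fourier f \<xi>))\<^sup>2 \<le> (cmod (fourier (\<lambda>x. f x - g x) \<xi>) + cmod (fourier g \<xi>))\<^sup>2"
      by (auto intro!: power_mono norm_triangle_ineq)
    also have "\<dots> \<le> 2 * (cmod (fourier (\<lambda>x. f x - g x) \<xi>))\<^sup>2 + 2 * (cmod (fourier g \<xi>))\<^sup>2"
      using sum_squares_bound[of "cmod (fourier (\<lambda>x. f x - g x) \<xi>)" "cmod (fourier g \<xi>)"] by (simp add: power2_sum)
    finally show "(cmod (fourier f \<xi>))\<^sup>2 * J \<xi> \<le> 2 * ((cmod (fourier (\<lambda>x. f x - g x) \<xi>))\<^sup>2 * J \<xi>) + 2 * ((cmod (fourier g \<xi>))\<^sup>2 * J \<xi>)"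
      using mult_right_mono[OF _ J_nonneg[of \<xi>]] by (fastforce simp: distrib_right mult.assoc)
  qed (intro integrable_energy f g schwartz_diff Bochner_Integration.integrable_add integrable_mult_right)+
  also have "\<dots> = 2 * energy (\<lambda>x. f x - g x) + 2 * energy g"
    unfolding energy_def
    by (subst Bochner_Integration.integral_add) (auto intro!: integrable_energy f g schwartz_diff integrable_mult_right)
  finally show ?thesis .
qed

text \<open>By the multiplication formula the pairing is a Gaussian average of
  \<open>fourier \<phi>\<close> around \<open>\<xi>\<close>. Jensen's inequality moves the square
  inside, and after Tonelli the weight is transferred from the centre \<open>\<xi>\<close> to the
  point \<open>\<eta>\<close>.\<close>

lemma energy_smoothed_le:
  assumes \<phi>: "\<phi> \<in> schwartz"
  shows "(\<integral>\<^sup>+ \<xi>. ennreal (J \<xi> * (cmod (LINT x|lborel. \<phi> x * (iexp (\<xi> \<bullet> x) * complex_of_real (gauss_exp 1 x))))\<^sup>2) \<partial>lborel) \<le>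
    2 * (\<integral>\<^sup>+ \<xi>. ennreal ((1 + \<psi> \<xi>) * gauss_density 1 \<xi>) \<partial>lborel) * ennreal (energy \<phi>)"
proof -
  note int = schwartz_integrable[OF \<phi>]
  note [measurable] = borel_measurable_fourier[OF int]
  have [measurable]: "\<phi> \<in> borel_measurable borel" using int by (auto dest: borel_measurable_integrable)
  define A where "A = (\<integral>\<^sup>+ \<xi>. ennreal ((1 + \<psi> \<xi>) * gauss_density 1 \<xi>) \<partial>lborel)"
  have gint: "integrable lborel (\<lambda>\<eta>. gauss_density 1 (\<eta> - \<xi>))" for \<xi> :: 'a
    using integrable_lborel_shift[OF integrable_gauss_density[of 1], of "- \<xi>"] by (simp add: add.commute)
  have g1: "(LINT \<eta>|lborel. gauss_density 1 (\<eta> - \<xi>)) = 1" for \<xi> :: 'a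
    using integral_lborel_shift[of "gauss_density 1" "- \<xi>"] by (simp add: add.commute integral_gauss_density)
  have F: "(LINT x|lborel. \<phi> x * (iexp (\<xi> \<bullet> x) * complex_of_real (gauss_exp 1 x))) =
      (LINT \<eta>|lborel. fourier \<phi> \<eta> * complex_of_real (gauss_density 1 (\<eta> - \<xi>)))" for \<xi>
    using gint[of \<xi>] by (subst fourier_mult[OF int]) (auto simp: fourier_gauss_density_shift inner_commute)
  define L where "L = (LINT x|lborel. cmod (\<phi> x))"
  have L: "cmod (fourier \<phi> \<xi>) \<le> L" for \<xi> unfolding L_def by (rule norm_fourier_le[OF int])
  have jensen: "ennreal ((cmod (LINT \<eta>|lborel. fourier \<phi> \<eta> * complex_of_real (gauss_density 1 (\<eta> - \<xi>))))\<^sup>2) \<le>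
      (\<integral>\<^sup>+ \<eta>. ennreal ((cmod (fourier \<phi> \<eta>))\<^sup>2 * gauss_density 1 (\<eta> - \<xi>)) \<partial>lborel)" for \<xi>
  proof -
    define g where "g \<eta> = gauss_density 1 (\<eta> - \<xi>)" for \<eta>
    have [measurable]: "g \<in> borel_measurable borel" unfolding g_def by simp
    have g: "integrable lborel g" "(LINT \<eta>|lborel. g \<eta>) = 1" "\<And>\<eta>. 0 \<le> g \<eta>"
      unfolding g_def using gint g1 by auto
    define a where "a = (LINT \<eta>|lborel. cmod (fourier \<phi> \<eta>) * g \<eta>)"
    have i1: "integrable lborel (\<lambda>\<eta>. cmod (fourier \<phi> \<eta>) * g \<eta>)"
      by (rule Bochner_Integration.integrable_bound[of _ "\<lambda>\<eta>. L * g \<eta>"])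
        (use g L in \<open>auto simp: abs_mult intro!: mult_right_mono order_trans[OF L abs_ge_self]\<close>)
    have i2: "integrable lborel (\<lambda>\<eta>. (cmod (fourier \<phi> \<eta>))\<^sup>2 * g \<eta>)"
      by (rule Bochner_Integration.integrable_bound[of _ "\<lambda>\<eta>. L\<^sup>2 * g \<eta>"])
        (use g L in \<open>auto simp: abs_mult intro!: mult_right_mono power_mono\<close>)
    have "cmod (LINT \<eta>|lborel. fourier \<phi> \<eta> * complex_of_real (g \<eta>)) \<le> a"
      unfolding a_def using i1 g(3) by (intro norm_integral_le) (auto simp: norm_mult)
    then have "(cmod (LINT \<eta>|lborel. fourier \<phi> \<eta> * complex_of_real (g \<eta>)))\<^sup>2 \<le> a\<^sup>2"
      by (intro power_mono) auto
    also have "a\<^sup>2 \<le> (LINT \<eta>|lborel. (cmod (fourier \<phi> \<eta>))\<^sup>2 * g \<eta>)"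
    proof -
      \<comment> \<open>Jensen's inequality for the square is the nonnegativity of a variance under
        the probability density \<open>g\<close>.\<close>
      have "0 \<le> (LINT \<eta>|lborel. (cmod (fourier \<phi> \<eta>) - a)\<^sup>2 * g \<eta>)"
        using g by (intro Bochner_Integration.integral_nonneg) auto
      also have "(\<lambda>\<eta>. (cmod (fourier \<phi> \<eta>) - a)\<^sup>2 * g \<eta>) =
         (\<lambda>\<eta>. ((cmod (fourier \<phi> \<eta>))\<^sup>2 * g \<eta> - 2 * a * (cmod (fourier \<phi> \<eta>) * g \<eta>)) + a\<^sup>2 * g \<eta>)"
        by (simp add: fun_eq_iff power2_diff algebra_simps)
      also have "(LINT \<eta>|lborel. ((cmod (fourier \<phi> \<eta>))\<^sup>2 * g \<eta> - 2 * a * (cmod (fourier \<phi> \<eta>) * g \<eta>)) + a\<^sup>2 * g \<eta>) =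
         (LINT \<eta>|lborel. (cmod (fourier \<phi> \<eta>))\<^sup>2 * g \<eta>) - 2 * a * a + a\<^sup>2 * 1"
        using i1 i2 g(1,2) a_def
        by (subst Bochner_Integration.integral_add, simp, simp, subst Bochner_Integration.integral_diff) auto
      finally show ?thesis by (simp add: power2_eq_square)
    qed
    finally have "ennreal ((cmod (LINT \<eta>|lborel. fourier \<phi> \<eta> * complex_of_real (g \<eta>)))\<^sup>2) \<le> ennreal (LINT \<eta>|lborel. (cmod (fourier \<phi> \<eta>))\<^sup>2 * g \<eta>)"
      by (rule ennreal_leI)
    also have "\<dots> = (\<integral>\<^sup>+ \<eta>. ennreal ((cmod (fourier \<phi> \<eta>))\<^sup>2 * g \<eta>) \<partial>lborel)"
      using i2 g(3) by (intro nn_integral_eq_integral[symmetric]) auto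
    finally show ?thesis unfolding g_def .
  qed
  have "(\<integral>\<^sup>+ \<xi>. ennreal (J \<xi> * (cmod (LINT x|lborel. \<phi> x * (iexp (\<xi> \<bullet> x) * complex_of_real (gauss_exp 1 x))))\<^sup>2) \<partial>lborel) \<le>
     (\<integral>\<^sup>+ \<xi>. (\<integral>\<^sup>+ \<eta>. ennreal ((cmod (fourier \<phi> \<eta>))\<^sup>2 * (J \<xi> * gauss_density 1 (\<eta> - \<xi>))) \<partial>lborel) \<partial>lborel)"
  proof (intro nn_integral_mono)
    fix \<xi>
    have "ennreal (J \<xi> * (cmod (LINT x|lborel. \<phi> x * (iexp (\<xi> \<bullet> x) * complex_of_real (gauss_exp 1 x))))\<^sup>2) \<le>
      ennreal (J \<xi>) * (\<integral>\<^sup>+ \<eta>. ennreal ((cmod (fourier \<phi> \<eta>))\<^sup>2 * gauss_density 1 (\<eta> - \<xi>)) \<partial>lborel)"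
      unfolding F ennreal_mult'[OF J_nonneg] by (intro mult_left_mono jensen) auto
    also have "\<dots> = (\<integral>\<^sup>+ \<eta>. ennreal ((cmod (fourier \<phi> \<eta>))\<^sup>2 * (J \<xi> * gauss_density 1 (\<eta> - \<xi>))) \<partial>lborel)"
      by (subst nn_integral_cmult[symmetric]) (auto simp: ennreal_mult'[symmetric] mult_ac)
    finally show "ennreal (J \<xi> * (cmod (LINT x|lborel. \<phi> x * (iexp (\<xi> \<bullet> x) * complex_of_real (gauss_exp 1 x))))\<^sup>2) \<le>
      (\<integral>\<^sup>+ \<eta>. ennreal ((cmod (fourier \<phi> \<eta>))\<^sup>2 * (J \<xi> * gauss_density 1 (\<eta> - \<xi>))) \<partial>lborel)" .
  qed
  also have "\<dots> = (\<integral>\<^sup>+ \<eta>. (\<integral>\<^sup>+ \<xi>. ennreal ((cmod (fourier \<phi> \<eta>))\<^sup>2 * (J \<xi> * gauss_density 1 (\<eta> - \<xi>))) \<partial>lborel) \<partial>lborel)"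
    by (rule lborel_pair.Fubini') measurable
  \<comment> \<open>After \<open>J_shift_le\<close> the remaining dependence on \<open>\<xi>\<close>
    is through \<open>\<eta> - \<xi>\<close>, so the inner integral is the constant
    \<open>A\<close>.\<close>
  also have "\<dots> \<le> (\<integral>\<^sup>+ \<eta>. (\<integral>\<^sup>+ \<xi>. ennreal (2 * ((cmod (fourier \<phi> \<eta>))\<^sup>2 * J \<eta>)) * ennreal ((1 + \<psi> (\<eta> - \<xi>)) * gauss_density 1 (\<eta> - \<xi>)) \<partial>lborel) \<partial>lborel)"
  proof (intro nn_integral_mono)
    fix \<xi> \<eta> :: 'a
    have "(cmod (fourier \<phi> \<eta>))\<^sup>2 * (J \<xi> * gauss_density 1 (\<eta> - \<xi>)) \<le> (cmod (fourier \<phi> \<eta>))\<^sup>2 * ((2 * J \<eta> * (1 + \<psi> (\<eta> - \<xi>))) * gauss_density 1 (\<eta> - \<xi>))"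
      by (intro mult_left_mono mult_right_mono J_shift_le) auto
    then show "ennreal ((cmod (fourier \<phi> \<eta>))\<^sup>2 * (J \<xi> * gauss_density 1 (\<eta> - \<xi>))) \<le>
        ennreal (2 * ((cmod (fourier \<phi> \<eta>))\<^sup>2 * J \<eta>)) * ennreal ((1 + \<psi> (\<eta> - \<xi>)) * gauss_density 1 (\<eta> - \<xi>))"
      by (subst ennreal_mult'[symmetric]) (auto intro!: ennreal_leI simp: mult_ac)
  qed
  also have "\<dots> = (\<integral>\<^sup>+ \<eta>. ennreal (2 * ((cmod (fourier \<phi> \<eta>))\<^sup>2 * J \<eta>)) * A \<partial>lborel)"
  proof (intro nn_integral_cong)
    fix \<eta>
    show "(\<integral>\<^sup>+ \<xi>. ennreal (2 * ((cmod (fourier \<phi> \<eta>))\<^sup>2 * J \<eta>)) * ennreal ((1 + \<psi> (\<eta> - \<xi>)) * gauss_density 1 (\<eta> - \<xi>)) \<partial>lborel) =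
      ennreal (2 * ((cmod (fourier \<phi> \<eta>))\<^sup>2 * J \<eta>)) * A"
      unfolding A_def
      using nn_integral_lborel_reflect[of "\<lambda>\<xi>. ennreal ((1 + \<psi> \<xi>) * gauss_density 1 \<xi>)" \<eta>]
      by (subst nn_integral_cmult) auto
  qed
  also have "\<dots> = 2 * A * ennreal (energy \<phi>)"
    unfolding nn_integral_energy[OF \<phi>, symmetric]
    by (subst nn_integral_multc) (auto simp: ennreal_mult nn_integral_cmult mult_ac)
  finally show ?thesis unfolding A_def .
qed

lemma dirac_in_completion:
  fixes u :: "real \<Rightarrow> ('a \<Rightarrow> complex) \<Rightarrow> 'p \<Rightarrow> complex"
  assumes J: "integrable lborel J"
    and C: "0 \<le> C" "\<And>\<phi>. \<phi> \<in> schwartz \<Longrightarrow> (solution_dist P u t \<phi>)\<^sup>2 \<le> C * energy \<phi>"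
  shows "dirac x \<in> solution_completion P u t"
proof -
  define \<sigma> where "\<sigma> n = 1 / real (Suc n)" for n
  have \<sigma>: "0 < \<sigma> n" for n by (simp add: \<sigma>_def)
  have \<sigma>0: "\<sigma> \<longlonglongrightarrow> 0" unfolding \<sigma>_def by (rule LIMSEQ_Suc[OF lim_1_over_n])
  define \<phi> where "\<phi> n y = complex_of_real (gauss_density (\<sigma> n) (y - x))" for n y
  have \<phi>: "\<phi> n \<in> schwartz" for n unfolding \<phi>_def by (rule gauss_density_schwartz[OF \<sigma>])
  define a where "a n = (LINT \<xi>|lborel. (1 - gauss_exp (\<sigma> n) \<xi>) * J \<xi>)" for n
  have ai: "integrable lborel (\<lambda>\<xi>. (1 - gauss_exp (\<sigma> n) \<xi>) * J \<xi>)" for n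
    by (rule Bochner_Integration.integrable_bound[OF J]) (auto simp: abs_mult intro!: mult_left_le_one_le)
  have "a \<longlonglongrightarrow> (LINT \<xi>|lborel. (0::real) * J \<xi>)"
    unfolding a_def
  proof (rule integral_dominated_convergence[OF _ _ J])
    show "AE \<xi> in lborel. (\<lambda>n. (1 - gauss_exp (\<sigma> n) \<xi>) * J \<xi>) \<longlonglongrightarrow> 0 * J \<xi>"
    proof (intro AE_I2)
      fix \<xi> :: 'a
      have "(\<lambda>n. (1 - exp (- (\<sigma> n * norm \<xi>)\<^sup>2 / 2)) * J \<xi>) \<longlonglongrightarrow> (1 - exp (- (0 * norm \<xi>)\<^sup>2 / 2)) * J \<xi>"
        by (intro tendsto_intros \<sigma>0) auto
      then show "(\<lambda>n. (1 - gauss_exp (\<sigma> n) \<xi>) * J \<xi>) \<longlonglongrightarrow> 0 * J \<xi>"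
        by (simp add: gauss_exp_def)
    qed
    show "AE \<xi> in lborel. norm ((1 - gauss_exp (\<sigma> n) \<xi>) * J \<xi>) \<le> J \<xi>" for n
      by (auto simp: abs_mult intro!: mult_left_le_one_le)
  qed auto
  then have a0: "a \<longlonglongrightarrow> 0" by simp
  \<comment> \<open>Both Gaussian factors lie between 0 and 1, so the square of their difference is
    at most the difference itself, hence at most the sum of their distances from 1. Each distance
    has a small weighted integral by dominated convergence.\<close>
  have le: "energy (\<lambda>y. \<phi> m y - \<phi> n y) \<le> a m + a n" for m n
  proof -
    have "energy (\<lambda>y. \<phi> m y - \<phi> n y) \<le> (LINT \<xi>|lborel. (1 - gauss_exp (\<sigma> m) \<xi>) * J \<xi> + (1 - gauss_exp (\<sigma> n) \<xi>) * J \<xi>)"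
      unfolding energy_def
    proof (rule integral_mono)
      fix \<xi>
      have "fourier (\<lambda>y. \<phi> m y - \<phi> n y) \<xi> = iexp (\<xi> \<bullet> x) * complex_of_real (gauss_exp (\<sigma> m) \<xi> - gauss_exp (\<sigma> n) \<xi>)"
        using schwartz_integrable[OF \<phi>] unfolding \<phi>_def
        by (simp add: fourier_diff fourier_gauss_density_shift \<sigma> right_diff_distrib)
      then have "(cmod (fourier (\<lambda>y. \<phi> m y - \<phi> n y) \<xi>))\<^sup>2 = \<bar>gauss_exp (\<sigma> m) \<xi> - gauss_exp (\<sigma> n) \<xi>\<bar>\<^sup>2"
        by (simp only: norm_mult norm_of_real norm_exp_i_times mult_1)
      also have "\<dots> \<le> \<bar>gauss_exp (\<sigma> m) \<xi> - gauss_exp (\<sigma> n) \<xi>\<bar> ^ 1"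
        by (rule power_decreasing) (auto simp: abs_le_iff intro: order_trans[OF _ gauss_exp_le_1[of "\<sigma> m" \<xi>]] order_trans[OF _ gauss_exp_le_1[of "\<sigma> n" \<xi>]])
      also have "\<dots> \<le> (1 - gauss_exp (\<sigma> m) \<xi>) + (1 - gauss_exp (\<sigma> n) \<xi>)"
        unfolding power_one_right using gauss_exp_le_1[of "\<sigma> m" \<xi>] gauss_exp_le_1[of "\<sigma> n" \<xi>] by linarith
      finally show "(cmod (fourier (\<lambda>y. \<phi> m y - \<phi> n y) \<xi>))\<^sup>2 * J \<xi> \<le> (1 - gauss_exp (\<sigma> m) \<xi>) * J \<xi> + (1 - gauss_exp (\<sigma> n) \<xi>) * J \<xi>"
        unfolding distrib_right[symmetric] by (rule mult_right_mono) simp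
    qed (intro integrable_energy schwartz_diff \<phi> Bochner_Integration.integrable_add ai)+
    also have "\<dots> = a m + a n"
      unfolding a_def by (intro Bochner_Integration.integral_add ai)
    finally show ?thesis .
  qed
  have cauchy: "\<exists>N. \<forall>m\<ge>N. \<forall>n\<ge>N. solution_dist P u t (\<lambda>y. \<phi> m y - \<phi> n y) < e" if e: "0 < e" for e
  proof -
    \<comment> \<open>Dividing by \<open>C + 1\<close> keeps the threshold meaningful when
      \<open>C\<close> is 0.\<close>
    have "0 < e\<^sup>2 / (2 * (C + 1))" using e C by simp
    with a0 have "eventually (\<lambda>n. a n < e\<^sup>2 / (2 * (C + 1))) sequentially"
      by (rule order_tendstoD(2))
    then obtain N where N: "\<And>n. N \<le> n \<Longrightarrow> a n < e\<^sup>2 / (2 * (C + 1))"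
      by (auto simp: eventually_sequentially)
    have "solution_dist P u t (\<lambda>y. \<phi> m y - \<phi> n y) < e" if "N \<le> m" "N \<le> n" for m n
    proof -
      have "(solution_dist P u t (\<lambda>y. \<phi> m y - \<phi> n y))\<^sup>2 \<le> C * energy (\<lambda>y. \<phi> m y - \<phi> n y)"
        by (intro C schwartz_diff \<phi>)
      also have "\<dots> \<le> (C + 1) * energy (\<lambda>y. \<phi> m y - \<phi> n y)"
        using energy_nonneg by (intro mult_right_mono) auto
      also have "\<dots> \<le> (C + 1) * (a m + a n)"
        using C by (intro mult_left_mono le) auto
      also have "\<dots> < (C + 1) * (e\<^sup>2 / (2 * (C + 1)) + e\<^sup>2 / (2 * (C + 1)))"
        using C N[OF that(1)] N[OF that(2)] by (intro mult_strict_left_mono) auto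
      also have "\<dots> = e\<^sup>2"
      proof -
        have F: "D * (x / (2 * D) + x / (2 * D)) = x" if "0 < D" for D x :: real
          using that by (simp add: field_simps)
        show ?thesis by (rule F) (use C in simp)
      qed
      finally show ?thesis using e by (intro power_less_imp_less_base[of _ 2 e]) auto
    qed
    then show ?thesis by blast
  qed
  have lim: "(\<lambda>n. LINT y|lborel. \<phi> n y * h y) \<longlonglongrightarrow> dirac x h" if h: "h \<in> schwartz" for h
  proof -
    obtain B where B: "\<And>x. cmod (h x) \<le> B" using schwartz_bounded[OF h] by blast
    show ?thesis
      using gauss_approx_identity[OF schwartz_continuous[OF h] B \<sigma> \<sigma>0, of x]
      by (simp add: \<phi>_def dirac_def scaleR_conv_of_real)
  qed
  show ?thesis
    unfolding solution_completion_def using schwartz_distribution_dirac \<phi> cauchy lim by blast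
qed

lemma integrable_J_of_dirac_in_completion:
  fixes u :: "real \<Rightarrow> ('a \<Rightarrow> complex) \<Rightarrow> 'p \<Rightarrow> complex"
  assumes d: "dirac 0 \<in> solution_completion P u t"
    and c: "0 < c" "\<And>\<phi>. \<phi> \<in> schwartz \<Longrightarrow> c * energy \<phi> \<le> (solution_dist P u t \<phi>)\<^sup>2"
  shows "integrable lborel J"
proof -
  obtain \<phi> where \<phi>: "\<And>n. \<phi> n \<in> schwartz"
    and cauchy: "\<And>e. e > 0 \<Longrightarrow> \<exists>N. \<forall>m\<ge>N. \<forall>n\<ge>N. solution_dist P u t (\<lambda>x. \<phi> m x - \<phi> n x) < e"
    and lim: "\<And>h. h \<in> schwartz \<Longrightarrow> (\<lambda>n. LINT x|lborel. \<phi> n x * h x) \<longlonglongrightarrow> dirac 0 h"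
    using d unfolding solution_completion_def by blast
  obtain N where N: "\<And>m n. N \<le> m \<Longrightarrow> N \<le> n \<Longrightarrow> solution_dist P u t (\<lambda>x. \<phi> m x - \<phi> n x) < 1"
    using cauchy[of 1] by auto
  \<comment> \<open>Beyond \<open>N\<close> the differences from \<open>\<phi> N\<close> have energy
    at most \<open>1 / c\<close>, and \<open>energy_le_diff\<close> doubles both
    contributions.\<close>
  define B where "B = 2 / c + 2 * energy (\<phi> N)"
  have B: "energy (\<phi> n) \<le> B" if "N \<le> n" for n
  proof -
    have "c * energy (\<lambda>x. \<phi> n x - \<phi> N x) \<le> (solution_dist P u t (\<lambda>x. \<phi> n x - \<phi> N x))\<^sup>2"
      by (intro c schwartz_diff \<phi>)
    also have "\<dots> \<le> 1"
      using N[OF that order_refl] by (intro power_le_one) (auto simp: solution_dist_def)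
    finally have "energy (\<lambda>x. \<phi> n x - \<phi> N x) \<le> 1 / c" using c by (simp add: field_simps)
    then show ?thesis
      using energy_le_diff[OF \<phi>[of n] \<phi>[of N]] by (simp add: B_def)
  qed
  define F where "F n \<xi> = (LINT x|lborel. \<phi> n x * (iexp (\<xi> \<bullet> x) * complex_of_real (gauss_exp 1 x)))" for n \<xi>
  have F: "(\<lambda>n. F n \<xi>) \<longlonglongrightarrow> 1" for \<xi>
    using lim[OF iexp_gauss_exp_schwartz[of \<xi>]] by (simp add: F_def dirac_def gauss_exp_def)
  have [measurable]: "\<phi> n \<in> borel_measurable borel" for n
    using schwartz_integrable[OF \<phi>] by (auto dest: borel_measurable_integrable)
  have [measurable]: "F n \<in> borel_measurable borel" for n
    unfolding F_def by measurable
  define A where "A = (\<integral>\<^sup>+ \<xi>. ennreal ((1 + \<psi> \<xi>) * gauss_density 1 \<xi>) \<partial>lborel)"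
  \<comment> \<open>Since \<open>F n \<xi>\<close> tends to 1 for every \<open>\<xi>\<close>, the
    weight is the pointwise limit of the averaged energy densities, and Fatou's lemma
    applies.\<close>
  have "(\<integral>\<^sup>+ \<xi>. ennreal (J \<xi>) \<partial>lborel) = (\<integral>\<^sup>+ \<xi>. liminf (\<lambda>n. ennreal (J \<xi> * (cmod (F n \<xi>))\<^sup>2)) \<partial>lborel)"
  proof (intro nn_integral_cong)
    fix \<xi> :: 'a
    have "(\<lambda>n. J \<xi> * (cmod (F n \<xi>))\<^sup>2) \<longlonglongrightarrow> J \<xi> * (cmod 1)\<^sup>2"
      by (intro tendsto_intros F)
    then have "(\<lambda>n. ennreal (J \<xi> * (cmod (F n \<xi>))\<^sup>2)) \<longlonglongrightarrow> ennreal (J \<xi>)"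
      by (simp add: tendsto_ennrealI)
    then show "ennreal (J \<xi>) = liminf (\<lambda>n. ennreal (J \<xi> * (cmod (F n \<xi>))\<^sup>2))"
      by (intro lim_imp_Liminf[symmetric]) auto
  qed
  also have "\<dots> \<le> liminf (\<lambda>n. \<integral>\<^sup>+ \<xi>. ennreal (J \<xi> * (cmod (F n \<xi>))\<^sup>2) \<partial>lborel)"
    by (rule nn_integral_liminf) measurable
  also have "\<dots> \<le> 2 * A * ennreal B"
  proof (rule Liminf_le)
    show "eventually (\<lambda>n. (\<integral>\<^sup>+ \<xi>. ennreal (J \<xi> * (cmod (F n \<xi>))\<^sup>2) \<partial>lborel) \<le> 2 * A * ennreal B) sequentially"
      unfolding eventually_sequentially
    proof (intro exI[of _ N] allI impI)
      fix n assume "N \<le> n"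
      have "(\<integral>\<^sup>+ \<xi>. ennreal (J \<xi> * (cmod (F n \<xi>))\<^sup>2) \<partial>lborel) \<le> 2 * A * ennreal (energy (\<phi> n))"
        unfolding F_def A_def by (rule energy_smoothed_le[OF \<phi>])
      also have "\<dots> \<le> 2 * A * ennreal B"
        using B[OF \<open>N \<le> n\<close>] by (intro mult_left_mono ennreal_leI) auto
      finally show "(\<integral>\<^sup>+ \<xi>. ennreal (J \<xi> * (cmod (F n \<xi>))\<^sup>2) \<partial>lborel) \<le> 2 * A * ennreal B" .
    qed
  qed simp
  also have "\<dots> < \<infinity>"
    using nn_integral_gauss_exponent_finite by (simp add: A_def ennreal_mult_less_top)
  finally show ?thesis
    by (intro integrableI_bounded) auto
qed

text \<open>All that is used of an equation is that its metric is comparable with the energy, with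
  constants depending on time. The lower bound is asked only for \<open>t > 0\<close>, the metric
  being degenerate at \<open>t = 0\<close>; necessity is drawn from the single point 0 and the
  single time 1.\<close>

lemma random_field_solutions_iff:
  fixes u :: "real \<Rightarrow> ('a \<Rightarrow> complex) \<Rightarrow> 'p \<Rightarrow> complex"
  assumes upper: "\<And>t. 0 \<le> t \<Longrightarrow> \<exists>C\<ge>0. \<forall>\<phi>\<in>schwartz. (solution_dist P u t \<phi>)\<^sup>2 \<le> C * energy \<phi>"
    and lower: "\<And>t. 0 < t \<Longrightarrow> \<exists>c>0. \<forall>\<phi>\<in>schwartz. c * energy \<phi> \<le> (solution_dist P u t \<phi>)\<^sup>2"
  shows "has_random_field_solutions P u \<longleftrightarrow> integrable lborel J"
proof
  assume "has_random_field_solutions P u"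
  then have "dirac 0 \<in> solution_completion P u 1"
    by (simp add: has_random_field_solutions_def)
  moreover obtain c where "0 < c" "\<forall>\<phi>\<in>schwartz. c * energy \<phi> \<le> (solution_dist P u 1 \<phi>)\<^sup>2"
    using lower[of 1] by auto
  ultimately show "integrable lborel J"
    using integrable_J_of_dirac_in_completion[of P u 1 c] by blast
next
  assume J: "integrable lborel J"
  have "dirac x \<in> solution_completion P u t" if t: "0 \<le> t" for x t
  proof -
    obtain C where "0 \<le> C" "\<forall>\<phi>\<in>schwartz. (solution_dist P u t \<phi>)\<^sup>2 \<le> C * energy \<phi>"
      using upper[OF t] by auto
    then show ?thesis by (intro dirac_in_completion[OF J]) auto
  qed
  then show "has_random_field_solutions P u"
    by (simp add: has_random_field_solutions_def)
qed

end

section \<open>Second moments of the solutions\<close>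

lemma nn_integral_exp_decay:
  assumes t: "0 \<le> t" and l: "0 < l"
  shows "(\<integral>\<^sup>+ s. ennreal (exp (- l * (t - s))) * indicator {0..t} s \<partial>lborel) = ennreal ((1 - exp (- l * t)) / l)"
proof -
  have "(\<integral>\<^sup>+ s. ennreal (exp (- l * (t - s))) * indicator {0..t} s \<partial>lborel) = exp (- l * (t - t)) / l - exp (- l * (t - 0)) / l"
    using t l by (intro nn_integral_FTC_Icc) (auto intro!: derivative_eq_intros)
  then show ?thesis by (simp add: diff_divide_distrib)
qed

text \<open>Replacing the rate \<open>2 v\<close> by \<open>2 (1 + v)\<close> changes the integrand
  by a factor between \<open>exp (- 2 t)\<close> and 1, and the new integral is explicit with no
  division by zero at \<open>v = 0\<close>.\<close>

lemma heat_multiplier_bounds: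
  fixes v :: real
  assumes t: "0 \<le> t" and v: "0 \<le> v"
  shows "ennreal ((1 - exp (- 2 * t)) / 2 * (1 / (1 + v))) \<le> (\<integral>\<^sup>+ s. ennreal (exp (- 2 * (t - s) * v)) * indicator {0..t} s \<partial>lborel)"
    and "(\<integral>\<^sup>+ s. ennreal (exp (- 2 * (t - s) * v)) * indicator {0..t} s \<partial>lborel) \<le> ennreal (exp (2 * t) / 2 * (1 / (1 + v)))"
proof -
  define l where "l = 2 * (1 + v)"
  have l: "0 < l" using v by (simp add: l_def)
  note * = nn_integral_exp_decay[OF t l]
  have "(1 - exp (- 2 * t)) / 2 * (1 / (1 + v)) = (1 - exp (- 2 * t)) / l"
    by (simp add: l_def)
  also have "\<dots> \<le> (1 - exp (- l * t)) / l"
  proof -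
    have "0 \<le> t * v" using t v by simp
    then have "- l * t \<le> - 2 * t" by (simp add: l_def algebra_simps)
    then show ?thesis using l by (intro divide_right_mono) auto
  qed
  finally have "ennreal ((1 - exp (- 2 * t)) / 2 * (1 / (1 + v))) \<le> (\<integral>\<^sup>+ s. ennreal (exp (- l * (t - s))) * indicator {0..t} s \<partial>lborel)"
    unfolding * by (rule ennreal_leI)
  also have "\<dots> \<le> (\<integral>\<^sup>+ s. ennreal (exp (- 2 * (t - s) * v)) * indicator {0..t} s \<partial>lborel)"
    by (intro nn_integral_mono) (auto simp: l_def algebra_simps split: split_indicator intro!: ennreal_leI)
  finally show "ennreal ((1 - exp (- 2 * t)) / 2 * (1 / (1 + v))) \<le> (\<integral>\<^sup>+ s. ennreal (exp (- 2 * (t - s) * v)) * indicator {0..t} s \<partial>lborel)" .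
  have "(\<integral>\<^sup>+ s. ennreal (exp (- 2 * (t - s) * v)) * indicator {0..t} s \<partial>lborel) \<le>
      (\<integral>\<^sup>+ s. ennreal (exp (2 * t)) * (ennreal (exp (- l * (t - s))) * indicator {0..t} s) \<partial>lborel)"
    by (intro nn_integral_mono)
      (auto simp: l_def algebra_simps ennreal_mult'[symmetric] exp_add[symmetric] split: split_indicator intro!: ennreal_leI)
  also have "\<dots> = ennreal (exp (2 * t)) * ennreal ((1 - exp (- l * t)) / l)"
    unfolding *[symmetric] by (subst nn_integral_cmult) auto
  also have "\<dots> \<le> ennreal (exp (2 * t)) * ennreal (1 / l)"
    using l by (intro mult_left_mono ennreal_leI divide_right_mono) auto
  also have "\<dots> = ennreal (exp (2 * t) / 2 * (1 / (1 + v)))"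
    by (subst ennreal_mult'[symmetric]) (auto simp: l_def)
  finally show "(\<integral>\<^sup>+ s. ennreal (exp (- 2 * (t - s) * v)) * indicator {0..t} s \<partial>lborel) \<le> ennreal (exp (2 * t) / 2 * (1 / (1 + v)))" .
qed

lemma half_le_sin: "x / 2 \<le> sin x" if "0 \<le> x" "x \<le> 1" for x :: real
proof -
  have "sin 0 - 0 / 2 \<le> sin x - x / 2"
  proof (rule DERIV_nonneg_imp_nondecreasing[OF that(1)])
    fix y assume y: "0 \<le> y" "y \<le> x"
    have "cos (pi / 3) \<le> cos y"
      using y that pi_gt3 by (intro cos_monotone_0_pi_le) auto
    then show "\<exists>z. ((\<lambda>x. sin x - x / 2) has_real_derivative z) (at y) \<and> 0 \<le> z"
      by (intro exI[of _ "cos y - 1 / 2"]) (auto intro!: derivative_eq_intros simp: cos_60)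
  qed
  then show ?thesis by simp
qed

text \<open>Written with \<open>sinc\<close> the kernel is visibly continuous in \<open>v\<close>
  down to \<open>v = 0\<close>; Plancherel's identity needs this for the wave integrand.\<close>

lemma wave_kernel_eq_sinc: "0 \<le> v \<Longrightarrow> wave_kernel v r = r * sinc (sqrt v * r)"
  by (auto simp: wave_kernel_def)

text \<open>The two summands of the bound come from two estimates of the sine: by 1, which controls
  the part multiplied by \<open>v\<close>, and by its argument, which controls the rest.\<close>

lemma wave_kernel_sq_le:
  assumes "0 \<le> v" shows "(wave_kernel v r)\<^sup>2 * (1 + v) \<le> 1 + r\<^sup>2"
proof (cases "v = 0")
  case False
  then have v: "0 < v" using assms by simp
  have "(wave_kernel v r)\<^sup>2 * v = (sin (sqrt v * r))\<^sup>2"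
    using v by (simp add: wave_kernel_def power_divide)
  also have "\<dots> \<le> 1" by (simp add: abs_square_le_1)
  finally have 1: "(wave_kernel v r)\<^sup>2 * v \<le> 1" .
  have "\<bar>sin (sqrt v * r)\<bar> \<le> \<bar>sqrt v * r\<bar>" by (rule abs_sin_x_le_abs_x)
  then have "\<bar>wave_kernel v r\<bar> \<le> \<bar>r\<bar>"
    using v by (simp add: wave_kernel_def abs_mult divide_le_eq mult.commute)
  then have "(wave_kernel v r)\<^sup>2 \<le> r\<^sup>2" by (simp add: abs_le_square_iff)
  with 1 show ?thesis by (simp add: distrib_left)
qed (simp add: wave_kernel_def)

lemma abs_wave_kernel_le: "0 \<le> v \<Longrightarrow> \<bar>wave_kernel v r\<bar> \<le> 1 + r\<^sup>2"
proof -
  assume v: "0 \<le> v"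
  have "(wave_kernel v r)\<^sup>2 * 1 \<le> (wave_kernel v r)\<^sup>2 * (1 + v)"
    using v by (intro mult_left_mono) auto
  also have "\<dots> \<le> 1 + r\<^sup>2" by (rule wave_kernel_sq_le[OF v])
  also have "\<dots> \<le> (1 + r\<^sup>2)\<^sup>2" by (simp add: power2_sum)
  finally show ?thesis by (intro abs_le_square_iff[THEN iffD2, of "wave_kernel v r" "1 + r\<^sup>2", simplified]) simp
qed

lemma borel_measurable_wave_kernel [measurable (raw)]:
  assumes [measurable]: "f \<in> borel_measurable M" "g \<in> borel_measurable M"
  shows "(\<lambda>x. wave_kernel (f x) (g x)) \<in> borel_measurable M"
  unfolding wave_kernel_def by measurable

text \<open>The lower bound has two regimes. If \<open>sqrt v * t \<le> 1\<close>, then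
  \<open>sin x \<ge> x / 2\<close> on the relevant range, and the integral of
  \<open>(t - s)\<^sup>2 / 4\<close> is \<open>t ^ 3 / 12\<close>. Otherwise the squared sine is
  integrated exactly: its mean contributes \<open>t / 2\<close>, the oscillating term takes away at
  most \<open>t / 4\<close>, and \<open>t / (4 v)\<close> remains.\<close>

lemma wave_multiplier_bounds:
  fixes v :: real
  assumes t: "0 < t" and v: "0 \<le> v"
  shows "ennreal (min (t ^ 3 / 12) (t / 4) * (1 / (1 + v))) \<le> (\<integral>\<^sup>+ s. ennreal ((wave_kernel v (t - s))\<^sup>2) * indicator {0..t} s \<partial>lborel)" (is "?L \<le> ?I")
    and "(\<integral>\<^sup>+ s. ennreal ((wave_kernel v (t - s))\<^sup>2) * indicator {0..t} s \<partial>lborel) \<le> ennreal (t * (1 + t\<^sup>2) * (1 / (1 + v)))"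
proof -
  have "?I \<le> (\<integral>\<^sup>+ s. ennreal ((1 + t\<^sup>2) / (1 + v)) * indicator {0..t} s \<partial>lborel)"
  proof (intro nn_integral_mono)
    fix s
    show "ennreal ((wave_kernel v (t - s))\<^sup>2) * indicator {0..t} s \<le> ennreal ((1 + t\<^sup>2) / (1 + v)) * indicator {0..t} s"
    proof (cases "s \<in> {0..t}")
      case True
      then have "(t - s)\<^sup>2 \<le> t\<^sup>2" by (intro power_mono) auto
      then have "(wave_kernel v (t - s))\<^sup>2 * (1 + v) \<le> 1 + t\<^sup>2"
        using wave_kernel_sq_le[OF v, of "t - s"] by linarith
      then show ?thesis using True v by (auto intro!: ennreal_leI simp: pos_le_divide_eq)
    qed simp
  qed
  also have "\<dots> = ennreal (t * (1 + t\<^sup>2) * (1 / (1 + v)))"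
    using t v by (subst nn_integral_cmult_indicator) (simp_all add: ennreal_mult[symmetric] mult.commute)
  finally show "?I \<le> ennreal (t * (1 + t\<^sup>2) * (1 / (1 + v)))" .
  show "?L \<le> ?I"
  proof (cases "sqrt v * t \<le> 1")
    case True
    have "?L \<le> ennreal (t ^ 3 / 12)"
    proof (intro ennreal_leI)
      have "min (t ^ 3 / 12) (t / 4) * (1 / (1 + v)) \<le> min (t ^ 3 / 12) (t / 4) * 1"
        using t v by (intro mult_left_mono) (auto simp: divide_le_eq)
      then show "min (t ^ 3 / 12) (t / 4) * (1 / (1 + v)) \<le> t ^ 3 / 12" by simp
    qed
    also have "ennreal (t ^ 3 / 12) = (\<integral>\<^sup>+ s. ennreal ((t - s)\<^sup>2 / 4) * indicator {0..t} s \<partial>lborel)"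
    proof -
      have "(\<integral>\<^sup>+ s. ennreal ((t - s)\<^sup>2 / 4) * indicator {0..t} s \<partial>lborel) = - ((t - t) ^ 3) / 12 - (- ((t - 0) ^ 3) / 12)"
        using t by (intro nn_integral_FTC_Icc) (auto intro!: derivative_eq_intros simp: power2_eq_square)
      then show ?thesis by simp
    qed
    also have "\<dots> \<le> ?I"
    proof (intro nn_integral_mono)
      fix s
      show "ennreal ((t - s)\<^sup>2 / 4) * indicator {0..t} s \<le> ennreal ((wave_kernel v (t - s))\<^sup>2) * indicator {0..t} s"
      proof (cases "s \<in> {0..t}")
        case s: True
        have "(t - s) / 2 \<le> wave_kernel v (t - s)"
        proof (cases "v = 0")
          case False
          then have v: "0 < sqrt v" using v by simp
          have "sqrt v * (t - s) \<le> sqrt v * t" using v s by (intro mult_left_mono) auto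
          with True have "sqrt v * (t - s) \<le> 1" by (rule order_trans[rotated])
          then have "sqrt v * (t - s) / 2 \<le> sin (sqrt v * (t - s))"
            using s v by (intro half_le_sin) auto
          then have "(t - s) / 2 * sqrt v \<le> sin (sqrt v * (t - s))" by (simp add: mult_ac)
          then show ?thesis using v False by (simp add: wave_kernel_def pos_le_divide_eq)
        qed (use s in \<open>auto simp: wave_kernel_def\<close>)
        then have "((t - s) / 2)\<^sup>2 \<le> (wave_kernel v (t - s))\<^sup>2"
          using s by (intro power_mono) auto
        then show ?thesis using s by (auto intro!: ennreal_leI simp: power_divide)
      qed simp
    qed
    finally show ?thesis .
  next
    case False
    then have "v \<noteq> 0" by auto
    then have v: "0 < v" using v by simp
    define r where "r = sqrt v"
    have r: "0 < r" "r * r = v" using v by (auto simp: r_def)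
    have rt: "1 < r * t" using False by (simp add: r_def)
    define F where "F s = - ((t - s) / 2 - sin (2 * (r * (t - s))) / (4 * r)) / v" for s
    have "?I = ennreal (F t - F 0)"
    proof (rule nn_integral_FTC_Icc)
      fix s
      have "(wave_kernel v (t - s))\<^sup>2 = (1 - cos (2 * (r * (t - s)))) / 2 / v"
        using v unfolding wave_kernel_def r_def cos_double_sin by (simp add: power_divide)
      moreover have "(F has_real_derivative (1 - cos (2 * (r * (t - s)))) / 2 / v) (at s)"
        unfolding F_def using r v by (auto intro!: derivative_eq_intros simp: field_simps)
      ultimately show "(F has_real_derivative (wave_kernel v (t - s))\<^sup>2) (at s)" by simp
    qed (use t in auto)
    also have "?L \<le> ennreal (F t - F 0)"
    proof (intro ennreal_leI)
      have "sin (2 * (r * t)) / (4 * r) \<le> 1 / (4 * r)"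
        using r by (intro divide_right_mono) auto
      also have "\<dots> \<le> t / 4" using rt r by (simp add: field_simps)
      finally have "t / 4 / v \<le> (t / 2 - sin (2 * (r * t)) / (4 * r)) / v"
        using v by (intro divide_right_mono) auto
      also have "\<dots> = F t - F 0" by (simp add: F_def diff_divide_distrib)
      finally have 1: "t / 4 / v \<le> F t - F 0" .
      have "min (t ^ 3 / 12) (t / 4) * (1 / (1 + v)) \<le> t / 4 * (1 / v)"
        using t v by (intro mult_mono divide_left_mono) auto
      with 1 show "min (t ^ 3 / 12) (t / 4) * (1 / (1 + v)) \<le> F t - F 0" by simp
    qed
    finally show ?thesis .
  qed
qed

section \<open>The space-time measure and the Wiener isometry\<close>

lemma measurable_fst_spacetime [measurable]: "fst \<in> borel_measurable (spacetime :: (real \<times> 'a::euclidean_space) measure)"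
proof -
  have "fst \<in> measurable (spacetime :: (real \<times> 'a) measure) (restrict_space lborel {0..})"
    unfolding spacetime_def by simp
  moreover have "(\<lambda>x. x) \<in> borel_measurable (restrict_space lborel {0::real..})"
    by (intro measurable_restrict_space1) simp
  ultimately show ?thesis by (rule measurable_compose)
qed

lemma measurable_snd_spacetime [measurable]: "snd \<in> borel_measurable (spacetime :: (real \<times> 'a::euclidean_space) measure)"
  unfolding spacetime_def by simp

lemma nn_integral_spacetime:
  fixes h :: "real \<times> 'a::euclidean_space \<Rightarrow> ennreal"
  assumes h: "h \<in> borel_measurable spacetime"
  shows "(\<integral>\<^sup>+ z. h z \<partial>spacetime) = (\<integral>\<^sup>+ s. (\<integral>\<^sup>+ y. h (s, y) \<partial>lborel) * indicator {0..} s \<partial>lborel)"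
proof -
  have "(\<integral>\<^sup>+ z. h z \<partial>spacetime) = (\<integral>\<^sup>+ s. (\<integral>\<^sup>+ y. h (s, y) \<partial>lborel) \<partial>restrict_space lborel {0..})"
    using h unfolding spacetime_def by (rule lborel.nn_integral_fst[symmetric])
  also have "\<dots> = (\<integral>\<^sup>+ s. (\<integral>\<^sup>+ y. h (s, y) \<partial>lborel) * indicator {0..} s \<partial>lborel)"
    by (rule nn_integral_restrict_space) simp
  finally show ?thesis .
qed

context white_noise
begin

text \<open>The covariance identity does not give integrability, because the Bochner integral of a
  non-integrable function is 0 by convention. Finite second moments come from Gaussianity, applied
  to the one-term sum.\<close>

lemma integrable_noise_sq:
  assumes g: "square_integrable spacetime g"
  shows "integrable P (\<lambda>\<omega>. (w g \<omega>)\<^sup>2)"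
proof -
  have "centred_gaussian P (\<lambda>\<omega>. \<Sum>h\<in>{g}. 1 * w h \<omega>)"
    using g by (intro gaussian) auto
  then have *: "w g \<in> borel_measurable P" "(AE \<omega> in P. w g \<omega> = 0) \<or> (\<exists>\<sigma>>0. distributed P lborel (w g) (normal_density 0 \<sigma>))"
    unfolding centred_gaussian_def by simp_all
  note [measurable] = *(1)
  from *(2) show ?thesis
  proof
    assume "AE \<omega> in P. w g \<omega> = 0"
    then have "integrable P (\<lambda>\<omega>. (w g \<omega>)\<^sup>2) \<longleftrightarrow> integrable P (\<lambda>\<omega>. 0 :: real)"
      by (intro integrable_cong_AE) auto
    then show ?thesis by simp
  next
    assume "\<exists>\<sigma>>0. distributed P lborel (w g) (normal_density 0 \<sigma>)"
    then obtain \<sigma> where \<sigma>: "0 < \<sigma>" "distributed P lborel (w g) (normal_density 0 \<sigma>)" by blast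
    have "integrable lborel (\<lambda>x. normal_density 0 \<sigma> x * x\<^sup>2)"
      using integrable_normal_moment[OF \<sigma>(1), of 0 2] by simp
    then show ?thesis
      using distributed_integrable[OF \<sigma>(2), of "\<lambda>x. x\<^sup>2"] by simp
  qed
qed

text \<open>The squared modulus separates into real and imaginary part, and each part is a real
  Wiener integral.\<close>

lemma wiener_isometry:
  assumes h: "h \<in> borel_measurable spacetime" and fin: "integrable spacetime (\<lambda>z. (cmod (h z))\<^sup>2)"
  shows "expectation (\<lambda>\<omega>. (cmod (wiener_integral w h \<omega>))\<^sup>2) = (LINT z|spacetime. (cmod (h z))\<^sup>2)"
proof -
  note [measurable] = h
  have i1: "integrable spacetime (\<lambda>z. (Re (h z))\<^sup>2)" and i2: "integrable spacetime (\<lambda>z. (Im (h z))\<^sup>2)"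
    by (auto intro!: Bochner_Integration.integrable_bound[OF fin] simp: cmod_power2)
  have s1: "square_integrable spacetime (\<lambda>z. Re (h z))" and s2: "square_integrable spacetime (\<lambda>z. Im (h z))"
    unfolding square_integrable_def using i1 i2 by auto
  have "expectation (\<lambda>\<omega>. (cmod (wiener_integral w h \<omega>))\<^sup>2) =
     expectation (\<lambda>\<omega>. (w (\<lambda>z. Re (h z)) \<omega>)\<^sup>2) + expectation (\<lambda>\<omega>. (w (\<lambda>z. Im (h z)) \<omega>)\<^sup>2)"
    unfolding wiener_integral_def cmod_power2 complex.sel
    by (intro Bochner_Integration.integral_add integrable_noise_sq s1 s2)
  also have "\<dots> = (LINT z|spacetime. (Re (h z))\<^sup>2) + (LINT z|spacetime. (Im (h z))\<^sup>2)"
    using covariance[OF s1 s1] covariance[OF s2 s2] by (simp add: power2_eq_square)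
  also have "\<dots> = (LINT z|spacetime. (cmod (h z))\<^sup>2)"
    unfolding cmod_power2 by (rule Bochner_Integration.integral_add[symmetric, OF i1 i2])
  finally show ?thesis .
qed

end

context subquadratic_exponent
begin

text \<open>The argument common to both equations. \<open>slice\<close> is Plancherel's identity at
  a fixed time, Tonelli moves the time integral onto the multiplier \<open>k\<close>, and two-sided
  bounds on that integral become bounds by the energy. \<open>\<kappa>\<close> absorbs Plancherel's
  constant, which is \<open>(2 * pi) ^ DIM('a)\<close> for the wave equation and its inverse for the
  heat equation.\<close>

lemma wiener_energy_bounds:
  assumes wn: "white_noise P w" and h: "h \<in> borel_measurable spacetime" and \<phi>: "\<phi> \<in> schwartz"
    and k [measurable]: "case_prod k \<in> borel_measurable (lborel \<Otimes>\<^sub>M lborel)"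
    and k0: "\<And>s \<xi>. 0 \<le> k s \<xi>" and \<kappa>: "0 \<le> \<kappa>" and t: "0 \<le> t" and C: "0 \<le> c" "0 \<le> C"
    and slice: "\<And>s. 0 \<le> s \<Longrightarrow> s \<le> t \<Longrightarrow> (\<integral>\<^sup>+ y. ennreal ((cmod (h (s, y)))\<^sup>2) \<partial>lborel) =
       (\<integral>\<^sup>+ \<xi>. ennreal (\<kappa> * ((cmod (fourier \<phi> \<xi>))\<^sup>2 * k s \<xi>)) \<partial>lborel)"
    and out: "\<And>s y. t < s \<Longrightarrow> h (s, y) = 0"
    and lower: "\<And>\<xi>. ennreal (c * J \<xi>) \<le> (\<integral>\<^sup>+ s. ennreal (k s \<xi>) * indicator {0..t} s \<partial>lborel)"
    and upper: "\<And>\<xi>. (\<integral>\<^sup>+ s. ennreal (k s \<xi>) * indicator {0..t} s \<partial>lborel) \<le> ennreal (C * J \<xi>)"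
  shows "\<kappa> * c * energy \<phi> \<le> (LINT \<omega>|P. (cmod (wiener_integral w h \<omega>))\<^sup>2)"
    and "(LINT \<omega>|P. (cmod (wiener_integral w h \<omega>))\<^sup>2) \<le> \<kappa> * C * energy \<phi>"
proof -
  interpret white_noise P w by fact
  note [measurable] = h borel_measurable_fourier[OF schwartz_integrable[OF \<phi>]]
  define N where "N = (\<integral>\<^sup>+ z. ennreal ((cmod (h z))\<^sup>2) \<partial>spacetime)"
  have "N = (\<integral>\<^sup>+ s. (\<integral>\<^sup>+ y. ennreal ((cmod (h (s, y)))\<^sup>2) \<partial>lborel) * indicator {0..} s \<partial>lborel)"
    unfolding N_def by (rule nn_integral_spacetime) simp
  also have "\<dots> = (\<integral>\<^sup>+ s. (\<integral>\<^sup>+ \<xi>. ennreal (\<kappa> * (cmod (fourier \<phi> \<xi>))\<^sup>2) * (ennreal (k s \<xi>) * indicator {0..t} s) \<partial>lborel) \<partial>lborel)"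
  proof (intro nn_integral_cong)
    fix s
    show "(\<integral>\<^sup>+ y. ennreal ((cmod (h (s, y)))\<^sup>2) \<partial>lborel) * indicator {0..} s =
      (\<integral>\<^sup>+ \<xi>. ennreal (\<kappa> * (cmod (fourier \<phi> \<xi>))\<^sup>2) * (ennreal (k s \<xi>) * indicator {0..t} s) \<partial>lborel)"
      using slice[of s] out[of s] \<kappa> k0 by (cases "s < 0"; cases "t < s") (auto simp: ennreal_mult[symmetric] mult.assoc)
  qed
  also have "\<dots> = (\<integral>\<^sup>+ \<xi>. (\<integral>\<^sup>+ s. ennreal (\<kappa> * (cmod (fourier \<phi> \<xi>))\<^sup>2) * (ennreal (k s \<xi>) * indicator {0..t} s) \<partial>lborel) \<partial>lborel)"
    by (rule lborel_pair.Fubini'[symmetric]) measurable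
  also have "\<dots> = (\<integral>\<^sup>+ \<xi>. ennreal (\<kappa> * (cmod (fourier \<phi> \<xi>))\<^sup>2) * (\<integral>\<^sup>+ s. ennreal (k s \<xi>) * indicator {0..t} s \<partial>lborel) \<partial>lborel)"
    by (intro nn_integral_cong nn_integral_cmult) measurable
  finally have N: "N = (\<integral>\<^sup>+ \<xi>. ennreal (\<kappa> * (cmod (fourier \<phi> \<xi>))\<^sup>2) * (\<integral>\<^sup>+ s. ennreal (k s \<xi>) * indicator {0..t} s \<partial>lborel) \<partial>lborel)" .
  have E: "(\<integral>\<^sup>+ \<xi>. ennreal (\<kappa> * (cmod (fourier \<phi> \<xi>))\<^sup>2) * ennreal (a * J \<xi>) \<partial>lborel) = ennreal (\<kappa> * a * energy \<phi>)" if "0 \<le> a" for a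
  proof -
    have "(\<integral>\<^sup>+ \<xi>. ennreal (\<kappa> * (cmod (fourier \<phi> \<xi>))\<^sup>2) * ennreal (a * J \<xi>) \<partial>lborel) =
      (\<integral>\<^sup>+ \<xi>. ennreal (\<kappa> * a) * ennreal ((cmod (fourier \<phi> \<xi>))\<^sup>2 * J \<xi>) \<partial>lborel)"
      using that \<kappa> by (intro nn_integral_cong) (auto simp: ennreal_mult[symmetric] mult_ac)
    also have "\<dots> = ennreal (\<kappa> * a) * ennreal (energy \<phi>)"
      by (subst nn_integral_cmult) (auto simp: nn_integral_energy[OF \<phi>])
    finally show ?thesis using that \<kappa> energy_nonneg by (simp add: ennreal_mult[symmetric])
  qed
  have up: "N \<le> ennreal (\<kappa> * C * energy \<phi>)"
    unfolding N E[OF C(2), symmetric] by (intro nn_integral_mono mult_left_mono upper) auto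
  have lo: "ennreal (\<kappa> * c * energy \<phi>) \<le> N"
    unfolding N E[OF C(1), symmetric] by (intro nn_integral_mono mult_left_mono lower) auto
  \<comment> \<open>Working with nonnegative integrals up to here lets the upper bound supply the
    square integrability that the isometry requires.\<close>
  have fin: "integrable spacetime (\<lambda>z. (cmod (h z))\<^sup>2)"
    using up unfolding N_def by (intro integrableI_bounded) (auto simp: le_less_trans)
  have "N = ennreal (LINT z|spacetime. (cmod (h z))\<^sup>2)"
    unfolding N_def using fin by (rule nn_integral_eq_integral) auto
  then have "N = ennreal (LINT \<omega>|P. (cmod (wiener_integral w h \<omega>))\<^sup>2)"
    using wiener_isometry[OF h fin] by simp
  moreover have "0 \<le> (LINT \<omega>|P. (cmod (wiener_integral w h \<omega>))\<^sup>2)"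
    by (rule Bochner_Integration.integral_nonneg) simp
  moreover have "0 \<le> \<kappa> * C * energy \<phi>"
    using \<kappa> C energy_nonneg by simp
  ultimately show "\<kappa> * c * energy \<phi> \<le> (LINT \<omega>|P. (cmod (wiener_integral w h \<omega>))\<^sup>2)"
    and "(LINT \<omega>|P. (cmod (wiener_integral w h \<omega>))\<^sup>2) \<le> \<kappa> * C * energy \<phi>"
    using up lo by (simp_all add: ennreal_le_iff)
qed

end

text \<open>Off a null set \<open>X\<^sub>t\<close> is the limit of \<open>X\<close> at grid points decreasing to \<open>t\<close>, by right continuity.\<close>

lemma levy_process_measurable_version:
  fixes X :: "real \<Rightarrow> 'w \<Rightarrow> 'a::euclidean_space"
  assumes "levy_process M X"
  obtains Y where "case_prod Y \<in> borel_measurable (borel \<Otimes>\<^sub>M M)" "AE \<omega> in M. \<forall>t\<ge>0. Y t \<omega> = X t \<omega>"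
proof -
  interpret levy_process M X by fact
  obtain N where N: "{\<omega>\<in>space M. \<not> (\<forall>t\<ge>0. ((\<lambda>s. X s \<omega>) \<longlongrightarrow> X t \<omega>) (at_right t) \<and>
      (0 < t \<longrightarrow> (\<exists>l. ((\<lambda>s. X s \<omega>) \<longlongrightarrow> l) (at_left t))))} \<subseteq> N" "N \<in> null_sets M"
    using cadlag unfolding eventually_ae_filter by auto
  have [measurable]: "N \<in> sets M" using N by auto
  \<comment> \<open>The value 0 on the null set and at negative times makes the grid approximations
    converge at every point, not just almost everywhere.\<close>
  define Y where "Y t \<omega> = (if \<omega> \<in> N \<or> t < 0 then 0 else X t \<omega>)" for t \<omega>
  \<comment> \<open>Adding 1 after rounding down puts the grid point strictly to the right of
    \<open>t\<close>, as the limit along \<open>at_right t\<close> demands.\<close>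
  define g where "g n z = nat \<lfloor>real (Suc n) * fst z\<rfloor> + 1" for n and z :: "real \<times> 'w"
  define A where "A n z = (if snd z \<in> N \<or> fst z < 0 then 0 else X (real (g n z) / real (Suc n)) (snd z))" for n z
  have "case_prod Y \<in> borel_measurable (borel \<Otimes>\<^sub>M M)"
  proof (rule borel_measurable_LIMSEQ_metric)
    show "A n \<in> borel_measurable (borel \<Otimes>\<^sub>M M)" for n
    proof -
      have 1: "(\<lambda>z. X (real k / real (Suc n)) (snd z)) \<in> borel_measurable (borel \<Otimes>\<^sub>M M)" for k :: nat
        using rv[of "real k / real (Suc n)"] by simp
      have 2: "g n \<in> measurable (borel \<Otimes>\<^sub>M M) (count_space UNIV)"
        unfolding g_def by measurable
      have [measurable]: "(\<lambda>z. X (real (g n z) / real (Suc n)) (snd z)) \<in> borel_measurable (borel \<Otimes>\<^sub>M M)"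
        using measurable_compose_countable[OF 1 2] by simp
      show ?thesis unfolding A_def by measurable
    qed
    fix z :: "real \<times> 'w" assume z: "z \<in> space (borel \<Otimes>\<^sub>M M)"
    obtain t \<omega> where tw: "z = (t, \<omega>)" by (cases z)
    then have \<omega>: "\<omega> \<in> space M" using z by (simp add: space_pair_measure)
    show "(\<lambda>n. A n z) \<longlonglongrightarrow> case_prod Y z"
    proof (cases "\<omega> \<in> N \<or> t < 0")
      case False
      then have t: "0 \<le> t" by simp
      have "\<forall>t\<ge>0. ((\<lambda>s. X s \<omega>) \<longlongrightarrow> X t \<omega>) (at_right t) \<and> (0 < t \<longrightarrow> (\<exists>l. ((\<lambda>s. X s \<omega>) \<longlongrightarrow> l) (at_left t)))"
        using N(1) \<omega> False by blast
      then have lim: "((\<lambda>s. X s \<omega>) \<longlongrightarrow> X t \<omega>) (at_right t)"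
        using t by blast
      define r where "r n = real (g n z) / real (Suc n)" for n
      have r: "t < r n" "r n \<le> t + 1 / real (Suc n)" for n
      proof -
        have *: "real (g n z) = of_int \<lfloor>real (Suc n) * t\<rfloor> + 1"
          using t unfolding g_def tw by simp
        have "real (Suc n) * t < real (g n z)" "real (g n z) \<le> real (Suc n) * t + 1"
          unfolding * by linarith+
        moreover define K where "K = real (Suc n)"
        moreover have K: "0 < K" by (simp add: K_def)
        ultimately have "K * t / K < real (g n z) / K" "real (g n z) / K \<le> (K * t + 1) / K"
          by (simp_all only: divide_strict_right_mono divide_right_mono less_imp_le)
        then show "t < r n" "r n \<le> t + 1 / real (Suc n)"
          unfolding r_def K_def[symmetric] using K by (simp_all add: add_divide_distrib)
      qed
      have "r \<longlonglongrightarrow> t"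
      proof (rule tendsto_sandwich[of "\<lambda>_. t" r _ "\<lambda>n. t + 1 / real (Suc n)"])
        have "(\<lambda>n. t + 1 / real (Suc n)) \<longlonglongrightarrow> t + 0"
          by (intro tendsto_intros LIMSEQ_Suc[OF lim_1_over_n])
        then show "(\<lambda>n. t + 1 / real (Suc n)) \<longlonglongrightarrow> t" by simp
      qed (use r in \<open>auto intro!: always_eventually less_imp_le\<close>)
      then have "filterlim r (at_right t) sequentially"
        using r by (auto simp: filterlim_at intro!: always_eventually less_imp_neq[symmetric])
      from filterlim_compose[OF lim this] show ?thesis
        using False by (simp add: A_def Y_def tw r_def)
    qed (auto simp: A_def Y_def tw)
  qed
  moreover have "AE \<omega> in M. \<forall>t\<ge>0. Y t \<omega> = X t \<omega>"
    using AE_not_in[OF N(2)] by eventually_elim (auto simp: Y_def)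
  ultimately show ?thesis by (rule that)
qed

lemma heat_solution_bounds:
  fixes X :: "real \<Rightarrow> 'w \<Rightarrow> 'a::euclidean_space"
  assumes levy: "levy_process M X" and \<Psi>: "characteristic_exponent M X \<Psi>" and wn: "white_noise P w"
    and t: "0 \<le> t" and \<phi>: "\<phi> \<in> schwartz"
  defines "\<kappa> \<equiv> 1 / (2 * pi) ^ DIM('a)"
  shows "\<kappa> * ((1 - exp (- 2 * t)) / 2) * subquadratic_exponent.energy (\<lambda>\<xi>. Re (\<Psi> \<xi>)) \<phi> \<le> (solution_dist P (heat_solution M X w) t \<phi>)\<^sup>2"
    and "(solution_dist P (heat_solution M X w) t \<phi>)\<^sup>2 \<le> \<kappa> * (exp (2 * t) / 2) * subquadratic_exponent.energy (\<lambda>\<xi>. Re (\<Psi> \<xi>)) \<phi>"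
proof -
  interpret levy_process M X by fact
  interpret subquadratic_exponent "\<lambda>\<xi>. Re (\<Psi> \<xi>)" by (rule subquadratic_exponent_levy[OF levy \<Psi>])
  obtain B where B: "\<And>x. cmod (\<phi> x) \<le> B" using schwartz_bounded[OF \<phi>] by blast
  note \<phi>' = schwartz_continuous[OF \<phi>] B schwartz_integrable[OF \<phi>]
  note [measurable] = borel_measurable_fourier[OF \<phi>'(3)]
  have [measurable]: "\<phi> \<in> borel_measurable borel" using \<phi>'(3) by (auto dest: borel_measurable_integrable)
  obtain Y where Y [measurable]: "case_prod Y \<in> borel_measurable (borel \<Otimes>\<^sub>M M)" and YX: "AE \<omega> in M. \<forall>t\<ge>0. Y t \<omega> = X t \<omega>"
    using levy_process_measurable_version[OF levy] by blast
  define h where "h = (\<lambda>(s, y). indicator {0..t} s * dual_semigroup M X (t - s) \<phi> y)"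
  \<comment> \<open>Passing to the jointly measurable version makes the integrand measurable in time
    and space together.\<close>
  have h_eq: "h z = indicator {0..t} (fst z) * (LINT \<omega>|M. \<phi> (snd z - case_prod Y (t - fst z, \<omega>)))" for z
  proof (cases "fst z \<in> {0..t}")
    case True
    then have r: "0 \<le> t - fst z" by simp
    note [measurable] = rv[OF r]
    have [measurable]: "Y (t - fst z) \<in> borel_measurable M"
      using measurable_compose_Pair1[OF _ Y, of "t - fst z"] by simp
    have "(LINT \<omega>|M. \<phi> (snd z - X (t - fst z) \<omega>)) = (LINT \<omega>|M. \<phi> (snd z - Y (t - fst z) \<omega>))"
      by (rule integral_cong_AE) (use YX r in \<open>auto elim!: eventually_mono\<close>)
    then show ?thesis by (simp add: h_def dual_semigroup_def case_prod_beta')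
  qed (simp add: h_def case_prod_beta')
  have h: "h \<in> borel_measurable spacetime"
    unfolding h_eq[abs_def] by measurable
  have slice: "(\<integral>\<^sup>+ y. ennreal ((cmod (h (s, y)))\<^sup>2) \<partial>lborel) =
       (\<integral>\<^sup>+ \<xi>. ennreal (\<kappa> * ((cmod (fourier \<phi> \<xi>))\<^sup>2 * exp (- 2 * (t - s) * Re (\<Psi> \<xi>)))) \<partial>lborel)" if s: "0 \<le> s" "s \<le> t" for s
  proof -
    have r: "0 \<le> t - s" using s by simp
    note [measurable] = rv[OF r]
    interpret \<mu>: finite_borel_measure "distr M borel (X (t - s))"
      by (rule finite_borel_measure_distr[OF prob_space_axioms rv[OF r]])
    have hs: "h (s, y) = \<mu>.conv \<phi> y" for y
      unfolding \<mu>.conv_def h_def dual_semigroup_def using s by (subst integral_distr) auto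
    have ft: "(cmod (\<mu>.ft \<xi>))\<^sup>2 = exp (- 2 * (t - s) * Re (\<Psi> \<xi>))" for \<xi>
      using levy_exponent_cmod[OF \<Psi> r] ft_distr[OF prob_space_axioms rv[OF r]]
      by (simp add: power2_eq_square exp_add[symmetric] algebra_simps)
    have "(\<integral>\<^sup>+ y. ennreal ((cmod (h (s, y)))\<^sup>2) \<partial>lborel) = ennreal (LINT y|lborel. (cmod (\<mu>.conv \<phi> y))\<^sup>2)"
      unfolding hs by (rule nn_integral_eq_integral[OF \<mu>.integrable_conv_sq[OF \<phi>']]) auto
    also have "(LINT y|lborel. (cmod (\<mu>.conv \<phi> y))\<^sup>2) = \<kappa> * (LINT \<xi>|lborel. (cmod (fourier \<phi> \<xi>))\<^sup>2 * exp (- 2 * (t - s) * Re (\<Psi> \<xi>)))"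
      using \<mu>.integral_conv_sq[OF \<phi>'] unfolding ft \<kappa>_def by (simp add: field_simps)
    also have "\<dots> = (LINT \<xi>|lborel. \<kappa> * ((cmod (fourier \<phi> \<xi>))\<^sup>2 * exp (- 2 * (t - s) * Re (\<Psi> \<xi>))))"
      by (rule integral_mult_right_zero[symmetric])
    also have "ennreal \<dots> = (\<integral>\<^sup>+ \<xi>. ennreal (\<kappa> * ((cmod (fourier \<phi> \<xi>))\<^sup>2 * exp (- 2 * (t - s) * Re (\<Psi> \<xi>)))) \<partial>lborel)"
      using \<mu>.integrable_fourier_conv_sq[OF \<phi>'] unfolding ft
      by (intro nn_integral_eq_integral[symmetric] integrable_mult_right) (auto simp: \<kappa>_def)
    finally show ?thesis .
  qed
  have sd: "(solution_dist P (heat_solution M X w) t \<phi>)\<^sup>2 = (LINT \<omega>|P. (cmod (wiener_integral w h \<omega>))\<^sup>2)"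
    unfolding solution_dist_def heat_solution_def h_def
    by (intro real_sqrt_pow2 Bochner_Integration.integral_nonneg) simp
  have k: "(\<lambda>(s, \<xi>). exp (- 2 * (t - s) * Re (\<Psi> \<xi>))) \<in> borel_measurable (lborel \<Otimes>\<^sub>M lborel)"
    by measurable
  have \<kappa>0: "0 \<le> \<kappa>" by (simp add: \<kappa>_def)
  have out: "h (s, y) = 0" if "t < s" for s y using that by (simp add: h_def)
  have lo: "ennreal ((1 - exp (- 2 * t)) / 2 * J \<xi>) \<le> (\<integral>\<^sup>+ s. ennreal (exp (- 2 * (t - s) * Re (\<Psi> \<xi>))) * indicator {0..t} s \<partial>lborel)"
    and up: "(\<integral>\<^sup>+ s. ennreal (exp (- 2 * (t - s) * Re (\<Psi> \<xi>))) * indicator {0..t} s \<partial>lborel) \<le> ennreal (exp (2 * t) / 2 * J \<xi>)" for \<xi>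
    unfolding J_def by (rule heat_multiplier_bounds[OF t nonneg])+
  have c0: "0 \<le> (1 - exp (- 2 * t)) / 2" "0 \<le> exp (2 * t) / 2" using t by auto
  show "\<kappa> * ((1 - exp (- 2 * t)) / 2) * energy \<phi> \<le> (solution_dist P (heat_solution M X w) t \<phi>)\<^sup>2"
    unfolding sd by (rule wiener_energy_bounds(1)[OF wn h \<phi> k _ \<kappa>0 t c0 slice out lo up]) (simp_all only: exp_ge_zero)
  show "(solution_dist P (heat_solution M X w) t \<phi>)\<^sup>2 \<le> \<kappa> * (exp (2 * t) / 2) * energy \<phi>"
    unfolding sd by (rule wiener_energy_bounds(2)[OF wn h \<phi> k _ \<kappa>0 t c0 slice out lo up]) (simp_all only: exp_ge_zero)
qed

text \<open>The multiplier bounds are hypotheses with free constants, so that time 0 can be treated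
  with both constants equal to 0.\<close>

lemma wave_solution_bounds:
  fixes \<Psi> :: "'a::euclidean_space \<Rightarrow> complex"
  assumes \<psi>: "subquadratic_exponent (\<lambda>\<xi>. Re (\<Psi> \<xi>))" and wn: "white_noise P w"
    and t: "0 \<le> t" and C: "0 \<le> c" "0 \<le> C" and \<phi>: "\<phi> \<in> schwartz"
    and lower: "\<And>v. 0 \<le> v \<Longrightarrow> ennreal (c * (1 / (1 + v))) \<le> (\<integral>\<^sup>+ s. ennreal ((wave_kernel v (t - s))\<^sup>2) * indicator {0..t} s \<partial>lborel)"
    and upper: "\<And>v. 0 \<le> v \<Longrightarrow> (\<integral>\<^sup>+ s. ennreal ((wave_kernel v (t - s))\<^sup>2) * indicator {0..t} s \<partial>lborel) \<le> ennreal (C * (1 / (1 + v)))"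
  defines "\<kappa> \<equiv> 1 / (2 * pi) ^ DIM('a)"
  shows "\<kappa> * c * subquadratic_exponent.energy (\<lambda>\<xi>. Re (\<Psi> \<xi>)) \<phi> \<le> (solution_dist P (wave_solution \<Psi> w) t \<phi>)\<^sup>2"
    and "(solution_dist P (wave_solution \<Psi> w) t \<phi>)\<^sup>2 \<le> \<kappa> * C * subquadratic_exponent.energy (\<lambda>\<xi>. Re (\<Psi> \<xi>)) \<phi>"
proof -
  interpret subquadratic_exponent "\<lambda>\<xi>. Re (\<Psi> \<xi>)" by fact
  note int = schwartz_integrable[OF \<phi>]
  note [measurable] = borel_measurable_fourier[OF int]
  define L where "L = (LINT x|lborel. cmod (\<phi> x))"
  have L: "cmod (fourier \<phi> \<xi>) \<le> L" for \<xi> unfolding L_def by (rule norm_fourier_le[OF int])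
  define q where "q s \<xi> = complex_of_real (wave_kernel (Re (\<Psi> \<xi>)) (t - s)) * cnj (fourier \<phi> \<xi>)" for s \<xi>
  have [measurable]: "(\<lambda>z. q (fst (fst z)) (snd z)) \<in> borel_measurable (spacetime \<Otimes>\<^sub>M lborel)"
    unfolding q_def by measurable
  define h where "h = (\<lambda>(s, x). fourier (\<lambda>\<xi>. indicator {0..t} s * complex_of_real (wave_kernel (Re (\<Psi> \<xi>)) (t - s)) * cnj (fourier \<phi> \<xi>)) x)"
  have h_eq: "h z = indicator {0..t} (fst z) * fourier (q (fst z)) (snd z)" for z
    unfolding h_def q_def case_prod_beta' by (cases "fst z \<in> {0..t}") (auto simp: fourier_def)
  have h: "h \<in> borel_measurable spacetime"
    unfolding h_eq[abs_def] fourier_def by measurable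
  have fint: "integrable lborel (\<lambda>\<xi>. cnj (fourier \<phi> \<xi>))"
    using fourier_schwartz_integrable[OF \<phi>] by simp
  have slice: "(\<integral>\<^sup>+ y. ennreal ((cmod (h (s, y)))\<^sup>2) \<partial>lborel) =
       (\<integral>\<^sup>+ \<xi>. ennreal ((2 * pi) ^ DIM('a) * ((cmod (fourier \<phi> \<xi>))\<^sup>2 * (wave_kernel (Re (\<Psi> \<xi>)) (t - s))\<^sup>2)) \<partial>lborel)" if s: "0 \<le> s" "s \<le> t" for s
  proof -
    have hs: "h (s, y) = fourier (q s) y" for y
      using s by (simp add: h_eq)
    have "continuous_on UNIV (\<lambda>\<xi>. complex_of_real ((t - s) * sinc (sqrt (Re (\<Psi> \<xi>)) * (t - s))) * cnj (fourier \<phi> \<xi>))"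
      by (intro continuous_intros continuous continuous_fourier int)
    also have "(\<lambda>\<xi>. complex_of_real ((t - s) * sinc (sqrt (Re (\<Psi> \<xi>)) * (t - s))) * cnj (fourier \<phi> \<xi>)) = q s"
      unfolding q_def by (subst wave_kernel_eq_sinc[OF nonneg]) (rule refl)
    finally have q1: "continuous_on UNIV (q s)" .
    have q2: "cmod (q s \<xi>) \<le> (1 + (t - s)\<^sup>2) * L" for \<xi>
      unfolding q_def norm_mult complex_mod_cnj norm_of_real
      by (intro mult_mono abs_wave_kernel_le L nonneg) auto
    have q3: "integrable lborel (q s)"
      unfolding q_def by (rule integrable_bounded_mult[OF fint, where B="1 + (t - s)\<^sup>2"]) (use abs_wave_kernel_le nonneg in auto)
    have [measurable]: "q s \<in> borel_measurable borel" using q3 by (auto dest: borel_measurable_integrable)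
    have sq: "integrable lborel (\<lambda>\<xi>. (cmod (q s \<xi>))\<^sup>2)"
    proof (rule Bochner_Integration.integrable_bound)
      show "integrable lborel (\<lambda>\<xi>. ((1 + (t - s)\<^sup>2) * L) * cmod (q s \<xi>))" using q3 by simp
      show "AE \<xi> in lborel. norm ((cmod (q s \<xi>))\<^sup>2) \<le> norm (((1 + (t - s)\<^sup>2) * L) * cmod (q s \<xi>))"
        using order_trans[OF q2 abs_ge_self] by (auto simp: power2_eq_square abs_mult intro!: mult_right_mono)
    qed simp
    have "(\<integral>\<^sup>+ y. ennreal ((cmod (h (s, y)))\<^sup>2) \<partial>lborel) = ennreal (LINT y|lborel. (cmod (fourier (q s) y))\<^sup>2)"
      unfolding hs by (rule nn_integral_eq_integral[OF integrable_plancherel[OF q1 q2 q3]]) auto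
    also have "(LINT y|lborel. (cmod (fourier (q s) y))\<^sup>2) = (LINT \<xi>|lborel. (2 * pi) ^ DIM('a) * (cmod (q s \<xi>))\<^sup>2)"
      unfolding integral_plancherel[OF q1 q2 q3] by (rule integral_mult_right_zero[symmetric])
    also have "ennreal \<dots> = (\<integral>\<^sup>+ \<xi>. ennreal ((2 * pi) ^ DIM('a) * (cmod (q s \<xi>))\<^sup>2) \<partial>lborel)"
      by (intro nn_integral_eq_integral[symmetric] integrable_mult_right sq) auto
    finally show ?thesis
      by (simp add: q_def norm_mult power_mult_distrib mult.commute)
  qed
  define c0 where "c0 = (2 * pi) powr (- real DIM('a) / 2)"
  have c0: "c0\<^sup>2 = \<kappa>"
  proof -
    have "c0\<^sup>2 = (2 * pi) powr (- real DIM('a) / 2 + - real DIM('a) / 2)"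
      unfolding c0_def powr_add power2_eq_square ..
    also have "\<dots> = inverse ((2 * pi) powr real DIM('a))"
      unfolding field_sum_of_halves powr_minus ..
    also have "(2 * pi) powr real DIM('a) = (2 * pi) ^ DIM('a)"
      by (rule powr_realpow) simp
    finally show ?thesis unfolding \<kappa>_def inverse_eq_divide .
  qed
  \<comment> \<open>The normalization \<open>c0\<close> occurs twice, in
    \<open>wave_solution\<close> and in \<open>wiener_integral_hat\<close>, so the squared modulus
    carries its fourth power \<open>\<kappa>\<^sup>2\<close>. One factor \<open>\<kappa>\<close>
    cancels later against Plancherel's constant.\<close>
  have sd: "(solution_dist P (wave_solution \<Psi> w) t \<phi>)\<^sup>2 = \<kappa>\<^sup>2 * (LINT \<omega>|P. (cmod (wiener_integral w h \<omega>))\<^sup>2)"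
  proof -
    have "(solution_dist P (wave_solution \<Psi> w) t \<phi>)\<^sup>2 = (LINT \<omega>|P. (cmod (wave_solution \<Psi> w t \<phi> \<omega>))\<^sup>2)"
      unfolding solution_dist_def by (intro real_sqrt_pow2 Bochner_Integration.integral_nonneg) simp
    also have "\<dots> = (LINT \<omega>|P. \<kappa>\<^sup>2 * (cmod (wiener_integral w h \<omega>))\<^sup>2)"
      unfolding wave_solution_def wiener_integral_hat_def c0_def[symmetric] h_def c0[symmetric]
      by (intro Bochner_Integration.integral_cong refl) (simp add: norm_mult power_mult_distrib power2_eq_square mult.assoc case_prod_beta')
    finally show ?thesis by simp
  qed
  have k: "(\<lambda>(s, \<xi>). (wave_kernel (Re (\<Psi> \<xi>)) (t - s))\<^sup>2) \<in> borel_measurable (lborel \<Otimes>\<^sub>M lborel)"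
    by measurable
  have out: "h (s, y) = 0" if "t < s" for s y using that by (simp add: h_eq)
  have p0: "0 \<le> (2 * pi) ^ DIM('a)" by simp
  have kk: "\<kappa>\<^sup>2 * ((2 * pi) ^ DIM('a) * a) = \<kappa> * a" for a
    by (simp add: \<kappa>_def power2_eq_square)
  have lo: "ennreal (c * J \<xi>) \<le> (\<integral>\<^sup>+ s. ennreal ((wave_kernel (Re (\<Psi> \<xi>)) (t - s))\<^sup>2) * indicator {0..t} s \<partial>lborel)"
    and up: "(\<integral>\<^sup>+ s. ennreal ((wave_kernel (Re (\<Psi> \<xi>)) (t - s))\<^sup>2) * indicator {0..t} s \<partial>lborel) \<le> ennreal (C * J \<xi>)" for \<xi>
    unfolding J_def by (rule lower[OF nonneg] upper[OF nonneg])+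
  have *: "(2 * pi) ^ DIM('a) * c * energy \<phi> \<le> (LINT \<omega>|P. (cmod (wiener_integral w h \<omega>))\<^sup>2)"
    by (rule wiener_energy_bounds(1)[OF wn h \<phi> k _ p0 t C slice out lo up]) (simp_all only: zero_le_power2)
  have **: "(LINT \<omega>|P. (cmod (wiener_integral w h \<omega>))\<^sup>2) \<le> (2 * pi) ^ DIM('a) * C * energy \<phi>"
    by (rule wiener_energy_bounds(2)[OF wn h \<phi> k _ p0 t C slice out lo up]) (simp_all only: zero_le_power2)
  have "\<kappa>\<^sup>2 * ((2 * pi) ^ DIM('a) * c * energy \<phi>) \<le> (solution_dist P (wave_solution \<Psi> w) t \<phi>)\<^sup>2"
    unfolding sd by (intro mult_left_mono *) auto
  then show "\<kappa> * c * energy \<phi> \<le> (solution_dist P (wave_solution \<Psi> w) t \<phi>)\<^sup>2"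
    unfolding mult.assoc kk .
  have "(solution_dist P (wave_solution \<Psi> w) t \<phi>)\<^sup>2 \<le> \<kappa>\<^sup>2 * ((2 * pi) ^ DIM('a) * C * energy \<phi>)"
    unfolding sd by (intro mult_left_mono **) auto
  then show "(solution_dist P (wave_solution \<Psi> w) t \<phi>)\<^sup>2 \<le> \<kappa> * C * energy \<phi>"
    unfolding mult.assoc kk .
qed

section \<open>Both equations reduced to Dalang's condition\<close>

theorem heat_random_field_iff:
  fixes X :: "real \<Rightarrow> 'w \<Rightarrow> 'a::euclidean_space"
  assumes levy: "levy_process M X" and \<Psi>: "characteristic_exponent M X \<Psi>" and wn: "white_noise P w"
  shows "has_random_field_solutions P (heat_solution M X w) \<longleftrightarrow> integrable lborel (\<lambda>\<xi>. 1 / (1 + Re (\<Psi> \<xi>)))"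
proof -
  interpret subquadratic_exponent "\<lambda>\<xi>. Re (\<Psi> \<xi>)" by (rule subquadratic_exponent_levy[OF levy \<Psi>])
  note b = heat_solution_bounds[OF levy \<Psi> wn]
  have "has_random_field_solutions P (heat_solution M X w) \<longleftrightarrow> integrable lborel J"
  proof (rule random_field_solutions_iff)
    fix t :: real assume t: "0 \<le> t"
    show "\<exists>C\<ge>0. \<forall>\<phi>\<in>schwartz. (solution_dist P (heat_solution M X w) t \<phi>)\<^sup>2 \<le> C * energy \<phi>"
      by (rule exI[of _ "1 / (2 * pi) ^ DIM('a) * (exp (2 * t) / 2)"]) (intro conjI ballI b(2)[OF t]; simp)
  next
    fix t :: real assume t: "0 < t"
    then have "0 < 1 / (2 * pi) ^ DIM('a) * ((1 - exp (- 2 * t)) / 2)" by simp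
    with b(1)[OF less_imp_le[OF t]]
    show "\<exists>c>0. \<forall>\<phi>\<in>schwartz. c * energy \<phi> \<le> (solution_dist P (heat_solution M X w) t \<phi>)\<^sup>2"
      by blast
  qed
  then show ?thesis unfolding J_def[abs_def] .
qed

theorem wave_random_field_iff:
  fixes \<Psi> :: "'a::euclidean_space \<Rightarrow> complex"
  assumes \<psi>: "subquadratic_exponent (\<lambda>\<xi>. Re (\<Psi> \<xi>))" and wn: "white_noise P w"
  shows "has_random_field_solutions P (wave_solution \<Psi> w) \<longleftrightarrow> integrable lborel (\<lambda>\<xi>. 1 / (1 + Re (\<Psi> \<xi>)))"
proof -
  interpret subquadratic_exponent "\<lambda>\<xi>. Re (\<Psi> \<xi>)" by fact
  define \<kappa> where "\<kappa> = 1 / (2 * pi) ^ DIM('a)"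
  have \<kappa>: "0 < \<kappa>" by (simp add: \<kappa>_def)
  note b = wave_solution_bounds[OF \<psi> wn, folded \<kappa>_def]
  have pos: "\<kappa> * min (t ^ 3 / 12) (t / 4) * energy \<phi> \<le> (solution_dist P (wave_solution \<Psi> w) t \<phi>)\<^sup>2"
    "(solution_dist P (wave_solution \<Psi> w) t \<phi>)\<^sup>2 \<le> \<kappa> * (t * (1 + t\<^sup>2)) * energy \<phi>"
    if t: "0 < t" and \<phi>: "\<phi> \<in> schwartz" for t \<phi>
    by (rule b[OF _ _ _ \<phi> wave_multiplier_bounds[OF t]]; use t in simp)+
  have "has_random_field_solutions P (wave_solution \<Psi> w) \<longleftrightarrow> integrable lborel J"
  proof (rule random_field_solutions_iff)
    fix t :: real assume t: "0 \<le> t"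
    show "\<exists>C\<ge>0. \<forall>\<phi>\<in>schwartz. (solution_dist P (wave_solution \<Psi> w) t \<phi>)\<^sup>2 \<le> C * energy \<phi>"
    proof (cases "t = 0")
      case True
      \<comment> \<open>\<open>wave_multiplier_bounds\<close> covers positive times. At
        \<open>t = 0\<close> the time integral runs over a single point and vanishes, so the
        constant 0 serves.\<close>
      have z: "(\<integral>\<^sup>+ s. ennreal ((wave_kernel v (0 - s))\<^sup>2) * indicator {0..0} s \<partial>lborel) = 0" for v
      proof -
        have "(\<integral>\<^sup>+ s. ennreal ((wave_kernel v (0 - s))\<^sup>2) * indicator {0..0} s \<partial>lborel) = (\<integral>\<^sup>+ s. 0 \<partial>(lborel :: real measure))"
          using AE_lborel_singleton[of "0::real"]
          by (intro nn_integral_cong_AE, rule eventually_mono) (auto split: split_indicator)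
        then show ?thesis by simp
      qed
      have "(solution_dist P (wave_solution \<Psi> w) 0 \<phi>)\<^sup>2 \<le> \<kappa> * 0 * energy \<phi>" if "\<phi> \<in> schwartz" for \<phi>
        by (rule b(2)[where c=0]) (use that z in auto)
      then show ?thesis using True by (intro exI[of _ 0]) auto
    next
      case False
      then have "0 < t" "0 \<le> \<kappa> * (t * (1 + t\<^sup>2))" using t \<kappa> by auto
      then show ?thesis using pos(2) by blast
    qed
  next
    fix t :: real assume "0 < t"
    then have "0 < t" "0 < \<kappa> * min (t ^ 3 / 12) (t / 4)" using \<kappa> by auto
    then show "\<exists>c>0. \<forall>\<phi>\<in>schwartz. c * energy \<phi> \<le> (solution_dist P (wave_solution \<Psi> w) t \<phi>)\<^sup>2"
      using pos(1) by blast
  qed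
  then show ?thesis unfolding J_def[abs_def] .
qed

section \<open>Local times: sufficiency\<close>

lemma (in prob_space) paley_zygmund:
  fixes f :: "'a \<Rightarrow> real"
  assumes f [measurable]: "f \<in> borel_measurable M" and f0: "\<And>x. 0 \<le> f x" and m: "0 < m"
    and f1: "(\<integral>\<^sup>+ x. ennreal (f x) \<partial>M) = ennreal m"
    and f2: "(\<integral>\<^sup>+ x. ennreal ((f x)\<^sup>2) \<partial>M) \<le> ennreal (2 * m\<^sup>2)"
  shows "1 / 8 \<le> prob {x\<in>space M. m / 2 < f x}"
proof -
  define S where "S = {x\<in>space M. m / 2 < f x}"
  have [measurable]: "S \<in> sets M" unfolding S_def by measurable
  have i1: "integrable M f"
    using f1 f0 by (intro integrableI_bounded) auto
  have i2: "integrable M (\<lambda>x. (f x)\<^sup>2)"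
    using f2 by (intro integrableI_bounded) (auto simp: le_less_trans)
  have e1: "expectation f = m"
    using nn_integral_eq_integral[OF i1] f0 f1 m by (simp add: integral_nonneg_AE)
  have e2: "expectation (\<lambda>x. (f x)\<^sup>2) \<le> 2 * m\<^sup>2"
    using nn_integral_eq_integral[OF i2] f2 by simp
  \<comment> \<open>A pointwise bound takes the place of Cauchy-Schwarz. Off \<open>S\<close> the
    first term suffices; on \<open>S\<close> the other two do, because
    \<open>(f x - 4 * m)\<^sup>2 \<ge> 0\<close>. The weights make the first two means add up to at
    most \<open>3 m / 4\<close>, which leaves \<open>m / 4 \<le> 2 m prob S\<close>.\<close>
  have "m \<le> expectation (\<lambda>x. m / 2 + (f x)\<^sup>2 / (8 * m) + 2 * m * indicator S x)"
    unfolding e1[symmetric]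
  proof (rule integral_mono)
    show "integrable M (\<lambda>x. expectation f / 2 + (f x)\<^sup>2 / (8 * expectation f) + 2 * expectation f * indicator S x)"
      using i2 by (intro Bochner_Integration.integrable_add integrable_divide integrable_mult_right)
        (auto intro!: integrable_const_bound[of _ 1] simp: indicator_def)
    fix x assume x: "x \<in> space M"
    have "0 \<le> (f x)\<^sup>2 / (8 * m)" using m by simp
    moreover have "f x \<le> (f x)\<^sup>2 / (8 * m) + 2 * m"
    proof -
      have "0 \<le> (f x - 4 * m)\<^sup>2" by simp
      then have "f x * (8 * m) \<le> (f x)\<^sup>2 + 16 * m\<^sup>2" by (simp add: power2_eq_square algebra_simps)
      then have "f x \<le> ((f x)\<^sup>2 + 16 * m\<^sup>2) / (8 * m)" using m by (simp add: pos_le_divide_eq)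
      also have "\<dots> = (f x)\<^sup>2 / (8 * m) + 2 * m" using m by (simp add: add_divide_distrib power2_eq_square)
      finally show ?thesis .
    qed
    ultimately show "f x \<le> expectation f / 2 + (f x)\<^sup>2 / (8 * expectation f) + 2 * expectation f * indicator S x"
    proof (cases "x \<in> S")
      case False
      then have "f x \<le> m / 2" using x by (simp add: S_def)
      from add_mono[OF this \<open>0 \<le> (f x)\<^sup>2 / (8 * m)\<close>] show ?thesis
        unfolding e1 using False by simp
    qed (use m in \<open>simp add: e1\<close>)
  qed (fact i1)
  also have "\<dots> = m / 2 + expectation (\<lambda>x. (f x)\<^sup>2) / (8 * m) + 2 * m * prob S"
  proof -
    have "integrable M (\<lambda>x. indicator S x :: real)"
      by (intro integrable_const_bound[of _ 1]) (auto simp: indicator_def)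
    then show ?thesis using i2 by (simp add: prob_space)
  qed
  also have "\<dots> \<le> m / 2 + 2 * m\<^sup>2 / (8 * m) + 2 * m * prob S"
    using e2 m by (intro add_mono divide_right_mono order_refl) auto
  also have "2 * m\<^sup>2 / (8 * m) = m / 4" using m by (simp add: power2_eq_square)
  finally have "m * (1 / 4) \<le> m * (2 * prob S)" by simp
  then show ?thesis using m unfolding S_def by (simp add: mult_le_cancel_left_pos)
qed

context finite_borel_measure
begin

text \<open>The open-set half of the portmanteau theorem for Gaussian mollifications. A point of
  \<open>U\<close> moved by a small multiple of \<open>z\<close> stays in \<open>U\<close>
  eventually, and Fatou's lemma is applied first in \<open>z\<close>, then under
  \<open>\<mu>\<close>.\<close>

lemma emeasure_open_le_liminf_conv:
  assumes U: "open U" and \<sigma>: "\<And>n. 0 < \<sigma> n" "\<sigma> \<longlonglongrightarrow> 0"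
  shows "emeasure \<mu> U \<le> liminf (\<lambda>n. \<integral>\<^sup>+ x. (\<integral>\<^sup>+ y. ennreal (gauss_density (\<sigma> n) (x - y)) \<partial>\<mu>) * indicator U x \<partial>lborel)"
proof -
  interpret pair_sigma_finite lborel \<mu>
    by (intro pair_sigma_finite.intro sigma_finite_lborel sigma_finite_measure)
  have [measurable]: "U \<in> sets borel" using U by simp
  have eq: "(\<integral>\<^sup>+ x. (\<integral>\<^sup>+ y. ennreal (gauss_density (\<sigma> n) (x - y)) \<partial>\<mu>) * indicator U x \<partial>lborel) =
      (\<integral>\<^sup>+ y. (\<integral>\<^sup>+ z. ennreal (gauss_density 1 z) * indicator U (y + \<sigma> n *\<^sub>R z) \<partial>lborel) \<partial>\<mu>)" for n
  proof -
    have "(\<integral>\<^sup>+ x. (\<integral>\<^sup>+ y. ennreal (gauss_density (\<sigma> n) (x - y)) \<partial>\<mu>) * indicator U x \<partial>lborel) =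
      (\<integral>\<^sup>+ x. (\<integral>\<^sup>+ y. ennreal (gauss_density (\<sigma> n) (x - y)) * indicator U x \<partial>\<mu>) \<partial>lborel)"
      by (intro nn_integral_cong nn_integral_multc[symmetric]) simp
    also have "\<dots> = (\<integral>\<^sup>+ y. (\<integral>\<^sup>+ x. ennreal (gauss_density (\<sigma> n) (x - y)) * indicator U x \<partial>lborel) \<partial>\<mu>)"
      by (rule Fubini'[symmetric]) simp
    finally show ?thesis
      by (simp add: nn_integral_gauss_density_scale \<sigma>)
  qed
  have "emeasure \<mu> U = (\<integral>\<^sup>+ y. indicator U y * (\<integral>\<^sup>+ z. ennreal (gauss_density 1 (z::'a)) \<partial>lborel) \<partial>\<mu>)"
    by (simp add: nn_integral_gauss_density)
  also have "\<dots> = (\<integral>\<^sup>+ y. (\<integral>\<^sup>+ z. ennreal (gauss_density 1 (z::'a)) * indicator U y \<partial>lborel) \<partial>\<mu>)"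
    by (intro nn_integral_cong, subst nn_integral_multc) (auto simp: mult.commute)
  also have "\<dots> \<le> (\<integral>\<^sup>+ y. (\<integral>\<^sup>+ z. liminf (\<lambda>n. ennreal (gauss_density 1 z) * indicator U (y + \<sigma> n *\<^sub>R z)) \<partial>lborel) \<partial>\<mu>)"
  proof (intro nn_integral_mono)
    fix y z :: 'a
    show "ennreal (gauss_density 1 z) * indicator U y \<le> liminf (\<lambda>n. ennreal (gauss_density 1 z) * indicator U (y + \<sigma> n *\<^sub>R z))"
    proof (cases "y \<in> U")
      case True
      have "(\<lambda>n. y + \<sigma> n *\<^sub>R z) \<longlonglongrightarrow> y + 0 *\<^sub>R z" by (intro tendsto_intros \<sigma>)
      then have "eventually (\<lambda>n. y + \<sigma> n *\<^sub>R z \<in> U) sequentially"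
        using U True by (intro topological_tendstoD) auto
      then show ?thesis
        using True by (intro Liminf_bounded) (auto elim!: eventually_mono)
    qed simp
  qed
  also have "\<dots> \<le> (\<integral>\<^sup>+ y. liminf (\<lambda>n. \<integral>\<^sup>+ z. ennreal (gauss_density 1 z) * indicator U (y + \<sigma> n *\<^sub>R z) \<partial>lborel) \<partial>\<mu>)"
    by (intro nn_integral_mono nn_integral_liminf) measurable
  also have "\<dots> \<le> liminf (\<lambda>n. \<integral>\<^sup>+ y. (\<integral>\<^sup>+ z. ennreal (gauss_density 1 z) * indicator U (y + \<sigma> n *\<^sub>R z) \<partial>lborel) \<partial>\<mu>)"
    by (intro nn_integral_liminf) measurable
  finally show ?thesis unfolding eq .
qed

text \<open>A finite measure with square integrable Fourier transform has a square integrable density. It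
  suffices that the Gaussian mollifications of the measure are bounded in \<open>L\<^sup>2\<close>.\<close>

lemma absolutely_continuous_if_ft_sq_integrable:
  assumes fin: "(\<integral>\<^sup>+ \<xi>. ennreal ((cmod (ft \<xi>))\<^sup>2) \<partial>lborel) < \<infinity>"
  shows "absolutely_continuous lborel \<mu>"
proof -
  have [measurable]: "ft \<in> borel_measurable borel"
    by (rule borel_measurable_continuous_onI[OF continuous_ft])
  have ft_int: "integrable lborel (\<lambda>\<xi>. (cmod (ft \<xi>))\<^sup>2)"
    using fin by (intro integrableI_bounded) auto
  define D where "D = (LINT \<xi>|lborel. (cmod (ft \<xi>))\<^sup>2)"
  have D: "0 \<le> D" unfolding D_def by (rule integral_nonneg_AE) simp
  define \<sigma> where "\<sigma> n = 1 / real (Suc n)" for n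
  have \<sigma>: "0 < \<sigma> n" for n by (simp add: \<sigma>_def)
  have \<sigma>0: "\<sigma> \<longlonglongrightarrow> 0" unfolding \<sigma>_def by (rule LIMSEQ_Suc[OF lim_1_over_n])
  define f where "f n x = (LINT y|\<mu>. gauss_density (\<sigma> n) (x - y))" for n x
  have sq: "(\<integral>\<^sup>+ x. ennreal ((f n x)\<^sup>2) \<partial>lborel) \<le> ennreal D" for n
  proof -
    let ?g = "\<lambda>x::'a. complex_of_real (gauss_density (\<sigma> n) (x - 0))"
    have gs: "?g \<in> schwartz" by (rule gauss_density_schwartz[OF \<sigma>])
    obtain B where B: "\<And>x. cmod (?g x) \<le> B" using schwartz_bounded[OF gs] by blast
    note g = schwartz_continuous[OF gs] B schwartz_integrable[OF gs]
    have c: "cmod (conv ?g x) = \<bar>f n x\<bar>" for x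
    proof -
      have "conv ?g x = complex_of_real (f n x)"
        unfolding conv_def f_def by simp
      then show ?thesis by (simp only: norm_of_real)
    qed
    have "(2 * pi) ^ DIM('a) * (LINT x|lborel. (cmod (conv ?g x))\<^sup>2) \<le> D"
      unfolding integral_conv_sq[OF g] D_def
    proof (rule integral_mono[OF integrable_fourier_conv_sq[OF g] ft_int])
      fix \<xi>
      have "cmod (fourier ?g \<xi>) \<le> 1"
        unfolding fourier_gauss_density_shift[OF \<sigma>] by (simp add: norm_mult)
      then show "(cmod (fourier ?g \<xi>))\<^sup>2 * (cmod (ft \<xi>))\<^sup>2 \<le> (cmod (ft \<xi>))\<^sup>2"
        by (intro mult_left_le_one_le) (auto simp: power_le_one)
    qed
    moreover have "(LINT x|lborel. (cmod (conv ?g x))\<^sup>2) \<le> (2 * pi) ^ DIM('a) * (LINT x|lborel. (cmod (conv ?g x))\<^sup>2)"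
    proof -
      have "1 \<le> (2 * pi) ^ DIM('a)" using pi_ge_two by (intro one_le_power) auto
      then have "1 * (LINT x|lborel. (cmod (conv ?g x))\<^sup>2) \<le> (2 * pi) ^ DIM('a) * (LINT x|lborel. (cmod (conv ?g x))\<^sup>2)"
        by (intro mult_right_mono integral_nonneg_AE) auto
      then show ?thesis by simp
    qed
    ultimately have "(LINT x|lborel. (cmod (conv ?g x))\<^sup>2) \<le> D" by linarith
    moreover have "(\<integral>\<^sup>+ x. ennreal ((f n x)\<^sup>2) \<partial>lborel) = ennreal (LINT x|lborel. (cmod (conv ?g x))\<^sup>2)"
      using integrable_conv_sq[OF g] unfolding c power2_abs by (intro nn_integral_eq_integral) auto
    ultimately show ?thesis by (simp add: ennreal_leI)
  qed
  have f_nn: "(\<integral>\<^sup>+ y. ennreal (gauss_density (\<sigma> n) (x - y)) \<partial>\<mu>) = ennreal (f n x)" for n x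
    unfolding f_def
  proof (rule nn_integral_eq_integral)
    obtain B where B: "\<And>x::'a. cmod (complex_of_real (gauss_density (\<sigma> n) (x - 0))) \<le> B"
      using schwartz_bounded[OF gauss_density_schwartz[OF \<sigma>]] by blast
    then show "integrable \<mu> (\<lambda>y. gauss_density (\<sigma> n) (x - y))"
      by (intro integrable_const_bound[of _ B]) auto
  qed simp
  have [measurable]: "f n \<in> borel_measurable borel" for n
    unfolding f_def by measurable
  have U: "emeasure \<mu> U \<le> ennreal (e * (D + 1))" if "open U" "emeasure lborel U \<le> ennreal (e\<^sup>2)" "0 < e" for U e
  proof -
    have [measurable]: "U \<in> sets borel" using that by simp
    have "(\<integral>\<^sup>+ x. ennreal (f n x) * indicator U x \<partial>lborel) \<le> ennreal (e * (D + 1))" for n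
    proof -
      \<comment> \<open>On \<open>U\<close> the density is split as
        \<open>f \<le> e f\<^sup>2 + 1 / e\<close>, a form of Young's inequality. The
        \<open>L\<^sup>2\<close> bound handles the first term, and \<open>e\<^sup>2\<close> as bound
        on the measure of \<open>U\<close> makes the second at most \<open>e\<close>.\<close>
      have "(\<integral>\<^sup>+ x. ennreal (f n x) * indicator U x \<partial>lborel) \<le>
        (\<integral>\<^sup>+ x. ennreal e * ennreal ((f n x)\<^sup>2) + ennreal (1 / e) * indicator U x \<partial>lborel)"
      proof (intro nn_integral_mono)
        fix x
        show "ennreal (f n x) * indicator U x \<le> ennreal e * ennreal ((f n x)\<^sup>2) + ennreal (1 / e) * indicator U x"
        proof (cases "x \<in> U")
          case True
          have "f n x \<le> e * (f n x)\<^sup>2 + 1 / e"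
          proof -
            have "0 \<le> (e * f n x - 1)\<^sup>2 + e * f n x"
              unfolding f_def using \<open>0 < e\<close> by (intro add_nonneg_nonneg mult_nonneg_nonneg integral_nonneg_AE) auto
            then have "e * f n x \<le> e * (e * (f n x)\<^sup>2 + 1 / e)"
              using \<open>0 < e\<close> by (simp add: power2_eq_square algebra_simps)
            then show ?thesis using \<open>0 < e\<close> by simp
          qed
          then have "ennreal (f n x) \<le> ennreal (e * (f n x)\<^sup>2 + 1 / e)" by (rule ennreal_leI)
          also have "\<dots> = ennreal e * ennreal ((f n x)\<^sup>2) + ennreal (1 / e)"
            using \<open>0 < e\<close> by (subst ennreal_plus) (auto simp: ennreal_mult)
          finally show ?thesis using True by simp
        qed simp
      qed
      also have "\<dots> = ennreal e * (\<integral>\<^sup>+ x. ennreal ((f n x)\<^sup>2) \<partial>lborel) + ennreal (1 / e) * emeasure lborel U"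
        by (subst nn_integral_add) (auto simp: nn_integral_cmult nn_integral_cmult_indicator)
      also have "\<dots> \<le> ennreal e * ennreal D + ennreal (1 / e) * ennreal (e\<^sup>2)"
        by (intro add_mono mult_left_mono sq that) auto
      also have "\<dots> = ennreal (e * (D + 1))"
        using \<open>0 < e\<close> D by (simp add: ennreal_mult[symmetric] ennreal_plus[symmetric] power2_eq_square distrib_left del: ennreal_plus)
      finally show ?thesis .
    qed
    then have "liminf (\<lambda>n. \<integral>\<^sup>+ x. ennreal (f n x) * indicator U x \<partial>lborel) \<le> ennreal (e * (D + 1))"
      by (intro Liminf_le) auto
    with emeasure_open_le_liminf_conv[OF that(1) \<sigma> \<sigma>0] show ?thesis
      unfolding f_nn by (rule order_trans)
  qed
  show ?thesis
    unfolding absolutely_continuous_def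
  proof
    fix A :: "'a set" assume A: "A \<in> null_sets lborel"
    then have A': "A \<in> sets borel" "emeasure lborel A = 0" by auto
    have small: "emeasure \<mu> A \<le> ennreal e" if e: "0 < e" for e
    proof -
      \<comment> \<open>Outer regularity encloses the null set in an open set of measure below
        \<open>d\<^sup>2\<close>, and with this \<open>d\<close> the bound \<open>U\<close> is
        exactly \<open>e\<close>.\<close>
      define d where "d = e / (D + 1)"
      have d: "0 < d" using e D by (simp add: d_def)
      obtain V where V: "open V" "A \<subseteq> V" "emeasure lborel (V - A) < ennreal (d\<^sup>2)"
        using outer_regular_lborel[OF A'(1), of "d\<^sup>2"] d by auto
      have "emeasure lborel V = emeasure lborel (V - A)"
        using A V by (intro emeasure_Diff_null_set[symmetric]) auto
      then have "emeasure \<mu> V \<le> ennreal (d * (D + 1))"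
        using V d by (intro U) auto
      also have "d * (D + 1) = e" using D by (simp add: d_def add_nonneg_eq_0_iff)
      finally show ?thesis
        using emeasure_mono[OF V(2), of \<mu>] V(1) by (auto intro: order_trans)
    qed
    have "emeasure \<mu> A \<le> 0"
    proof (rule ennreal_le_epsilon)
      show "emeasure \<mu> A \<le> 0 + ennreal e" if "0 < e" for e
        unfolding add_0 by (rule small[OF that])
    qed
    then have "emeasure \<mu> A = 0" by simp
    then show "A \<in> null_sets \<mu>" using A'(1) by (intro null_setsI) (simp_all only: sets_eq)
  qed
qed

end

text \<open>The joint law of two consecutive increments is all that second moments need. The factor
  2 in the exponent reflects that the symmetrization has exponent \<open>2 * \<psi>\<close>.\<close>

locale symmetric_increments = prob_space M + subquadratic_exponent \<psi>
  for M :: "'w measure" and \<psi> :: "'a::euclidean_space \<Rightarrow> real" +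
  fixes Y :: "real \<Rightarrow> 'w \<Rightarrow> 'a"
  assumes joint [measurable]: "case_prod Y \<in> borel_measurable (borel \<Otimes>\<^sub>M M)"
    and increments: "\<And>s r r' \<xi> \<eta>. 0 \<le> s \<Longrightarrow> s \<le> r \<Longrightarrow> r \<le> r' \<Longrightarrow>
      (LINT \<omega>|M. iexp (\<xi> \<bullet> (Y r \<omega> - Y s \<omega>)) * iexp (\<eta> \<bullet> (Y r' \<omega> - Y r \<omega>))) =
        complex_of_real (exp (- 2 * (r - s) * \<psi> \<xi>) * exp (- 2 * (r' - r) * \<psi> \<eta>))"
begin

lemma measurable_path [measurable]: "\<omega> \<in> space M \<Longrightarrow> (\<lambda>s. Y s \<omega>) \<in> borel_measurable borel"
  using measurable_Pair2[OF joint] by simp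

lemma measurable_marginal [measurable]: "Y s \<in> borel_measurable M"
  using measurable_compose_Pair1[OF _ joint, of s] by simp

lemma finite_measure_interval: "finite_measure (restrict_space lborel {0..t::real})"
  by (rule finite_measureI) (simp add: space_restrict_space emeasure_restrict_space emeasure_lborel_Icc_eq)

lemma measurable_id_interval: "(\<lambda>s. s) \<in> borel_measurable (restrict_space lborel {0..t::real})"
  by (intro measurable_restrict_space1) simp

lemma measurable_path_interval:
  assumes "\<omega> \<in> space M" shows "(\<lambda>s. Y s \<omega>) \<in> borel_measurable (restrict_space lborel {0..t})"
  using measurable_compose[OF measurable_id_interval measurable_path[OF assms]] .

lemma finite_borel_occupation:
  assumes "\<omega> \<in> space M" shows "finite_borel_measure (occupation_measure Y t \<omega>)"
proof -
  have "finite_measure (occupation_measure Y t \<omega>)"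
    unfolding occupation_measure_def
    by (intro finite_measure.finite_measure_distr finite_measure_interval measurable_path_interval assms)
  then show ?thesis
    by (simp add: finite_borel_measure_def finite_borel_measure_axioms_def occupation_measure_def)
qed

lemma nn_integral_occupation:
  assumes \<omega>: "\<omega> \<in> space M" and [measurable]: "f \<in> borel_measurable borel"
  shows "(\<integral>\<^sup>+ x. f x \<partial>occupation_measure Y t \<omega>) = (\<integral>\<^sup>+ s. f (Y s \<omega>) * indicator {0..t} s \<partial>lborel)"
  unfolding occupation_measure_def
  using measurable_path_interval[OF \<omega>] by (simp add: nn_integral_distr nn_integral_restrict_space)

lemma AE_occupation:
  assumes \<omega>: "\<omega> \<in> space M" and "{x. P x} \<in> sets borel"
  shows "(AE x in occupation_measure Y t \<omega>. P x) \<longleftrightarrow> (AE s in lborel. s \<in> {0..t} \<longrightarrow> P (Y s \<omega>))"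
  unfolding occupation_measure_def
  using assms measurable_path_interval[OF \<omega>] by (simp add: AE_distr_iff AE_restrict_space_iff)

lemma increment_char:
  assumes "0 \<le> s" "s \<le> r"
  shows "(LINT \<omega>|M. iexp (\<xi> \<bullet> (Y r \<omega> - Y s \<omega>))) = complex_of_real (exp (- 2 * (r - s) * \<psi> \<xi>))"
  using increments[OF assms order_refl, of \<xi> 0] by simp

lemma expectation_cos_increment:
  assumes "0 \<le> s" "0 \<le> r"
  shows "expectation (\<lambda>\<omega>. cos (\<xi> \<bullet> (Y s \<omega> - Y r \<omega>))) = exp (- 2 * \<bar>s - r\<bar> * \<psi> \<xi>)"
proof -
  have *: "expectation (\<lambda>\<omega>. cos (\<xi> \<bullet> (Y r \<omega> - Y s \<omega>))) = exp (- 2 * (r - s) * \<psi> \<xi>)" if "0 \<le> s" "s \<le> r" for r s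
  proof -
    have "expectation (\<lambda>\<omega>. cos (\<xi> \<bullet> (Y r \<omega> - Y s \<omega>))) = expectation (\<lambda>\<omega>. Re (iexp (\<xi> \<bullet> (Y r \<omega> - Y s \<omega>))))"
      by (simp add: Re_exp)
    also have "\<dots> = Re (LINT \<omega>|M. iexp (\<xi> \<bullet> (Y r \<omega> - Y s \<omega>)))"
      by (intro integral_Re integrable_const_bound[of _ 1]) auto
    finally show ?thesis unfolding increment_char[OF that] by simp
  qed
  show ?thesis
  proof (cases "s \<le> r")
    case True
    have "cos (\<xi> \<bullet> (Y s \<omega> - Y r \<omega>)) = cos (\<xi> \<bullet> (Y r \<omega> - Y s \<omega>))" for \<omega>
      using cos_minus[of "\<xi> \<bullet> (Y r \<omega> - Y s \<omega>)"] by (simp add: inner_diff_right)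
    then show ?thesis using *[OF assms(1) True] True by simp
  next
    case False
    then show ?thesis using *[OF assms(2), of s] by simp
  qed
qed

text \<open>The second moment is a double time integral of
  \<open>exp (- 2 \<bar>s - r\<bar> \<psi>)\<close>. Splitting the square at the diagonal leaves,
  for each later time, the multiplier integral of the heat equation.\<close>

lemma expectation_ft_occupation_le:
  assumes t: "0 \<le> t"
  shows "(\<integral>\<^sup>+ \<omega>. ennreal ((cmod (LINT s|restrict_space lborel {0..t}. iexp (\<xi> \<bullet> Y s \<omega>)))\<^sup>2) \<partial>M) \<le> ennreal (t * exp (2 * t) * J \<xi>)"
proof -
  define R where "R = restrict_space lborel {0..t}"
  interpret R: finite_measure R unfolding R_def by (rule finite_measure_interval)
  interpret RR: finite_measure "R \<Otimes>\<^sub>M R"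
    by (rule finite_measure_pair_measure) unfold_locales
  interpret R2: pair_sigma_finite R R ..
  interpret P: pair_sigma_finite "R \<Otimes>\<^sub>M R" M ..
  interpret PF: finite_measure "(R \<Otimes>\<^sub>M R) \<Otimes>\<^sub>M M"
    by (rule finite_measure_pair_measure) unfold_locales
  have id_R [measurable]: "(\<lambda>s. s) \<in> borel_measurable R" unfolding R_def by (rule measurable_id_interval)
  have [measurable]: "fst \<in> borel_measurable (R \<Otimes>\<^sub>M R)" "snd \<in> borel_measurable (R \<Otimes>\<^sub>M R)"
    using measurable_compose[OF measurable_fst id_R] measurable_compose[OF measurable_snd id_R] by simp_all
  have [measurable]: "fst \<in> borel_measurable (R \<Otimes>\<^sub>M M)"
    using measurable_compose[OF measurable_fst id_R] by simp
  have sp: "space R = {0..t}" by (simp add: R_def space_restrict_space)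
  have Y1: "(\<lambda>z. case_prod Y (fst (fst z), snd z)) \<in> borel_measurable ((R \<Otimes>\<^sub>M R) \<Otimes>\<^sub>M M)"
    "(\<lambda>z. case_prod Y (snd (fst z), snd z)) \<in> borel_measurable ((R \<Otimes>\<^sub>M R) \<Otimes>\<^sub>M M)"
    by measurable
  have f_int: "integrable ((R \<Otimes>\<^sub>M R) \<Otimes>\<^sub>M M) (case_prod (\<lambda>z \<omega>. cos (\<xi> \<bullet> (Y (fst z) \<omega> - Y (snd z) \<omega>))))"
    using Y1 by (intro PF.integrable_const_bound[of _ 1]) (auto simp: case_prod_beta')
  have Z_meas: "(\<lambda>\<omega>. LINT s|R. iexp (\<xi> \<bullet> Y s \<omega>)) \<in> borel_measurable M"
  proof (rule R.borel_measurable_lebesgue_integral)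
    have "(\<lambda>z. case_prod Y (snd z, fst z)) \<in> borel_measurable (M \<Otimes>\<^sub>M R)"
      using measurable_compose[OF measurable_snd id_R] by measurable
    then show "(\<lambda>(\<omega>, s). iexp (\<xi> \<bullet> Y s \<omega>)) \<in> borel_measurable (M \<Otimes>\<^sub>M R)"
      by (simp add: case_prod_beta')
  qed
  have Z_le: "(cmod (LINT s|R. iexp (\<xi> \<bullet> Y s \<omega>)))\<^sup>2 \<le> (measure R (space R))\<^sup>2" if "\<omega> \<in> space M" for \<omega>
  proof (rule power_mono)
    have "cmod (LINT s|R. iexp (\<xi> \<bullet> Y s \<omega>)) \<le> (LINT s|R. 1)"
      using measurable_path_interval[OF that, of t] unfolding R_def[symmetric] by (intro norm_integral_le) auto
    then show "cmod (LINT s|R. iexp (\<xi> \<bullet> Y s \<omega>)) \<le> measure R (space R)" by simp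
  qed simp
  have Z_int: "integrable M (\<lambda>\<omega>. (cmod (LINT s|R. iexp (\<xi> \<bullet> Y s \<omega>)))\<^sup>2)"
    using Z_meas Z_le by (intro integrable_const_bound[of _ "(measure R (space R))\<^sup>2"]) auto
  have "(\<integral>\<^sup>+ \<omega>. ennreal ((cmod (LINT s|R. iexp (\<xi> \<bullet> Y s \<omega>)))\<^sup>2) \<partial>M) =
      ennreal (expectation (\<lambda>\<omega>. (cmod (LINT s|R. iexp (\<xi> \<bullet> Y s \<omega>)))\<^sup>2))"
    using Z_int by (intro nn_integral_eq_integral) auto
  also have "expectation (\<lambda>\<omega>. (cmod (LINT s|R. iexp (\<xi> \<bullet> Y s \<omega>)))\<^sup>2) =
      expectation (\<lambda>\<omega>. LINT z|(R \<Otimes>\<^sub>M R). cos (\<xi> \<bullet> (Y (fst z) \<omega> - Y (snd z) \<omega>)))"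
  proof (rule Bochner_Integration.integral_cong[OF refl])
    fix \<omega> assume "\<omega> \<in> space M"
    then show "(cmod (LINT s|R. iexp (\<xi> \<bullet> Y s \<omega>)))\<^sup>2 = (LINT z|(R \<Otimes>\<^sub>M R). cos (\<xi> \<bullet> (Y (fst z) \<omega> - Y (snd z) \<omega>)))"
      unfolding R_def by (intro finite_measure.norm_integral_iexp_sq finite_measure_interval measurable_path_interval)
  qed
  also have "\<dots> = (LINT z|(R \<Otimes>\<^sub>M R). expectation (\<lambda>\<omega>. cos (\<xi> \<bullet> (Y (fst z) \<omega> - Y (snd z) \<omega>))))"
    by (rule P.Fubini_integral[OF f_int])
  also have "\<dots> = (LINT z|(R \<Otimes>\<^sub>M R). exp (- 2 * \<bar>fst z - snd z\<bar> * \<psi> \<xi>))"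
    by (intro Bochner_Integration.integral_cong refl expectation_cos_increment) (auto simp: space_pair_measure sp)
  also have "ennreal \<dots> = (\<integral>\<^sup>+ z. ennreal (exp (- 2 * \<bar>fst z - snd z\<bar> * \<psi> \<xi>)) \<partial>(R \<Otimes>\<^sub>M R))"
    by (intro nn_integral_eq_integral[symmetric] RR.integrable_const_bound[of _ 1]) auto
  \<comment> \<open>Both indicators are 1 on the diagonal, hence an inequality rather than an
    equality.\<close>
  also have "\<dots> \<le> (\<integral>\<^sup>+ z. (ennreal (exp (- 2 * (fst z - snd z) * \<psi> \<xi>)) * indicator {0..fst z} (snd z)) +
      (ennreal (exp (- 2 * (snd z - fst z) * \<psi> \<xi>)) * indicator {0..snd z} (fst z)) \<partial>(R \<Otimes>\<^sub>M R))"
  proof (intro nn_integral_mono)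
    fix z assume "z \<in> space (R \<Otimes>\<^sub>M R)"
    then have "0 \<le> fst z" "0 \<le> snd z" by (auto simp: space_pair_measure sp)
    then show "ennreal (exp (- 2 * \<bar>fst z - snd z\<bar> * \<psi> \<xi>)) \<le> (ennreal (exp (- 2 * (fst z - snd z) * \<psi> \<xi>)) * indicator {0..fst z} (snd z)) +
      (ennreal (exp (- 2 * (snd z - fst z) * \<psi> \<xi>)) * indicator {0..snd z} (fst z))"
      by (cases "snd z \<le> fst z") (auto simp: add_increasing2)
  qed
  also have "\<dots> = (\<integral>\<^sup>+ z. ennreal (exp (- 2 * (fst z - snd z) * \<psi> \<xi>)) * indicator {0..fst z} (snd z) \<partial>(R \<Otimes>\<^sub>M R)) +
      (\<integral>\<^sup>+ z. ennreal (exp (- 2 * (snd z - fst z) * \<psi> \<xi>)) * indicator {0..snd z} (fst z) \<partial>(R \<Otimes>\<^sub>M R))"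
    unfolding indicator_def of_bool_def by (intro nn_integral_add) simp_all
  also have "\<dots> = (\<integral>\<^sup>+ s. (\<integral>\<^sup>+ r. ennreal (exp (- 2 * (s - r) * \<psi> \<xi>)) * indicator {0..s} r \<partial>R) \<partial>R) +
     (\<integral>\<^sup>+ s. (\<integral>\<^sup>+ r. ennreal (exp (- 2 * (s - r) * \<psi> \<xi>)) * indicator {0..s} r \<partial>R) \<partial>R)"
    unfolding indicator_def of_bool_def
    by (subst R.nn_integral_fst[symmetric], simp, subst R2.nn_integral_snd[symmetric], simp_all)
  also have "\<dots> \<le> (\<integral>\<^sup>+ s. ennreal (exp (2 * t) / 2 * J \<xi>) \<partial>R) + (\<integral>\<^sup>+ s. ennreal (exp (2 * t) / 2 * J \<xi>) \<partial>R)"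
  proof (intro add_mono nn_integral_mono)
    fix s assume "s \<in> space R"
    then have s: "0 \<le> s" "s \<le> t" by (auto simp: sp)
    have "(\<integral>\<^sup>+ r. ennreal (exp (- 2 * (s - r) * \<psi> \<xi>)) * indicator {0..s} r \<partial>R) \<le>
       (\<integral>\<^sup>+ r. ennreal (exp (- 2 * (s - r) * \<psi> \<xi>)) * indicator {0..s} r \<partial>lborel)"
      unfolding R_def by (subst nn_integral_restrict_space) (auto intro!: nn_integral_mono split: split_indicator)
    also have "\<dots> \<le> ennreal (exp (2 * s) / 2 * J \<xi>)"
      unfolding J_def by (rule heat_multiplier_bounds(2)[OF s(1) nonneg])
    also have "\<dots> \<le> ennreal (exp (2 * t) / 2 * J \<xi>)"
      using s by (intro ennreal_leI mult_right_mono divide_right_mono) auto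
    finally show "(\<integral>\<^sup>+ r. ennreal (exp (- 2 * (s - r) * \<psi> \<xi>)) * indicator {0..s} r \<partial>R) \<le> ennreal (exp (2 * t) / 2 * J \<xi>)"
      "(\<integral>\<^sup>+ r. ennreal (exp (- 2 * (s - r) * \<psi> \<xi>)) * indicator {0..s} r \<partial>R) \<le> ennreal (exp (2 * t) / 2 * J \<xi>)" by this+
  qed
  also have "\<dots> = ennreal (t * exp (2 * t) * J \<xi>)"
  proof -
    have "emeasure R (space R) = ennreal t"
      unfolding R_def using t by (simp add: emeasure_restrict_space space_restrict_space)
    moreover have "0 \<le> t * (exp (2 * t) / 2 * J \<xi>)" using t by simp
    ultimately show ?thesis
      using t by (simp add: ennreal_mult[symmetric] ennreal_plus[symmetric] mult_ac del: ennreal_plus)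
  qed
  finally show ?thesis unfolding R_def .
qed

theorem local_times_if_integrable:
  assumes J: "integrable lborel J"
  shows "has_local_times M Y"
  unfolding has_local_times_def
proof (intro allI impI)
  fix t :: real assume t: "0 \<le> t"
  define R where "R = restrict_space lborel {0..t}"
  interpret R: finite_measure R unfolding R_def by (rule finite_measure_interval)
  interpret P: pair_sigma_finite "lborel :: 'a measure" M ..
  have id_R: "(\<lambda>s. s) \<in> borel_measurable R" unfolding R_def by (rule measurable_id_interval)
  have [measurable]: "(\<lambda>z. LINT s|R. iexp (fst z \<bullet> Y s (snd z))) \<in> borel_measurable ((lborel :: 'a measure) \<Otimes>\<^sub>M M)"
  proof (rule R.borel_measurable_lebesgue_integral)
    have 1: "(\<lambda>z. case_prod Y (snd z, snd (fst z))) \<in> borel_measurable (((lborel :: 'a measure) \<Otimes>\<^sub>M M) \<Otimes>\<^sub>M R)"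
      using measurable_compose[OF measurable_snd id_R] by measurable
    have 2: "(\<lambda>z. fst (fst z)) \<in> borel_measurable (((lborel :: 'a measure) \<Otimes>\<^sub>M M) \<Otimes>\<^sub>M R)"
      using measurable_compose[OF measurable_fst measurable_fst] by simp
    show "(\<lambda>(z, s). iexp (fst z \<bullet> Y s (snd z))) \<in> borel_measurable (((lborel :: 'a measure) \<Otimes>\<^sub>M M) \<Otimes>\<^sub>M R)"
      using 1 2 by (simp add: case_prod_beta')
  qed
  define F where "F \<omega> = (\<integral>\<^sup>+ \<xi>. ennreal ((cmod (LINT s|R. iexp (\<xi> \<bullet> Y s \<omega>)))\<^sup>2) \<partial>lborel)" for \<omega>
  have Fm: "case_prod (\<lambda>\<xi> \<omega>. ennreal ((cmod (LINT s|R. iexp (\<xi> \<bullet> Y s \<omega>)))\<^sup>2)) \<in> borel_measurable (lborel \<Otimes>\<^sub>M M)"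
    unfolding case_prod_beta' by measurable
  have "(\<integral>\<^sup>+ \<omega>. F \<omega> \<partial>M) = (\<integral>\<^sup>+ \<xi>. (\<integral>\<^sup>+ \<omega>. ennreal ((cmod (LINT s|R. iexp (\<xi> \<bullet> Y s \<omega>)))\<^sup>2) \<partial>M) \<partial>lborel)"
    unfolding F_def by (rule P.Fubini'[OF Fm])
  also have "\<dots> \<le> (\<integral>\<^sup>+ \<xi>. ennreal (t * exp (2 * t) * J \<xi>) \<partial>lborel)"
    unfolding R_def by (intro nn_integral_mono expectation_ft_occupation_le t)
  also have "\<dots> = ennreal (LINT \<xi>|lborel. t * exp (2 * t) * J \<xi>)"
    using J t by (intro nn_integral_eq_integral) auto
  also have "\<dots> < \<infinity>" by simp
  finally have "(\<integral>\<^sup>+ \<omega>. F \<omega> \<partial>M) \<noteq> \<infinity>" by simp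
  moreover have "F \<in> borel_measurable M"
    unfolding F_def using measurable_pair_swap[OF Fm] by (intro lborel.borel_measurable_nn_integral) (simp add: case_prod_beta')
  ultimately have "AE \<omega> in M. F \<omega> \<noteq> \<infinity>" by (intro nn_integral_PInf_AE)
  then show "AE \<omega> in M. absolutely_continuous lborel (occupation_measure Y t \<omega>)"
  proof (rule AE_mp, intro AE_I2 impI)
    fix \<omega> assume \<omega>: "\<omega> \<in> space M" and fin: "F \<omega> \<noteq> \<infinity>"
    interpret \<mu>: finite_borel_measure "occupation_measure Y t \<omega>" by (rule finite_borel_occupation[OF \<omega>])
    have "\<mu>.ft \<xi> = (LINT s|R. iexp (\<xi> \<bullet> Y s \<omega>))" for \<xi>
      unfolding \<mu>.ft_def unfolding occupation_measure_def R_def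
      by (subst integral_distr[OF measurable_path_interval[OF \<omega>]]) auto
    then show "absolutely_continuous lborel (occupation_measure Y t \<omega>)"
      using fin by (intro \<mu>.absolutely_continuous_if_ft_sq_integrable) (simp add: F_def top.not_eq_extremum)
  qed
qed

end

section \<open>Local times: necessity\<close>

context symmetric_increments
begin

text \<open>The mean of the Gaussian kernel at an increment over a time span \<open>a\<close>, in
  Fourier form. It stands for the density of the increment at 0, which itself may be infinite or
  fail to exist.\<close>

definition mollified_density :: "real \<Rightarrow> real \<Rightarrow> real" where
  "mollified_density \<sigma> a = (LINT \<xi>|lborel. gauss_exp \<sigma> \<xi> * exp (- 2 * a * \<psi> \<xi>)) / (2 * pi) ^ DIM('a)"

lemma integrable_gauss_exp_mult:
  assumes "0 < \<sigma>" and [measurable]: "f \<in> borel_measurable borel" and "\<And>\<xi>. 0 \<le> f \<xi>" "\<And>\<xi>. f \<xi> \<le> 1"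
  shows "integrable lborel (\<lambda>\<xi>::'a. gauss_exp \<sigma> \<xi> * f \<xi>)"
  by (rule Bochner_Integration.integrable_bound[OF integrable_gauss_exp[OF assms(1)]])
    (use assms in \<open>auto simp: abs_mult intro!: mult_left_le\<close>)

lemma gauss_density_inversion:
  assumes "0 < \<sigma>"
  shows "complex_of_real (gauss_density \<sigma> (x::'a)) = (LINT \<xi>|lborel. iexp (\<xi> \<bullet> x) * complex_of_real (gauss_exp \<sigma> \<xi>)) / (2 * pi) ^ DIM('a)"
  using fourier_gauss_exp[OF assms, of x] unfolding fourier_def by (simp add: inner_commute)

text \<open>Inversion writes the kernel as a superposition of exponentials, so modulation by
  \<open>\<eta>\<close> only shifts the frequency on the first increment. With
  \<open>\<eta> = 0\<close> and \<open>r' = r\<close> this is the mean of the kernel; general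
  \<open>\<eta>\<close> serves the product of two kernels.\<close>

lemma expectation_modulated_gauss:
  assumes \<sigma>: "0 < \<sigma>" and s: "0 \<le> s" "s \<le> r" "r \<le> r'"
  shows "(LINT \<omega>|M. complex_of_real (gauss_density \<sigma> (Y r \<omega> - Y s \<omega>)) * (iexp (\<eta> \<bullet> (Y r \<omega> - Y s \<omega>)) * iexp (\<eta> \<bullet> (Y r' \<omega> - Y r \<omega>)))) =
    complex_of_real ((LINT \<xi>|lborel. gauss_exp \<sigma> \<xi> * exp (- 2 * (r - s) * \<psi> (\<xi> + \<eta>))) / (2 * pi) ^ DIM('a) * exp (- 2 * (r' - r) * \<psi> \<eta>))"
proof -
  interpret P: pair_sigma_finite "lborel :: 'a measure" M ..
  define f where "f \<xi> \<omega> = complex_of_real (gauss_exp \<sigma> \<xi>) * (iexp ((\<xi> + \<eta>) \<bullet> (Y r \<omega> - Y s \<omega>)) * iexp (\<eta> \<bullet> (Y r' \<omega> - Y r \<omega>)))" for \<xi> \<omega>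
  have e: "complex_of_real (gauss_density \<sigma> (Y r \<omega> - Y s \<omega>)) * (iexp (\<eta> \<bullet> (Y r \<omega> - Y s \<omega>)) * iexp (\<eta> \<bullet> (Y r' \<omega> - Y r \<omega>))) =
      (LINT \<xi>|lborel. f \<xi> \<omega>) / (2 * pi) ^ DIM('a)" for \<omega>
  proof -
    have "f \<xi> \<omega> = (iexp (\<xi> \<bullet> (Y r \<omega> - Y s \<omega>)) * complex_of_real (gauss_exp \<sigma> \<xi>)) * (iexp (\<eta> \<bullet> (Y r \<omega> - Y s \<omega>)) * iexp (\<eta> \<bullet> (Y r' \<omega> - Y r \<omega>)))" for \<xi>
      unfolding f_def by (simp add: inner_add_left distrib_left exp_add)
    then show ?thesis
      unfolding gauss_density_inversion[OF \<sigma>] by (simp only: integral_mult_left_zero times_divide_eq_left)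
  qed
  have "(LINT \<omega>|M. (LINT \<xi>|lborel. f \<xi> \<omega>)) = (LINT \<xi>|lborel. (LINT \<omega>|M. f \<xi> \<omega>))"
  proof (rule P.Fubini_product_bound[where a="gauss_exp \<sigma>" and b="\<lambda>_. 1"])
    show "case_prod f \<in> borel_measurable (lborel \<Otimes>\<^sub>M M)"
      unfolding f_def by measurable
  qed (use \<sigma> in \<open>auto simp: f_def norm_mult integrable_gauss_exp\<close>)
  also have "\<dots> = (LINT \<xi>|lborel. complex_of_real (gauss_exp \<sigma> \<xi> * exp (- 2 * (r - s) * \<psi> (\<xi> + \<eta>))) * complex_of_real (exp (- 2 * (r' - r) * \<psi> \<eta>)))"
    unfolding f_def integral_mult_right_zero increments[OF s] of_real_mult mult.assoc ..
  also have "\<dots> = complex_of_real ((LINT \<xi>|lborel. gauss_exp \<sigma> \<xi> * exp (- 2 * (r - s) * \<psi> (\<xi> + \<eta>))) * exp (- 2 * (r' - r) * \<psi> \<eta>))"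
    unfolding of_real_mult[symmetric] integral_complex_of_real integral_mult_left_zero ..
  finally show ?thesis
    unfolding e integral_divide_zero by simp
qed

lemma expectation_gauss_density:
  assumes \<sigma>: "0 < \<sigma>" and s: "0 \<le> s" "s \<le> r"
  shows "expectation (\<lambda>\<omega>. gauss_density \<sigma> (Y r \<omega> - Y s \<omega>)) = mollified_density \<sigma> (r - s)"
proof -
  have "complex_of_real (expectation (\<lambda>\<omega>. gauss_density \<sigma> (Y r \<omega> - Y s \<omega>))) = complex_of_real (mollified_density \<sigma> (r - s))"
    using expectation_modulated_gauss[OF \<sigma> s order_refl, of 0]
    by (simp add: mollified_density_def)
  then show ?thesis by (simp only: of_real_eq_iff)
qed

lemma mollified_density_nonneg: "0 \<le> mollified_density \<sigma> a"
  unfolding mollified_density_def by (intro divide_nonneg_nonneg integral_nonneg_AE) auto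

lemma gauss_density_bounded:
  assumes "0 < \<sigma>" obtains B where "\<And>x::'a. gauss_density \<sigma> x \<le> B"
proof -
  have "gauss_density \<sigma> x \<le> 1 / (sqrt (2 * pi) * \<sigma>) ^ DIM('a)" for x :: 'a
    unfolding gauss_density_eq[OF assms] using assms by (intro divide_right_mono) auto
  then show ?thesis by (rule that)
qed

lemma integrable_gauss_density_increment:
  assumes "0 < \<sigma>" shows "integrable M (\<lambda>\<omega>. gauss_density \<sigma> (Y r \<omega> - Y s \<omega>))"
proof -
  obtain B where "\<And>x::'a. gauss_density \<sigma> x \<le> B" using gauss_density_bounded[OF assms] by blast
  then show ?thesis by (intro integrable_const_bound[of _ B]) auto
qed

text \<open>Positivity of the Fourier transform makes \<open>x \<mapsto> E k (x + Y\<^sub>a)\<close> maximal at \<open>0\<close>.\<close>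

lemma shifted_density_le:
  assumes \<sigma>: "0 < \<sigma>" and a: "0 \<le> a"
  shows "(LINT \<xi>|lborel. gauss_exp \<sigma> \<xi> * exp (- 2 * a * \<psi> (\<xi> + \<eta>))) / (2 * pi) ^ DIM('a) \<le> mollified_density \<sigma> a"
    (is "?q \<le> _")
proof -
  have eq: "complex_of_real ?q = (LINT \<omega>|M. complex_of_real (gauss_density \<sigma> (Y a \<omega> - Y 0 \<omega>)) * (iexp (\<eta> \<bullet> (Y a \<omega> - Y 0 \<omega>)) * iexp (\<eta> \<bullet> (Y a \<omega> - Y a \<omega>))))"
    using expectation_modulated_gauss[OF \<sigma> order_refl a order_refl, of \<eta>] by simp
  have "?q \<le> cmod (complex_of_real ?q)"
    unfolding norm_of_real by (rule abs_ge_self)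
  also have "\<dots> = cmod (LINT \<omega>|M. complex_of_real (gauss_density \<sigma> (Y a \<omega> - Y 0 \<omega>)) * (iexp (\<eta> \<bullet> (Y a \<omega> - Y 0 \<omega>)) * iexp (\<eta> \<bullet> (Y a \<omega> - Y a \<omega>))))"
    by (rule arg_cong[OF eq])
  also have "\<dots> \<le> expectation (\<lambda>\<omega>. gauss_density \<sigma> (Y a \<omega> - Y 0 \<omega>))"
    using integrable_gauss_density_increment[OF \<sigma>] by (intro norm_integral_le) (auto simp: norm_mult)
  also have "\<dots> = mollified_density \<sigma> a"
    using expectation_gauss_density[OF \<sigma> order_refl a] by simp
  finally show ?thesis .
qed

text \<open>Inverting the second kernel turns the mean into an integral over \<open>\<eta>\<close>
  of \<open>q \<eta>\<close> times the decay due to the later increment. Here \<open>q\<close> is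
  the transform of a positive measure, hence bounded by its value at frequency 0, and what remains
  is the mean of one kernel over the later span.\<close>

lemma expectation_gauss_density_prod_le:
  assumes \<sigma>: "0 < \<sigma>" and s: "0 \<le> s" "s \<le> r" "r \<le> r'"
  shows "expectation (\<lambda>\<omega>. gauss_density \<sigma> (Y r \<omega> - Y s \<omega>) * gauss_density \<sigma> (Y r' \<omega> - Y s \<omega>)) \<le>
    mollified_density \<sigma> (r - s) * mollified_density \<sigma> (r' - r)"
proof -
  interpret P: pair_sigma_finite "lborel :: 'a measure" M ..
  obtain B where B: "\<And>x::'a. gauss_density \<sigma> x \<le> B" using gauss_density_bounded[OF \<sigma>] by blast
  define q where "q \<eta> = (LINT \<xi>|lborel. gauss_exp \<sigma> \<xi> * exp (- 2 * (r - s) * \<psi> (\<xi> + \<eta>))) / (2 * pi) ^ DIM('a)" for \<eta>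
  have "0 \<le> r - s" using s by simp
  then have q: "0 \<le> q \<eta>" "q \<eta> \<le> mollified_density \<sigma> (r - s)" for \<eta>
    unfolding q_def by (intro divide_nonneg_nonneg integral_nonneg_AE shifted_density_le[OF \<sigma>]; simp)+
  have [measurable]: "q \<in> borel_measurable borel" unfolding q_def by measurable
  define f where "f \<eta> \<omega> = complex_of_real (gauss_exp \<sigma> \<eta>) * (complex_of_real (gauss_density \<sigma> (Y r \<omega> - Y s \<omega>)) * (iexp (\<eta> \<bullet> (Y r \<omega> - Y s \<omega>)) * iexp (\<eta> \<bullet> (Y r' \<omega> - Y r \<omega>))))" for \<eta> \<omega>
  have e: "complex_of_real (gauss_density \<sigma> (Y r \<omega> - Y s \<omega>) * gauss_density \<sigma> (Y r' \<omega> - Y s \<omega>)) =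
      (LINT \<eta>|lborel. f \<eta> \<omega>) / (2 * pi) ^ DIM('a)" for \<omega>
  proof -
    have "iexp (\<eta> \<bullet> (Y r \<omega> - Y s \<omega>)) * iexp (\<eta> \<bullet> (Y r' \<omega> - Y r \<omega>)) = iexp (\<eta> \<bullet> (Y r' \<omega> - Y s \<omega>))" for \<eta>
      unfolding iexp_add_inner[symmetric] by simp
    then have "f \<eta> \<omega> = complex_of_real (gauss_density \<sigma> (Y r \<omega> - Y s \<omega>)) * (iexp (\<eta> \<bullet> (Y r' \<omega> - Y s \<omega>)) * complex_of_real (gauss_exp \<sigma> \<eta>))" for \<eta>
      unfolding f_def by simp
    then show ?thesis
      unfolding of_real_mult gauss_density_inversion[OF \<sigma>, of "Y r' \<omega> - Y s \<omega>"]
      by (simp only: integral_mult_right_zero times_divide_eq_right)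
  qed
  have "complex_of_real (expectation (\<lambda>\<omega>. gauss_density \<sigma> (Y r \<omega> - Y s \<omega>) * gauss_density \<sigma> (Y r' \<omega> - Y s \<omega>))) =
     (LINT \<omega>|M. (LINT \<eta>|lborel. f \<eta> \<omega>)) / (2 * pi) ^ DIM('a)"
    unfolding integral_complex_of_real[symmetric] e integral_divide_zero ..
  also have "(LINT \<omega>|M. (LINT \<eta>|lborel. f \<eta> \<omega>)) = (LINT \<eta>|lborel. (LINT \<omega>|M. f \<eta> \<omega>))"
  proof (rule P.Fubini_product_bound[where a="gauss_exp \<sigma>" and b="\<lambda>_. B"])
    show "case_prod f \<in> borel_measurable (lborel \<Otimes>\<^sub>M M)"
      unfolding f_def by measurable
    show "norm (f \<eta> \<omega>) \<le> gauss_exp \<sigma> \<eta> * B" for \<eta> \<omega>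
      unfolding f_def using B by (auto simp: norm_mult intro!: mult_left_mono)
  qed (use \<sigma> in \<open>auto simp: integrable_gauss_exp\<close>)
  also have "\<dots> = (LINT \<eta>|lborel. complex_of_real (gauss_exp \<sigma> \<eta> * (q \<eta> * exp (- 2 * (r' - r) * \<psi> \<eta>))))"
    unfolding f_def integral_mult_right_zero expectation_modulated_gauss[OF \<sigma> s] q_def of_real_mult ..
  also have "(LINT \<eta>|lborel. complex_of_real (gauss_exp \<sigma> \<eta> * (q \<eta> * exp (- 2 * (r' - r) * \<psi> \<eta>)))) / (2 * pi) ^ DIM('a) =
      complex_of_real ((LINT \<eta>|lborel. gauss_exp \<sigma> \<eta> * (q \<eta> * exp (- 2 * (r' - r) * \<psi> \<eta>))) / (2 * pi) ^ DIM('a))"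
    unfolding integral_complex_of_real of_real_divide ..
  finally have "expectation (\<lambda>\<omega>. gauss_density \<sigma> (Y r \<omega> - Y s \<omega>) * gauss_density \<sigma> (Y r' \<omega> - Y s \<omega>)) =
      (LINT \<eta>|lborel. gauss_exp \<sigma> \<eta> * (q \<eta> * exp (- 2 * (r' - r) * \<psi> \<eta>))) / (2 * pi) ^ DIM('a)"
    unfolding of_real_eq_iff .
  also have "\<dots> \<le> (LINT \<eta>|lborel. mollified_density \<sigma> (r - s) * (gauss_exp \<sigma> \<eta> * exp (- 2 * (r' - r) * \<psi> \<eta>))) / (2 * pi) ^ DIM('a)"
  proof (intro divide_right_mono integral_mono)
    have i: "integrable lborel (\<lambda>\<eta>. gauss_exp \<sigma> \<eta> * exp (- 2 * (r' - r) * \<psi> \<eta>))"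
    proof (rule integrable_gauss_exp_mult[OF \<sigma>])
      show "exp (- 2 * (r' - r) * \<psi> \<eta>) \<le> 1" for \<eta>
        unfolding exp_le_one_iff using s by (intro mult_nonpos_nonneg) auto
    qed auto
    then show i': "integrable lborel (\<lambda>\<eta>. mollified_density \<sigma> (r - s) * (gauss_exp \<sigma> \<eta> * exp (- 2 * (r' - r) * \<psi> \<eta>)))"
      by simp
    show le: "gauss_exp \<sigma> \<eta> * (q \<eta> * exp (- 2 * (r' - r) * \<psi> \<eta>)) \<le> mollified_density \<sigma> (r - s) * (gauss_exp \<sigma> \<eta> * exp (- 2 * (r' - r) * \<psi> \<eta>))" for \<eta>
      unfolding mult.left_commute[of _ "gauss_exp \<sigma> \<eta>"] using q by (intro mult_left_mono mult_right_mono) auto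
    show "integrable lborel (\<lambda>\<eta>. gauss_exp \<sigma> \<eta> * (q \<eta> * exp (- 2 * (r' - r) * \<psi> \<eta>)))"
    proof (rule Bochner_Integration.integrable_bound[OF i'])
      show "AE \<eta> in lborel. norm (gauss_exp \<sigma> \<eta> * (q \<eta> * exp (- 2 * (r' - r) * \<psi> \<eta>))) \<le>
          norm (mollified_density \<sigma> (r - s) * (gauss_exp \<sigma> \<eta> * exp (- 2 * (r' - r) * \<psi> \<eta>)))"
        using le order_trans[OF le abs_ge_self] q by (intro AE_I2) (simp add: abs_mult)
    qed simp
  qed simp
  also have "\<dots> = mollified_density \<sigma> (r - s) * mollified_density \<sigma> (r' - r)"
    unfolding integral_mult_right_zero by (simp add: mollified_density_def)
  finally show ?thesis .
qed

section \<open>First and second moment of the mollified local mass\<close>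

definition local_mass :: "real \<Rightarrow> real \<Rightarrow> 'w \<Rightarrow> ennreal" where
  "local_mass \<sigma> s \<omega> = (\<integral>\<^sup>+ a. ennreal (gauss_density \<sigma> (Y (s + a) \<omega> - Y s \<omega>)) * indicator {0..1} a \<partial>lborel)"

definition mean_mass :: "real \<Rightarrow> ennreal" where
  "mean_mass \<sigma> = (\<integral>\<^sup>+ a. ennreal (mollified_density \<sigma> a) * indicator {0..1} a \<partial>lborel)"

lemma measurable_mollified_density [measurable]: "mollified_density \<sigma> \<in> borel_measurable borel"
  unfolding mollified_density_def by measurable

lemma measurable_Y_comp [measurable (raw)]:
  assumes "f \<in> borel_measurable N" "g \<in> measurable N M"
  shows "(\<lambda>x. Y (f x) (g x)) \<in> borel_measurable N"
  using measurable_compose[OF measurable_Pair[OF assms] joint] by simp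

lemma measurable_local_mass:
  "(\<lambda>z. local_mass \<sigma> (fst z) (snd z)) \<in> borel_measurable (lborel \<Otimes>\<^sub>M M)"
  unfolding local_mass_def by measurable

lemma measurable_local_mass' [measurable]: "local_mass \<sigma> s \<in> borel_measurable M"
  unfolding local_mass_def by measurable

lemma nn_expectation_local_mass:
  assumes \<sigma>: "0 < \<sigma>" and s: "0 \<le> s"
  shows "(\<integral>\<^sup>+ \<omega>. local_mass \<sigma> s \<omega> \<partial>M) = mean_mass \<sigma>"
proof -
  interpret P: pair_sigma_finite "lborel :: real measure" M ..
  have "(\<integral>\<^sup>+ \<omega>. local_mass \<sigma> s \<omega> \<partial>M) = (\<integral>\<^sup>+ a. (\<integral>\<^sup>+ \<omega>. ennreal (gauss_density \<sigma> (Y (s + a) \<omega> - Y s \<omega>)) * indicator {0..1} a \<partial>M) \<partial>lborel)"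
    unfolding local_mass_def by (rule P.Fubini') measurable
  also have "\<dots> = mean_mass \<sigma>"
    unfolding mean_mass_def
  proof (intro nn_integral_cong)
    fix a
    have "(\<integral>\<^sup>+ \<omega>. ennreal (gauss_density \<sigma> (Y (s + a) \<omega> - Y s \<omega>)) \<partial>M) = ennreal (mollified_density \<sigma> a)" if "0 \<le> a"
      using expectation_gauss_density[OF \<sigma> s, of "s + a"] that
      by (subst nn_integral_eq_integral) (auto intro: integrable_gauss_density_increment \<sigma>)
    then show "(\<integral>\<^sup>+ \<omega>. ennreal (gauss_density \<sigma> (Y (s + a) \<omega> - Y s \<omega>)) * indicator {0..1} a \<partial>M) = ennreal (mollified_density \<sigma> a) * indicator {0..1} a"
      by (simp add: nn_integral_multc split: split_indicator)
  qed
  finally show ?thesis .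
qed

text \<open>Shifting \<open>b\<close> by \<open>a\<close> decouples the two spans once the later one
  is allowed the full range from 0 to 1.\<close>

lemma nn_integral_density_pairs_le:
  "(\<integral>\<^sup>+ a. (\<integral>\<^sup>+ b. ennreal (mollified_density \<sigma> a * mollified_density \<sigma> (b - a)) * (indicator {0..1} a * indicator {a..1} b) \<partial>lborel) \<partial>lborel) \<le> mean_mass \<sigma> * mean_mass \<sigma>"
proof -
  have "(\<integral>\<^sup>+ b. ennreal (mollified_density \<sigma> (b - a)) * indicator {a..1} b \<partial>lborel) \<le> mean_mass \<sigma>" if "0 \<le> a" for a
  proof -
    have "(\<integral>\<^sup>+ b. ennreal (mollified_density \<sigma> (b - a)) * indicator {a..1} b \<partial>lborel) =
      (\<integral>\<^sup>+ b. ennreal (mollified_density \<sigma> ((a + b) - a)) * indicator {a..1} (a + b) \<partial>lborel)"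
      by (rule nn_integral_lborel_shift[symmetric]) measurable
    also have "\<dots> \<le> mean_mass \<sigma>"
      unfolding mean_mass_def using that by (intro nn_integral_mono) (auto split: split_indicator)
    finally show ?thesis .
  qed
  note inner = this
  have "(\<integral>\<^sup>+ a. (\<integral>\<^sup>+ b. ennreal (mollified_density \<sigma> a * mollified_density \<sigma> (b - a)) * (indicator {0..1} a * indicator {a..1} b) \<partial>lborel) \<partial>lborel) =
    (\<integral>\<^sup>+ a. (ennreal (mollified_density \<sigma> a) * indicator {0..1} a) * (\<integral>\<^sup>+ b. ennreal (mollified_density \<sigma> (b - a)) * indicator {a..1} b \<partial>lborel) \<partial>lborel)"
    by (intro nn_integral_cong, subst nn_integral_cmult[symmetric]) (auto simp: ennreal_mult mollified_density_nonneg mult_ac)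
  also have "\<dots> \<le> (\<integral>\<^sup>+ a. (ennreal (mollified_density \<sigma> a) * indicator {0..1} a) * mean_mass \<sigma> \<partial>lborel)"
    by (intro nn_integral_mono) (auto intro!: mult_left_mono inner split: split_indicator)
  also have "\<dots> = mean_mass \<sigma> * mean_mass \<sigma>"
    unfolding mean_mass_def by (rule nn_integral_multc) measurable
  finally show ?thesis .
qed

text \<open>The square is an integral over pairs of times. Each of the two orders contributes at
  most the square of the mean, which explains the factor 2.\<close>

lemma nn_expectation_local_mass_sq:
  assumes \<sigma>: "0 < \<sigma>" and s: "0 \<le> s"
  shows "(\<integral>\<^sup>+ \<omega>. (local_mass \<sigma> s \<omega>)\<^sup>2 \<partial>M) \<le> 2 * (mean_mass \<sigma>)\<^sup>2"
proof -
  interpret P: pair_sigma_finite "lborel :: real measure" M ..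
  define k where "k a \<omega> = gauss_density \<sigma> (Y (s + a) \<omega> - Y s \<omega>)" for a \<omega>
  have [measurable]: "(\<lambda>z. k (f z) (g z)) \<in> borel_measurable N" if "f \<in> borel_measurable N" "g \<in> measurable N M" for f g and N :: "'n measure"
    unfolding k_def using that by measurable
  have k0: "0 \<le> k a \<omega>" for a \<omega> by (simp add: k_def)
  define I where "I a = (indicator {0..1::real} a :: ennreal)" for a
  have [measurable]: "I \<in> borel_measurable borel" unfolding I_def by measurable
  define m2 where "m2 a b = ennreal (mollified_density \<sigma> a * mollified_density \<sigma> (b - a)) * (indicator {0..1} a * indicator {a..1} b)" for a b
  have m2_meas: "case_prod m2 \<in> borel_measurable (lborel \<Otimes>\<^sub>M lborel)"
    unfolding m2_def indicator_def of_bool_def atLeastAtMost_iff by measurable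
  have kk: "(\<integral>\<^sup>+ \<omega>. ennreal (k a \<omega> * k b \<omega>) \<partial>M) \<le> ennreal (mollified_density \<sigma> a * mollified_density \<sigma> (b - a))" if "0 \<le> a" "a \<le> b" for a b
  proof -
    obtain B where B: "\<And>x::'a. gauss_density \<sigma> x \<le> B" using gauss_density_bounded[OF \<sigma>] by blast
    have "integrable M (\<lambda>\<omega>. k a \<omega> * k b \<omega>)"
      by (intro integrable_const_bound[of _ "B * B"]) (auto simp: k_def abs_mult intro!: mult_mono B order_trans[OF gauss_density_nonneg B])
    then have "(\<integral>\<^sup>+ \<omega>. ennreal (k a \<omega> * k b \<omega>) \<partial>M) = ennreal (expectation (\<lambda>\<omega>. k a \<omega> * k b \<omega>))"
      by (intro nn_integral_eq_integral) (auto simp: k0)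
    also have "\<dots> \<le> ennreal (mollified_density \<sigma> a * mollified_density \<sigma> (b - a))"
      using expectation_gauss_density_prod_le[OF \<sigma> s, of "s + a" "s + b"] that
      by (intro ennreal_leI) (simp add: k_def)
    finally show ?thesis .
  qed
  have sq: "(local_mass \<sigma> s \<omega>)\<^sup>2 = (\<integral>\<^sup>+ a. (\<integral>\<^sup>+ b. ennreal (k a \<omega> * k b \<omega>) * (I a * I b) \<partial>lborel) \<partial>lborel)" if \<omega>: "\<omega> \<in> space M" for \<omega>
  proof -
    have [measurable]: "(\<lambda>a. k a \<omega>) \<in> borel_measurable borel"
      unfolding k_def using \<omega> by measurable
    have "(local_mass \<sigma> s \<omega>)\<^sup>2 = (\<integral>\<^sup>+ a. (ennreal (k a \<omega>) * I a) * local_mass \<sigma> s \<omega> \<partial>lborel)"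
      unfolding power2_eq_square local_mass_def k_def[symmetric] I_def[symmetric] by (rule nn_integral_multc[symmetric]) measurable
    also have "\<dots> = (\<integral>\<^sup>+ a. (\<integral>\<^sup>+ b. ennreal (k a \<omega> * k b \<omega>) * (I a * I b) \<partial>lborel) \<partial>lborel)"
      unfolding local_mass_def k_def[symmetric] I_def[symmetric]
      by (intro nn_integral_cong, subst nn_integral_cmult[symmetric]) (auto simp: ennreal_mult k0 mult_ac)
    finally show ?thesis .
  qed
  have "(\<integral>\<^sup>+ \<omega>. (local_mass \<sigma> s \<omega>)\<^sup>2 \<partial>M) = (\<integral>\<^sup>+ \<omega>. (\<integral>\<^sup>+ a. (\<integral>\<^sup>+ b. ennreal (k a \<omega> * k b \<omega>) * (I a * I b) \<partial>lborel) \<partial>lborel) \<partial>M)"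
    by (intro nn_integral_cong sq)
  also have "\<dots> = (\<integral>\<^sup>+ a. (\<integral>\<^sup>+ \<omega>. (\<integral>\<^sup>+ b. ennreal (k a \<omega> * k b \<omega>) * (I a * I b) \<partial>lborel) \<partial>M) \<partial>lborel)"
    by (rule P.Fubini') measurable
  also have "\<dots> = (\<integral>\<^sup>+ a. (\<integral>\<^sup>+ b. (\<integral>\<^sup>+ \<omega>. ennreal (k a \<omega> * k b \<omega>) * (I a * I b) \<partial>M) \<partial>lborel) \<partial>lborel)"
    by (intro nn_integral_cong P.Fubini') measurable
  also have "\<dots> \<le> (\<integral>\<^sup>+ a. (\<integral>\<^sup>+ b. m2 a b + m2 b a \<partial>lborel) \<partial>lborel)"
  proof (intro nn_integral_mono)
    fix a b
    have "(\<integral>\<^sup>+ \<omega>. ennreal (k a \<omega> * k b \<omega>) * (I a * I b) \<partial>M) = (\<integral>\<^sup>+ \<omega>. ennreal (k a \<omega> * k b \<omega>) \<partial>M) * (I a * I b)"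
      by (rule nn_integral_multc) measurable
    also have "\<dots> \<le> m2 a b + m2 b a"
    proof (cases "a \<in> {0..1} \<and> b \<in> {0..1}")
      case True
      then have I: "I a = 1" "I b = 1" by (auto simp: I_def)
      show ?thesis
      proof (cases "a \<le> b")
        case ab: True
        then have "(\<integral>\<^sup>+ \<omega>. ennreal (k a \<omega> * k b \<omega>) \<partial>M) \<le> m2 a b"
          using kk[of a b] True by (simp add: m2_def)
        then show ?thesis by (simp add: I add_increasing2)
      next
        case False
        then have "(\<integral>\<^sup>+ \<omega>. ennreal (k a \<omega> * k b \<omega>) \<partial>M) \<le> m2 b a"
          using kk[of b a] True by (simp add: m2_def mult.commute)
        then show ?thesis by (simp add: I add_increasing)
      qed
    qed (auto simp: I_def)
    finally show "(\<integral>\<^sup>+ \<omega>. ennreal (k a \<omega> * k b \<omega>) * (I a * I b) \<partial>M) \<le> m2 a b + m2 b a" .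
  qed
  also have "\<dots> = (\<integral>\<^sup>+ a. (\<integral>\<^sup>+ b. m2 a b \<partial>lborel) \<partial>lborel) + (\<integral>\<^sup>+ a. (\<integral>\<^sup>+ b. m2 b a \<partial>lborel) \<partial>lborel)"
  proof -
    have 1: "(\<lambda>b. m2 a b) \<in> borel_measurable lborel" "(\<lambda>b. m2 b a) \<in> borel_measurable lborel" for a
      unfolding m2_def indicator_def of_bool_def atLeastAtMost_iff by measurable
    have 2: "(\<lambda>a. \<integral>\<^sup>+ b. m2 a b \<partial>lborel) \<in> borel_measurable lborel"
      using m2_meas by (rule lborel.borel_measurable_nn_integral)
    have 3: "(\<lambda>a. \<integral>\<^sup>+ b. m2 b a \<partial>lborel) \<in> borel_measurable lborel"
      using measurable_pair_swap[OF m2_meas] by (intro lborel.borel_measurable_nn_integral) (simp add: case_prod_beta')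
    show ?thesis
      by (subst nn_integral_add[OF 2 3, symmetric]) (intro nn_integral_cong nn_integral_add 1)
  qed
  also have "(\<integral>\<^sup>+ a. (\<integral>\<^sup>+ b. m2 b a \<partial>lborel) \<partial>lborel) = (\<integral>\<^sup>+ a. (\<integral>\<^sup>+ b. m2 a b \<partial>lborel) \<partial>lborel)"
    by (rule lborel_pair.Fubini'[OF m2_meas])
  also have "(\<integral>\<^sup>+ a. (\<integral>\<^sup>+ b. m2 a b \<partial>lborel) \<partial>lborel) + (\<integral>\<^sup>+ a. (\<integral>\<^sup>+ b. m2 a b \<partial>lborel) \<partial>lborel) \<le> mean_mass \<sigma> * mean_mass \<sigma> + mean_mass \<sigma> * mean_mass \<sigma>"
    unfolding m2_def by (intro add_mono nn_integral_density_pairs_le)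
  finally show ?thesis by (simp add: power2_eq_square mult_2)
qed

lemma mean_mass_finite:
  assumes \<sigma>: "0 < \<sigma>" shows "mean_mass \<sigma> < \<infinity>"
proof -
  obtain B where B: "\<And>x::'a. gauss_density \<sigma> x \<le> B" using gauss_density_bounded[OF \<sigma>] by blast
  have "mollified_density \<sigma> a \<le> B" if "0 \<le> a" for a
  proof -
    have "expectation (\<lambda>\<omega>. gauss_density \<sigma> (Y a \<omega> - Y 0 \<omega>)) \<le> expectation (\<lambda>\<omega>. B)"
      using B by (intro integral_mono integrable_gauss_density_increment \<sigma>) auto
    then show ?thesis using expectation_gauss_density[OF \<sigma> order_refl that] by (simp add: prob_space)
  qed
  then have "mean_mass \<sigma> \<le> (\<integral>\<^sup>+ a. ennreal B * indicator {0..1::real} a \<partial>lborel)"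
    unfolding mean_mass_def by (intro nn_integral_mono) (auto split: split_indicator intro!: ennreal_leI)
  also have "\<dots> < \<infinity>" by (simp add: nn_integral_cmult_indicator)
  finally show ?thesis .
qed

text \<open>Paley-Zygmund gives a threshold of half the mean, hence the factor 2 in front of
  \<open>K\<close>.\<close>

lemma prob_local_mass_ge:
  assumes \<sigma>: "0 < \<sigma>" and s: "0 \<le> s" and K: "0 < K" "ennreal (2 * K) \<le> mean_mass \<sigma>"
  shows "1 / 8 \<le> prob {\<omega>\<in>space M. ennreal K < local_mass \<sigma> s \<omega>}"
proof -
  obtain m where m: "mean_mass \<sigma> = ennreal m" "0 \<le> m"
    using mean_mass_finite[OF \<sigma>] by (cases "mean_mass \<sigma>") auto
  have Km: "2 * K \<le> m" using K m by (simp add: ennreal_le_iff)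
  define f where "f \<omega> = enn2real (local_mass \<sigma> s \<omega>)" for \<omega>
  obtain B where B: "\<And>x::'a. gauss_density \<sigma> x \<le> B" using gauss_density_bounded[OF \<sigma>] by blast
  \<comment> \<open>\<open>enn2real\<close> sends infinity to 0; boundedness of the kernel ensures
    that nothing is lost.\<close>
  have f: "ennreal (f \<omega>) = local_mass \<sigma> s \<omega>" for \<omega>
  proof -
    have "local_mass \<sigma> s \<omega> \<le> (\<integral>\<^sup>+ a. ennreal B * indicator {0..1::real} a \<partial>lborel)"
      unfolding local_mass_def using B by (intro nn_integral_mono mult_right_mono ennreal_leI) auto
    also have "\<dots> < top" by (simp add: nn_integral_cmult_indicator)
    finally show ?thesis unfolding f_def by simp
  qed
  have "1 / 8 \<le> prob {\<omega>\<in>space M. m / 2 < f \<omega>}"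
  proof (rule paley_zygmund)
    show "f \<in> borel_measurable M" unfolding f_def by measurable
    show "0 \<le> f \<omega>" for \<omega> by (simp add: f_def)
    show "0 < m" using K Km by simp
    show "(\<integral>\<^sup>+ \<omega>. ennreal (f \<omega>) \<partial>M) = ennreal m"
      unfolding f m(1)[symmetric] by (rule nn_expectation_local_mass[OF \<sigma> s])
    have "ennreal ((f \<omega>)\<^sup>2) = (local_mass \<sigma> s \<omega>)\<^sup>2" for \<omega>
      unfolding f[symmetric] by (simp add: f_def ennreal_power)
    then show "(\<integral>\<^sup>+ \<omega>. ennreal ((f \<omega>)\<^sup>2) \<partial>M) \<le> ennreal (2 * m\<^sup>2)"
      using nn_expectation_local_mass_sq[OF \<sigma> s] m by (simp add: ennreal_mult ennreal_power)
  qed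
  also have "\<dots> \<le> prob {\<omega>\<in>space M. ennreal K < local_mass \<sigma> s \<omega>}"
  proof (rule finite_measure_mono)
    show "{\<omega>\<in>space M. m / 2 < f \<omega>} \<subseteq> {\<omega>\<in>space M. ennreal K < local_mass \<sigma> s \<omega>}"
      unfolding f[symmetric] using Km K by (auto simp: ennreal_less_iff)
  qed measurable
  finally show ?thesis .
qed

text \<open>Frequency by frequency, the mean is the heat multiplier at time 1 damped by
  \<open>gauss_exp \<sigma>\<close>. As the width tends to 0 the damping disappears, so bounded
  means would make \<open>J\<close> integrable by Fatou's lemma.\<close>

lemma mean_mass_unbounded:
  assumes J: "\<not> integrable lborel J"
  shows "\<exists>\<sigma>>0. ennreal K \<le> mean_mass \<sigma>"
proof (rule ccontr)
  assume "\<not> ?thesis"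
  then have le: "mean_mass \<sigma> \<le> ennreal K" if "0 < \<sigma>" for \<sigma> using that by (auto simp: not_le intro: less_imp_le)
  define \<sigma> where "\<sigma> n = 1 / real (Suc n)" for n
  have \<sigma>: "0 < \<sigma> n" for n by (simp add: \<sigma>_def)
  have \<sigma>0: "\<sigma> \<longlonglongrightarrow> 0" unfolding \<sigma>_def by (rule LIMSEQ_Suc[OF lim_1_over_n])
  \<comment> \<open>The lower constant of \<open>heat_multiplier_bounds\<close> at time 1, divided
    by the constant of Fourier inversion.\<close>
  define c where "c = (1 - exp (- 2 * 1)) / 2 / (2 * pi) ^ DIM('a)"
  have c: "0 < c" unfolding c_def by (intro divide_pos_pos) auto
  have lower: "(\<integral>\<^sup>+ \<xi>. ennreal (c * (gauss_exp \<sigma> \<xi> * J \<xi>)) \<partial>lborel) \<le> mean_mass \<sigma>" if "0 < \<sigma>" for \<sigma>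
  proof -
    have a: "ennreal ((1 - exp (- 2 * 1)) / 2 * J \<xi>) \<le> (\<integral>\<^sup>+ a. ennreal (exp (- 2 * a * \<psi> \<xi>)) * indicator {0..1} a \<partial>lborel)" for \<xi>
    proof -
      have "ennreal ((1 - exp (- 2 * 1)) / 2 * J \<xi>) \<le> (\<integral>\<^sup>+ s. ennreal (exp (- 2 * (1 - s) * \<psi> \<xi>)) * indicator {0..1} s \<partial>lborel)"
        unfolding J_def by (rule heat_multiplier_bounds(1)) auto
      \<comment> \<open>Reversing time by \<open>a = 1 - s\<close> turns the heat multiplier into
        the integral over spans.\<close>
      also have "\<dots> = (\<integral>\<^sup>+ s. ennreal (exp (- 2 * (1 - s) * \<psi> \<xi>)) * indicator {0..1} (1 - s) \<partial>lborel)"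
        by (intro nn_integral_cong) (auto split: split_indicator)
      also have "\<dots> = (\<integral>\<^sup>+ a. ennreal (exp (- 2 * a * \<psi> \<xi>)) * indicator {0..1} a \<partial>lborel)"
        by (rule nn_integral_lborel_reflect) measurable
      finally show ?thesis .
    qed
    define d where "d \<xi> = gauss_exp \<sigma> \<xi> / (2 * pi) ^ DIM('a)" for \<xi> :: 'a
    have [measurable]: "d \<in> borel_measurable borel" unfolding d_def by measurable
    have d0: "0 \<le> d \<xi>" for \<xi> by (simp add: d_def)
    have "(\<integral>\<^sup>+ \<xi>. ennreal (c * (gauss_exp \<sigma> \<xi> * J \<xi>)) \<partial>lborel) = (\<integral>\<^sup>+ \<xi>. ennreal (d \<xi>) * ennreal ((1 - exp (- 2 * 1)) / 2 * J \<xi>) \<partial>lborel)"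
      by (intro nn_integral_cong) (auto simp: ennreal_mult[symmetric] d0 c_def, simp add: d_def)
    also have "\<dots> \<le> (\<integral>\<^sup>+ \<xi>. ennreal (d \<xi>) * (\<integral>\<^sup>+ a. ennreal (exp (- 2 * a * \<psi> \<xi>)) * indicator {0..1} a \<partial>lborel) \<partial>lborel)"
      by (intro nn_integral_mono mult_left_mono a) auto
    also have "\<dots> = (\<integral>\<^sup>+ \<xi>. (\<integral>\<^sup>+ a. ennreal (d \<xi>) * (ennreal (exp (- 2 * a * \<psi> \<xi>)) * indicator {0..1} a) \<partial>lborel) \<partial>lborel)"
      by (intro nn_integral_cong nn_integral_cmult[symmetric]) measurable
    also have "\<dots> = (\<integral>\<^sup>+ a. (\<integral>\<^sup>+ \<xi>. ennreal (d \<xi>) * (ennreal (exp (- 2 * a * \<psi> \<xi>)) * indicator {0..1} a) \<partial>lborel) \<partial>lborel)"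
      by (rule lborel_pair.Fubini') measurable
    also have "\<dots> = mean_mass \<sigma>"
      unfolding mean_mass_def
    proof (intro nn_integral_cong)
      fix a :: real
      show "(\<integral>\<^sup>+ \<xi>. ennreal (d \<xi>) * (ennreal (exp (- 2 * a * \<psi> \<xi>)) * indicator {0..1} a) \<partial>lborel) = ennreal (mollified_density \<sigma> a) * indicator {0..1} a"
      proof (cases "a \<in> {0..1}")
        case True
        have i: "integrable lborel (\<lambda>\<xi>. gauss_exp \<sigma> \<xi> * exp (- 2 * a * \<psi> \<xi>))"
          using True by (intro integrable_gauss_exp_mult that) auto
        have "(\<integral>\<^sup>+ \<xi>. ennreal (d \<xi>) * ennreal (exp (- 2 * a * \<psi> \<xi>)) \<partial>lborel) = (\<integral>\<^sup>+ \<xi>. ennreal (gauss_exp \<sigma> \<xi> * exp (- 2 * a * \<psi> \<xi>) / (2 * pi) ^ DIM('a)) \<partial>lborel)"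
          by (intro nn_integral_cong) (simp add: d_def ennreal_mult[symmetric])
        also have "\<dots> = ennreal (LINT \<xi>|lborel. gauss_exp \<sigma> \<xi> * exp (- 2 * a * \<psi> \<xi>) / (2 * pi) ^ DIM('a))"
          using i by (intro nn_integral_eq_integral integrable_divide) auto
        also have "(LINT \<xi>|lborel. gauss_exp \<sigma> \<xi> * exp (- 2 * a * \<psi> \<xi>) / (2 * pi) ^ DIM('a)) = mollified_density \<sigma> a"
          unfolding mollified_density_def by (rule integral_divide_zero)
        finally show ?thesis using True by simp
      qed simp
    qed
    finally show ?thesis .
  qed
  have "(\<integral>\<^sup>+ \<xi>. ennreal (c * J \<xi>) \<partial>lborel) = (\<integral>\<^sup>+ \<xi>. liminf (\<lambda>n. ennreal (c * (gauss_exp (\<sigma> n) \<xi> * J \<xi>))) \<partial>lborel)"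
  proof (intro nn_integral_cong)
    fix \<xi> :: 'a
    have "(\<lambda>n. c * (exp (- (\<sigma> n * norm \<xi>)\<^sup>2 / 2) * J \<xi>)) \<longlonglongrightarrow> c * (exp (- (0 * norm \<xi>)\<^sup>2 / 2) * J \<xi>)"
      by (intro tendsto_intros \<sigma>0) auto
    then have "(\<lambda>n. ennreal (c * (gauss_exp (\<sigma> n) \<xi> * J \<xi>))) \<longlonglongrightarrow> ennreal (c * J \<xi>)"
      by (simp add: gauss_exp_def tendsto_ennrealI)
    then show "ennreal (c * J \<xi>) = liminf (\<lambda>n. ennreal (c * (gauss_exp (\<sigma> n) \<xi> * J \<xi>)))"
      by (intro lim_imp_Liminf[symmetric]) auto
  qed
  also have "\<dots> \<le> liminf (\<lambda>n. \<integral>\<^sup>+ \<xi>. ennreal (c * (gauss_exp (\<sigma> n) \<xi> * J \<xi>)) \<partial>lborel)"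
    by (rule nn_integral_liminf) measurable
  also have "\<dots> \<le> ennreal K"
    using order_trans[OF lower le, OF \<sigma> \<sigma>] by (intro Liminf_le) auto
  also have "\<dots> < \<infinity>" by simp
  finally have "integrable lborel (\<lambda>\<xi>. c * J \<xi>)"
    using c by (intro integrableI_bounded) (auto simp: abs_mult)
  then show False using J c by simp
qed

text \<open>By absolute continuity the mollified occupation density around \<open>Y\<^sub>s\<close> cannot exceed \<open>2\<^sup>n\<close> for
  infinitely many scales: Markov's inequality makes the exceptional sets summable in
  Lebesgue measure.\<close>

lemma eventually_local_mass_le:
  assumes \<omega>: "\<omega> \<in> space M" and ac: "absolutely_continuous lborel (occupation_measure Y 2 \<omega>)"
    and \<sigma>: "\<And>n. 0 < \<sigma> n"
  shows "AE s in lborel. s \<in> {0..1} \<longrightarrow> eventually (\<lambda>n. local_mass (\<sigma> n) s \<omega> \<le> ennreal (2 ^ n)) sequentially"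
proof -
  \<comment> \<open>Horizon 2 covers every time \<open>s + a\<close> with \<open>s\<close> and
    \<open>a\<close> in the unit interval; the total mass is accordingly 2.\<close>
  define \<mu> where "\<mu> = occupation_measure Y 2 \<omega>"
  interpret \<mu>: finite_borel_measure \<mu> unfolding \<mu>_def by (rule finite_borel_occupation[OF \<omega>])
  interpret P: pair_sigma_finite "lborel :: 'a measure" \<mu>
    by (intro pair_sigma_finite.intro sigma_finite_lborel \<mu>.sigma_finite_measure)
  have mass: "emeasure \<mu> UNIV = 2"
    using nn_integral_occupation[OF \<omega>, of "\<lambda>_. 1" 2] by (simp add: \<mu>_def[symmetric])
  define g where "g n x = (\<integral>\<^sup>+ y. ennreal (gauss_density (\<sigma> n) (y - x)) \<partial>\<mu>)" for n x
  have [measurable]: "g n \<in> borel_measurable borel" for n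
    unfolding g_def by measurable
  have gint: "(\<integral>\<^sup>+ x. g n x \<partial>lborel) = 2" for n
  proof -
    have "(\<integral>\<^sup>+ x. g n x \<partial>lborel) = (\<integral>\<^sup>+ y. (\<integral>\<^sup>+ x. ennreal (gauss_density (\<sigma> n) (y - x)) \<partial>lborel) \<partial>\<mu>)"
      unfolding g_def by (rule P.Fubini'[symmetric]) simp
    also have "\<dots> = 2"
      using nn_integral_lborel_reflect[of "\<lambda>x::'a. ennreal (gauss_density (\<sigma> n) x)"]
      by (simp add: nn_integral_gauss_density \<sigma> mass)
    finally show ?thesis .
  qed
  define E where "E n = {x. ennreal (2 ^ n) < g n x}" for n
  have [measurable]: "E n \<in> sets borel" for n unfolding E_def by measurable
  have E: "emeasure lborel (E n) \<le> ennreal (2 * (1 / 2) ^ n)" for n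
  proof -
    have "ennreal (2 ^ n) * emeasure lborel (E n) = (\<integral>\<^sup>+ x. ennreal (2 ^ n) * indicator (E n) x \<partial>lborel)"
      by (simp add: nn_integral_cmult_indicator)
    also have "\<dots> \<le> (\<integral>\<^sup>+ x. g n x \<partial>lborel)"
      by (intro nn_integral_mono) (auto simp: E_def less_imp_le split: split_indicator)
    finally have *: "ennreal (2 ^ n) * emeasure lborel (E n) \<le> 2" unfolding gint .
    have "emeasure lborel (E n) = ennreal ((1 / 2) ^ n) * (ennreal (2 ^ n) * emeasure lborel (E n))"
      unfolding mult.assoc[symmetric] by (simp add: ennreal_mult[symmetric] power_mult_distrib[symmetric])
    also have "\<dots> \<le> ennreal ((1 / 2) ^ n) * 2"
      by (intro mult_left_mono *) simp
    finally show ?thesis by (simp add: ennreal_mult mult.commute)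
  qed
  have fin: "emeasure lborel (E n) < \<infinity>" for n
    using E[of n] by (rule le_less_trans) simp
  have "summable (\<lambda>n. measure lborel (E n))"
  proof (rule summable_comparison_test')
    show "summable (\<lambda>n. 2 * (1 / 2 :: real) ^ n)" by (intro summable_mult summable_geometric) simp
    show "norm (measure lborel (E n)) \<le> 2 * (1 / 2) ^ n" for n
      using E[of n] by (simp add: measure_def enn2real_leI)
  qed
  then have "AE x in lborel. eventually (\<lambda>n. x \<in> space lborel - E n) sequentially"
    using fin by (intro borel_cantelli_AE1) auto
  then have "AE x in lborel. eventually (\<lambda>n. g n x \<le> ennreal (2 ^ n)) sequentially"
    by (simp add: E_def not_less)
  \<comment> \<open>Here absolute continuity enters: a property of almost every point in space holds
    for the position of the path at almost every time.\<close>
  then have "AE x in \<mu>. eventually (\<lambda>n. g n x \<le> ennreal (2 ^ n)) sequentially"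
    using ac by (intro absolutely_continuous_AE[of \<mu> lborel]) (auto simp: \<mu>_def[symmetric])
  then have "AE s in lborel. s \<in> {0..2} \<longrightarrow> eventually (\<lambda>n. g n (Y s \<omega>) \<le> ennreal (2 ^ n)) sequentially"
    unfolding \<mu>_def by (subst (asm) AE_occupation[OF \<omega>]) (auto simp: eventually_sequentially)
  then show ?thesis
  proof (rule AE_mp, intro AE_I2 impI)
    fix s :: real
    assume ev: "s \<in> {0..2} \<longrightarrow> eventually (\<lambda>n. g n (Y s \<omega>) \<le> ennreal (2 ^ n)) sequentially" and s: "s \<in> {0..1}"
    have "local_mass (\<sigma> n) s \<omega> \<le> g n (Y s \<omega>)" for n
    proof -
      have [measurable]: "(\<lambda>r. Y r \<omega>) \<in> borel_measurable borel" by (rule measurable_path[OF \<omega>])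
      have "local_mass (\<sigma> n) s \<omega> = (\<integral>\<^sup>+ a. ennreal (gauss_density (\<sigma> n) (Y (s + a) \<omega> - Y s \<omega>)) * indicator {s..s + 1} (s + a) \<partial>lborel)"
        unfolding local_mass_def by (intro nn_integral_cong) (auto split: split_indicator)
      also have "\<dots> = (\<integral>\<^sup>+ r. ennreal (gauss_density (\<sigma> n) (Y r \<omega> - Y s \<omega>)) * indicator {s..s + 1} r \<partial>lborel)"
        by (rule nn_integral_lborel_shift) measurable
      also have "\<dots> \<le> (\<integral>\<^sup>+ r. ennreal (gauss_density (\<sigma> n) (Y r \<omega> - Y s \<omega>)) * indicator {0..2} r \<partial>lborel)"
        using s by (intro nn_integral_mono) (auto split: split_indicator)
      also have "\<dots> = g n (Y s \<omega>)"
        unfolding g_def \<mu>_def by (rule nn_integral_occupation[OF \<omega>, symmetric]) measurable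
      finally show ?thesis .
    qed
    then show "eventually (\<lambda>n. local_mass (\<sigma> n) s \<omega> \<le> ennreal (2 ^ n)) sequentially"
      using ev s by (auto elim!: eventually_mono intro: order_trans)
  qed
qed

theorem integrable_if_local_times:
  assumes lt: "has_local_times M Y"
  shows "integrable lborel J"
proof (rule ccontr)
  assume J: "\<not> integrable lborel J"
  interpret P: pair_sigma_finite "lborel :: real measure" M ..
  \<comment> \<open>The means are matched to the thresholds \<open>2 ^ n\<close> of
    \<open>eventually_local_mass_le\<close>, with the factor 2 that Paley-Zygmund asks for.\<close>
  have "\<exists>\<sigma>>0. ennreal (2 * 2 ^ n) \<le> mean_mass \<sigma>" for n
    by (rule mean_mass_unbounded[OF J])
  then obtain \<sigma> where \<sigma>: "\<And>n. 0 < \<sigma> n" and big: "\<And>n. ennreal (2 * 2 ^ n) \<le> mean_mass (\<sigma> n)"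
    by metis
  have "AE \<omega> in M. absolutely_continuous lborel (occupation_measure Y 2 \<omega>)"
    using lt unfolding has_local_times_def by simp
  then have "AE \<omega> in M. AE s in lborel. s \<in> {0..1} \<longrightarrow> eventually (\<lambda>n. local_mass (\<sigma> n) s \<omega> \<le> ennreal (2 ^ n)) sequentially"
    by (rule AE_mp) (intro AE_I2 impI eventually_local_mass_le \<sigma>)
  moreover have "{z\<in>space (lborel \<Otimes>\<^sub>M M). fst z \<in> {0..1} \<longrightarrow> eventually (\<lambda>n. local_mass (\<sigma> n) (fst z) (snd z) \<le> ennreal (2 ^ n)) sequentially} \<in> sets (lborel \<Otimes>\<^sub>M M)"
    unfolding eventually_sequentially using measurable_local_mass by measurable
  \<comment> \<open>Exchanging the quantifiers yields one deterministic time \<open>s\<close>; the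
    probability bound holds at fixed times, so it can be contradicted there.\<close>
  ultimately have "AE s in lborel. AE \<omega> in M. s \<in> {0..1} \<longrightarrow> eventually (\<lambda>n. local_mass (\<sigma> n) s \<omega> \<le> ennreal (2 ^ n)) sequentially"
    by (subst P.AE_commute)
  then obtain N where N: "N \<in> null_sets (lborel :: real measure)"
    "{s \<in> space lborel. \<not> (AE \<omega> in M. s \<in> {0..1} \<longrightarrow> eventually (\<lambda>n. local_mass (\<sigma> n) s \<omega> \<le> ennreal (2 ^ n)) sequentially)} \<subseteq> N"
    unfolding eventually_ae_filter by blast
  have "\<not> {0..1::real} \<subseteq> N"
  proof
    assume "{0..1} \<subseteq> N"
    then have "emeasure lborel {0..1::real} \<le> emeasure lborel N"
      using N(1) by (intro emeasure_mono) auto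
    then show False using N(1) by auto
  qed
  then obtain s where s: "s \<in> {0..1}" "s \<notin> N" by blast
  then have ev: "AE \<omega> in M. eventually (\<lambda>n. local_mass (\<sigma> n) s \<omega> \<le> ennreal (2 ^ n)) sequentially"
    using N(2) by auto
  define S where "S n = {\<omega>\<in>space M. ennreal (2 ^ n) < local_mass (\<sigma> n) s \<omega>}" for n
  have [measurable]: "S n \<in> sets M" for n unfolding S_def by measurable
  have "(\<lambda>n. LINT \<omega>|M. indicator (S n) \<omega> :: real) \<longlonglongrightarrow> (LINT \<omega>|M. 0)"
  proof (rule integral_dominated_convergence[where w="\<lambda>_. 1"])
    show "AE \<omega> in M. (\<lambda>n. indicator (S n) \<omega> :: real) \<longlonglongrightarrow> 0"
      using ev
    proof eventually_elim
      case (elim \<omega>)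
      then have "eventually (\<lambda>n. (indicator (S n) \<omega> :: real) = 0) sequentially"
        by eventually_elim (auto simp: S_def indicator_def)
      then show ?case by (rule tendsto_eventually)
    qed
  qed auto
  then have "(\<lambda>n. prob (S n)) \<longlonglongrightarrow> 0" by simp
  moreover have "1 / 8 \<le> prob (S n)" for n
    unfolding S_def using s big[of n] by (intro prob_local_mass_ge \<sigma>) auto
  ultimately have "1 / 8 \<le> (0::real)"
    by (intro LIMSEQ_le_const) auto
  then show False by simp
qed

end

section \<open>The symmetrized process\<close>

lemma levy_joint_increment_char:
  fixes X :: "real \<Rightarrow> 'w \<Rightarrow> 'a::euclidean_space"
  assumes levy: "levy_process M X" and \<Psi>: "characteristic_exponent M X \<Psi>" and s: "0 \<le> s" "s \<le> r" "r \<le> r'"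
  shows "(LINT \<omega>|M. iexp (\<xi> \<bullet> (X r \<omega> - X s \<omega>)) * iexp (\<eta> \<bullet> (X r' \<omega> - X r \<omega>))) =
    exp (- complex_of_real (r - s) * \<Psi> \<xi>) * exp (- complex_of_real (r' - r) * \<Psi> \<eta>)"
proof -
  interpret levy_process M X by fact
  \<comment> \<open>The increments axiom takes an infinite monotone sequence of times, so the three
    times are continued by the constant \<open>r'\<close>.\<close>
  define \<tau> where "\<tau> n = (if n = 0 then s else if n = 1 then r else r')" for n :: nat
  have \<tau>: "\<tau> 0 = s" "\<tau> (Suc 0) = r" "\<tau> (Suc (Suc 0)) = r'" by (simp_all add: \<tau>_def)
  have "mono \<tau>" using s by (auto simp: mono_def \<tau>_def)
  then have ind: "indep_vars (\<lambda>_. borel) (\<lambda>i \<omega>. X (\<tau> (Suc i)) \<omega> - X (\<tau> i) \<omega>) {..<2::nat}"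
    using s by (intro indep_increments) (auto simp: \<tau>)
  define e where "e i x = (if i = 0 then iexp (\<xi> \<bullet> x) else iexp (\<eta> \<bullet> x))" for i :: nat and x
  have [measurable]: "e i \<in> borel_measurable borel" for i
    unfolding e_def by (cases "i = 0") simp_all
  have ind': "indep_vars (\<lambda>_. borel) (\<lambda>i \<omega>. e i (X (\<tau> (Suc i)) \<omega> - X (\<tau> i) \<omega>)) {..<2::nat}"
    by (rule indep_vars_compose2[OF ind]) simp
  have meas: "(\<lambda>\<omega>. X (\<tau> (Suc i)) \<omega> - X (\<tau> i) \<omega>) \<in> borel_measurable M" for i
    using rv[of "\<tau> (Suc i)"] rv[of "\<tau> i"] s by (intro borel_measurable_diff) (auto simp: \<tau>_def)
  have int: "integrable M (\<lambda>\<omega>. e i (X (\<tau> (Suc i)) \<omega> - X (\<tau> i) \<omega>))" for i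
    by (rule integrable_const_bound[of _ 1]) (use measurable_compose[OF meas, of "e i"] in \<open>auto simp: e_def\<close>)
  have one: "(LINT \<omega>|M. iexp (\<zeta> \<bullet> (X b \<omega> - X a \<omega>))) = exp (- complex_of_real (b - a) * \<Psi> \<zeta>)" if "0 \<le> a" "a \<le> b" for a b \<zeta>
  proof -
    have [measurable]: "X b \<in> borel_measurable M" "X a \<in> borel_measurable M" "X (b - a) \<in> borel_measurable M"
      using that by (intro rv; simp)+
    have "(LINT \<omega>|M. iexp (\<zeta> \<bullet> (X b \<omega> - X a \<omega>))) = (LINT x|distr M borel (\<lambda>\<omega>. X b \<omega> - X a \<omega>). iexp (\<zeta> \<bullet> x))"
      by (subst integral_distr) auto
    also have "distr M borel (\<lambda>\<omega>. X b \<omega> - X a \<omega>) = distr M borel (X (b - a))"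
      using stationary_increments[of a "b - a"] that by simp
    also have "(LINT x|distr M borel (X (b - a)). iexp (\<zeta> \<bullet> x)) = (LINT \<omega>|M. iexp (\<zeta> \<bullet> X (b - a) \<omega>))"
      by (subst integral_distr) auto
    also have "\<dots> = exp (- complex_of_real (b - a) * \<Psi> \<zeta>)"
      by (rule \<Psi>[unfolded characteristic_exponent_def, rule_format]) (use that in simp)
    finally show ?thesis .
  qed
  have set2: "{..<2::nat} = {0, Suc 0}" by auto
  have "(LINT \<omega>|M. (\<Prod>i\<in>{..<2}. e i (X (\<tau> (Suc i)) \<omega> - X (\<tau> i) \<omega>))) = (\<Prod>i\<in>{..<2}. LINT \<omega>|M. e i (X (\<tau> (Suc i)) \<omega> - X (\<tau> i) \<omega>))"
    using ind' int by (intro indep_vars_lebesgue_integral) auto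
  then show ?thesis
    using one[OF s(1,2), of \<xi>] one[OF order_trans[OF s(1,2)] s(3), of \<eta>]
    by (simp add: set2 \<tau> e_def)
qed

text \<open>Both increments are read off the path by one functional \<open>G\<close>. The
  symmetrized path gives \<open>G\<close> at \<open>X\<close> times the conjugate of
  \<open>G\<close> at \<open>X'\<close>; independence and equality in law make the mean a squared
  modulus, in which the imaginary part of \<open>\<Psi>\<close> cancels.\<close>

lemma symmetrization_increments:
  fixes X X' :: "real \<Rightarrow> 'w \<Rightarrow> 'a::euclidean_space"
  assumes levy: "levy_process M X" and \<Psi>: "characteristic_exponent M X \<Psi>" and copy: "independent_copy M X X'"
    and s: "0 \<le> s" "s \<le> r" "r \<le> r'"
  shows "(LINT \<omega>|M. iexp (\<xi> \<bullet> ((X r \<omega> - X' r \<omega>) - (X s \<omega> - X' s \<omega>))) * iexp (\<eta> \<bullet> ((X r' \<omega> - X' r' \<omega>) - (X r \<omega> - X' r \<omega>)))) =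
    complex_of_real (exp (- 2 * (r - s) * Re (\<Psi> \<xi>)) * exp (- 2 * (r' - r) * Re (\<Psi> \<eta>)))"
proof -
  interpret levy_process M X by fact
  define G where "G f = iexp (\<xi> \<bullet> (f r - f s)) * iexp (\<eta> \<bullet> (f r' - f r))" for f :: "real \<Rightarrow> 'a"
  let ?S = "\<Pi>\<^sub>M t\<in>{0::real..}. (borel :: 'a measure)"
  have G: "G \<in> borel_measurable ?S"
  proof -
    have [measurable]: "(\<lambda>f. f r) \<in> measurable ?S borel" "(\<lambda>f. f s) \<in> measurable ?S borel" "(\<lambda>f. f r') \<in> measurable ?S borel"
      using s by (auto intro!: measurable_component_singleton)
    show ?thesis unfolding G_def by measurable
  qed
  have ind: "indep_var ?S (trajectory X) ?S (trajectory X')" and dist: "distr M ?S (trajectory X') = distr M ?S (trajectory X)"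
    using copy unfolding independent_copy_def by auto
  have meas: "trajectory X \<in> measurable M ?S" "trajectory X' \<in> measurable M ?S"
    using indep_var_rv1[OF ind] indep_var_rv2[OF ind] by auto
  have GX: "G (trajectory Z \<omega>) = iexp (\<xi> \<bullet> (Z r \<omega> - Z s \<omega>)) * iexp (\<eta> \<bullet> (Z r' \<omega> - Z r \<omega>))" for Z \<omega>
    using s by (simp add: G_def trajectory_def)
  have norm_G: "cmod (G f) = 1" for f by (simp add: G_def norm_mult)
  have int: "integrable M (\<lambda>\<omega>. G (trajectory X \<omega>))" "integrable M (\<lambda>\<omega>. cnj (G (trajectory X' \<omega>)))"
    using measurable_compose[OF meas(1) G] measurable_compose[OF meas(2) G]
    by (auto intro!: integrable_const_bound[of _ 1] simp: norm_G)
  have Gc: "(\<lambda>f. cnj (G f)) \<in> borel_measurable ?S" using G by measurable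
  have "indep_var borel (G \<circ> trajectory X) borel ((\<lambda>f. cnj (G f)) \<circ> trajectory X')"
    by (rule indep_var_compose[OF ind G Gc])
  then have ind': "indep_var borel (\<lambda>\<omega>. G (trajectory X \<omega>)) borel (\<lambda>\<omega>. cnj (G (trajectory X' \<omega>)))"
    by (simp add: comp_def)
  have "iexp (\<xi> \<bullet> ((X r \<omega> - X' r \<omega>) - (X s \<omega> - X' s \<omega>))) * iexp (\<eta> \<bullet> ((X r' \<omega> - X' r' \<omega>) - (X r \<omega> - X' r \<omega>))) =
      G (trajectory X \<omega>) * cnj (G (trajectory X' \<omega>))" for \<omega>
  proof -
    have c: "iexp (\<zeta> \<bullet> ((a - a') - (b - b'))) = iexp (\<zeta> \<bullet> (a - b)) * cnj (iexp (\<zeta> \<bullet> (a' - b')))" for \<zeta> a a' b b' :: 'a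
    proof -
      have "(a - a') - (b - b') = (a - b) + - (a' - b')" by simp
      then have "iexp (\<zeta> \<bullet> ((a - a') - (b - b'))) = iexp (\<zeta> \<bullet> (a - b)) * iexp (\<zeta> \<bullet> (- (a' - b')))"
        by (simp only: iexp_add_inner)
      also have "iexp (\<zeta> \<bullet> (- (a' - b'))) = cnj (iexp (\<zeta> \<bullet> (a' - b')))"
        unfolding inner_minus_right by (simp add: exp_cnj)
      finally show ?thesis .
    qed
    show ?thesis unfolding GX c complex_cnj_mult by (simp only: mult_ac)
  qed
  then have "(LINT \<omega>|M. iexp (\<xi> \<bullet> ((X r \<omega> - X' r \<omega>) - (X s \<omega> - X' s \<omega>))) * iexp (\<eta> \<bullet> ((X r' \<omega> - X' r' \<omega>) - (X r \<omega> - X' r \<omega>)))) =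
      (LINT \<omega>|M. G (trajectory X \<omega>) * cnj (G (trajectory X' \<omega>)))"
    by simp
  also have "\<dots> = (LINT \<omega>|M. G (trajectory X \<omega>)) * (LINT \<omega>|M. cnj (G (trajectory X' \<omega>)))"
    by (rule indep_var_lebesgue_integral[OF ind' int])
  also have "(LINT \<omega>|M. cnj (G (trajectory X' \<omega>))) = cnj (LINT \<omega>|M. G (trajectory X' \<omega>))"
    by (rule Bochner_Integration.integral_cnj)
  also have "(LINT \<omega>|M. G (trajectory X' \<omega>)) = (LINT \<omega>|M. G (trajectory X \<omega>))"
    unfolding integral_distr[OF meas(1) G, symmetric] integral_distr[OF meas(2) G, symmetric] dist ..
  also have "(LINT \<omega>|M. G (trajectory X \<omega>)) = exp (- complex_of_real (r - s) * \<Psi> \<xi>) * exp (- complex_of_real (r' - r) * \<Psi> \<eta>)"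
    unfolding GX by (rule levy_joint_increment_char[OF levy \<Psi> s])
  also have "\<dots> * cnj \<dots> = complex_of_real ((cmod \<dots>)\<^sup>2)"
    by (rule complex_norm_square[symmetric])
  also have "(cmod (exp (- complex_of_real (r - s) * \<Psi> \<xi>) * exp (- complex_of_real (r' - r) * \<Psi> \<eta>)))\<^sup>2 =
      exp (- 2 * (r - s) * Re (\<Psi> \<xi>)) * exp (- 2 * (r' - r) * Re (\<Psi> \<eta>))"
  proof -
    have "(exp a)\<^sup>2 = exp (2 * a)" for a :: real by (simp add: exp_double)
    then show ?thesis
      unfolding norm_mult norm_exp_eq_Re power_mult_distrib by (simp add: algebra_simps)
  qed
  finally show ?thesis .
qed

lemma has_local_times_cong:
  assumes "AE \<omega> in M. \<forall>t\<ge>0. Y t \<omega> = Z t \<omega>"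
  shows "has_local_times M Y \<longleftrightarrow> has_local_times M Z"
proof -
  have "AE \<omega> in M. \<forall>t\<ge>0. occupation_measure Y t \<omega> = occupation_measure Z t \<omega>"
    using assms
  proof eventually_elim
    case (elim \<omega>)
    then show ?case
      unfolding occupation_measure_def by (auto intro!: distr_cong simp: space_restrict_space)
  qed
  then have "(AE \<omega> in M. absolutely_continuous lborel (occupation_measure Y t \<omega>)) \<longleftrightarrow>
     (AE \<omega> in M. absolutely_continuous lborel (occupation_measure Z t \<omega>))" if "0 \<le> t" for t
    using that by (intro eventually_subst) (auto elim!: eventually_mono)
  then show ?thesis unfolding has_local_times_def by blast
qed

text \<open>Equality in law on the product space says nothing about path regularity, so the
  measurable version of \<open>X'\<close> comes from \<open>X'\<close> being a Levy process itself.
  The difference of the two versions satisfies the assumptions of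
  \<open>symmetric_increments\<close> and almost surely has the same occupation measures.\<close>

theorem symmetrization_local_times_iff:
  fixes X X' :: "real \<Rightarrow> 'w \<Rightarrow> 'a::euclidean_space"
  assumes levy: "levy_process M X" and \<Psi>: "characteristic_exponent M X \<Psi>"
    and levy': "levy_process M X'" and copy: "independent_copy M X X'"
  shows "has_local_times M (\<lambda>t \<omega>. X t \<omega> - X' t \<omega>) \<longleftrightarrow> integrable lborel (\<lambda>\<xi>. 1 / (1 + Re (\<Psi> \<xi>)))"
proof -
  interpret levy_process M X by fact
  interpret L': levy_process M X' by fact
  interpret subquadratic_exponent "\<lambda>\<xi>. Re (\<Psi> \<xi>)" by (rule subquadratic_exponent_levy[OF levy \<Psi>])
  obtain Y where Y [measurable]: "case_prod Y \<in> borel_measurable (borel \<Otimes>\<^sub>M M)" and YX: "AE \<omega> in M. \<forall>t\<ge>0. Y t \<omega> = X t \<omega>"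
    using levy_process_measurable_version[OF levy] by blast
  obtain Y' where Y' [measurable]: "case_prod Y' \<in> borel_measurable (borel \<Otimes>\<^sub>M M)" and YX': "AE \<omega> in M. \<forall>t\<ge>0. Y' t \<omega> = X' t \<omega>"
    using levy_process_measurable_version[OF levy'] by blast
  define Z where "Z t \<omega> = Y t \<omega> - Y' t \<omega>" for t \<omega>
  have Z: "AE \<omega> in M. \<forall>t\<ge>0. Z t \<omega> = X t \<omega> - X' t \<omega>"
    using YX YX' by eventually_elim (auto simp: Z_def)
  have Zm: "case_prod Z \<in> borel_measurable (borel \<Otimes>\<^sub>M M)"
  proof -
    have "(\<lambda>z. case_prod Y z - case_prod Y' z) \<in> borel_measurable (borel \<Otimes>\<^sub>M M)" by measurable
    also have "(\<lambda>z. case_prod Y z - case_prod Y' z) = case_prod Z" by (auto simp: Z_def fun_eq_iff)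
    finally show ?thesis .
  qed
  interpret Z: symmetric_increments M "\<lambda>\<xi>. Re (\<Psi> \<xi>)" Z
  proof
    show "case_prod Z \<in> borel_measurable (borel \<Otimes>\<^sub>M M)" by (rule Zm)
    fix s r r' :: real and \<xi> \<eta> :: 'a assume s: "0 \<le> s" "s \<le> r" "r \<le> r'"
    have [measurable]: "Z t \<in> borel_measurable M" for t
      using measurable_compose_Pair1[OF _ Zm, of t] by simp
    have [measurable]: "X s \<in> borel_measurable M" "X r \<in> borel_measurable M" "X r' \<in> borel_measurable M"
      "X' s \<in> borel_measurable M" "X' r \<in> borel_measurable M" "X' r' \<in> borel_measurable M"
      using s by (auto intro!: rv L'.rv)
    have "(LINT \<omega>|M. iexp (\<xi> \<bullet> (Z r \<omega> - Z s \<omega>)) * iexp (\<eta> \<bullet> (Z r' \<omega> - Z r \<omega>))) =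
       (LINT \<omega>|M. iexp (\<xi> \<bullet> ((X r \<omega> - X' r \<omega>) - (X s \<omega> - X' s \<omega>))) * iexp (\<eta> \<bullet> ((X r' \<omega> - X' r' \<omega>) - (X r \<omega> - X' r \<omega>))))"
    proof (rule integral_cong_AE)
      show "AE \<omega> in M. iexp (\<xi> \<bullet> (Z r \<omega> - Z s \<omega>)) * iexp (\<eta> \<bullet> (Z r' \<omega> - Z r \<omega>)) =
        iexp (\<xi> \<bullet> ((X r \<omega> - X' r \<omega>) - (X s \<omega> - X' s \<omega>))) * iexp (\<eta> \<bullet> ((X r' \<omega> - X' r' \<omega>) - (X r \<omega> - X' r \<omega>)))"
        using Z by eventually_elim (use s in simp)
    qed measurable
    then show "(LINT \<omega>|M. iexp (\<xi> \<bullet> (Z r \<omega> - Z s \<omega>)) * iexp (\<eta> \<bullet> (Z r' \<omega> - Z r \<omega>))) =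
        complex_of_real (exp (- 2 * (r - s) * Re (\<Psi> \<xi>)) * exp (- 2 * (r' - r) * Re (\<Psi> \<eta>)))"
      unfolding symmetrization_increments[OF levy \<Psi> copy s] .
  qed
  have "has_local_times M (\<lambda>t \<omega>. X t \<omega> - X' t \<omega>) \<longleftrightarrow> has_local_times M Z"
    using Z by (intro has_local_times_cong) (auto elim!: eventually_mono)
  also have "\<dots> \<longleftrightarrow> integrable lborel J"
    using Z.local_times_if_integrable Z.integrable_if_local_times by blast
  finally show ?thesis unfolding J_def[abs_def] .
qed

theorem theorem2p1:
  fixes M :: "'w measure" and P :: "'p measure"
    and X X' :: "real \<Rightarrow> 'w \<Rightarrow> 'a::euclidean_space"
    and \<Psi> :: "'a \<Rightarrow> complex"
    and w :: "(real \<times> 'a \<Rightarrow> real) \<Rightarrow> 'p \<Rightarrow> real"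
  assumes "levy_process M X"
    and "characteristic_exponent M X \<Psi>"
    and "levy_process M X'"
    and "independent_copy M X X'"
    and "white_noise P w"
  shows "(has_random_field_solutions P (heat_solution M X w)
            \<longleftrightarrow> has_local_times M (\<lambda>t \<omega>. X t \<omega> - X' t \<omega>))
       \<and> (symmetric_process M X \<longrightarrow>
            (has_random_field_solutions P (wave_solution \<Psi> w)
              \<longleftrightarrow> has_local_times M (\<lambda>t \<omega>. X t \<omega> - X' t \<omega>)))"
  using heat_random_field_iff[OF assms(1,2,5)] wave_random_field_iff[OF subquadratic_exponent_levy[OF assms(1,2)] assms(5)]
    symmetrization_local_times_iff[OF assms(1-4)]
  by simp

end
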